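(* Let $f:E\to X$ be a fibrewise pointed map over $B$ between fibrewise well-pointed spaces, and assume either that $E$ and $X$ are normal, or that $f$ is a closed fibrewise pointed cofibration and $X$ is normal. Then for every $n\ge0$ the following are equivalent: (i) $\mathrm{secat}^B_B(f)\le n$; (ii) the diagonal $\Delta_{n+1}:X\to\prod^{n+1}_BX$ factors up to fibrewise pointed homotopy through the fibrewise $n$-fat wedge, i.e. there is a fibrewise pointed map $\varphi:X\to T^n_B(f)$ with $j_n\varphi\simeq^B_B\Delta_{n+1}$; (iii) the $n$-th fibrewise Ganea map $p_n:G^n_B(f)\to X$ admits a fibrewise pointed homotopy section, i.e. a fibrewise pointed map $\sigma:X\to G^n_B(f)$ with $p_n\sigma\simeq^B_B\mathrm{id}_X$.
   Context: Fibrewise pointed space over $B$: a space $X$ with map $p_X:X\to B$ and section $s_X$; fibrewise pointed map: $p_Yf=p_X$, $fs_X=s_Y$. Fibrewise products $X\times_BY=\{(x,y):p_X(x)=p_Y(y)\}$ carry section $b\mapsto(s_X(b),s_Y(b))$; $\prod^n_BX$ is the $n$-fold product, $\Delta_{n+1}$ the diagonal. A fibrewise homotopy $H$ satisfies $p_Y(H(x,t))=p_X(x)$; it is fibrewise pointed if also $H(s_X(b),t)=s_Y(b)$ ($\simeq^B_B$). A fibrewise map $j:A\to X$ is a fibrewise cofibration if it has the homotopy extension property for fibrewise homotopies; closed if $j(A)$ is closed. A closed fibrewise pointed cofibration is a fibrewise pointed map with $j(A)$ closed having the homotopy extension property for fibrewise pointed homotopies. $X$ is fibrewise well-pointed if $s_X$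 is a closed fibrewise cofibration. $\mathrm{secat}^B_B(f)$: least $n$ such that $X$ is covered by $n+1$ open sets $U\supseteq s_X(B)$ each with a fibrewise pointed map $s:U\to E$, $fs\simeq^B_B$ inclusion ($\infty$ if none). Fibrewise (pointed) join: for fibrewise pointed $h:Y\to K$, $k:Z\to K$, let $P_B(K)=\{(b,\theta)\in B\times K^{[0,1]}:p_K\theta\equiv b\}$ and $E_{h,k}=\{(y,(b,\theta),z):h(y)=\theta(0),k(z)=\theta(1)\}$ with section $\sigma(b)=(s_Y(b),(b,\text{const}_{s_K(b)}),s_Z(b))$. The join is the quotient of $Y\sqcup(E_{h,k}\times[0,1])\sqcup Z$ by $(y,\xi,z,0)\sim y$, $(y,\xi,z,1)\sim z$, and collapsing each segment $\{\sigma(b)\}\times[0,1]$ to a point (identified with $s_Y(b)$ and $s_Z(b)$); its section is $b\mapsto s_Y(b)$, and the join map to $K$ is $h$, $k$ and $(y,(b,\theta),z,t)\mapsto\theta(t)$. $T^0_B(f)=E$, $j_0=f$; for $n\ge1$, $j_n:T^n_B(f)\to\prod^{n+1}_BX$ is the join map of the join of $f\times_B\mathrm{id}:E\times_B\prod^n_BX\to\prod^{n+1}_BX$ and $\mathrm{id}_X\times_Bj_{n-1}:X\times_BT^{n-1}_B(f)\to\prod^{n+1}_BX$. $G^0_B(f)=E$, $p_0=f$; for $n\ge1$, $p_n:G^n_B(f)\to X$ is the join map of the join of $p_{n-1}$ and $f$. *)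

theory Defs
  imports "HOL-Analysis.Analysis" "HOL-Library.Extended_Nat"
begin

record ('a, 'b) fsp =
  tsp :: "'a topology"
  prj :: "'a \<Rightarrow> 'b"
  sct :: "'b \<Rightarrow> 'a"

definition fibrewise_pointed_space :: "'b topology \<Rightarrow> ('a, 'b) fsp \<Rightarrow> bool" where
  "fibrewise_pointed_space B X \<longleftrightarrow>
     continuous_map (tsp X) B (prj X) \<and> continuous_map B (tsp X) (sct X) \<and>
     (\<forall>b\<in>topspace B. prj X (sct X b) = b)"

definition fp_map :: "'b topology \<Rightarrow> ('a, 'b) fsp \<Rightarrow> ('c, 'b) fsp \<Rightarrow> ('a \<Rightarrow> 'c) \<Rightarrow> bool" where
  "fp_map B X Y g \<longleftrightarrow>
     continuous_map (tsp X) (tsp Y) g \<and>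
     (\<forall>x\<in>topspace (tsp X). prj Y (g x) = prj X x) \<and>
     (\<forall>b\<in>topspace B. g (sct X b) = sct Y b)"

definition fp_homotopic ::
  "'b topology \<Rightarrow> ('a, 'b) fsp \<Rightarrow> ('c, 'b) fsp \<Rightarrow> ('a \<Rightarrow> 'c) \<Rightarrow> ('a \<Rightarrow> 'c) \<Rightarrow> bool" where
  "fp_homotopic B X Y g0 g1 \<longleftrightarrow>
     homotopic_with
       (\<lambda>g. (\<forall>x\<in>topspace (tsp X). prj Y (g x) = prj X x) \<and> (\<forall>b\<in>topspace B. g (sct X b) = sct Y b))
       (tsp X) (tsp Y) g0 g1"

definition fib_cofibration ::
  "'b topology \<Rightarrow> 'a topology \<Rightarrow> ('a \<Rightarrow> 'b) \<Rightarrow> 'c topology \<Rightarrow> ('c \<Rightarrow> 'b) \<Rightarrow> ('a \<Rightarrow> 'c)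
    \<Rightarrow> 'd itself \<Rightarrow> bool" where
  "fib_cofibration B A pA X pX j (_::'d itself) \<longleftrightarrow>
     continuous_map A X j \<and> (\<forall>a\<in>topspace A. pX (j a) = pA a) \<and>
     (\<forall>(Y::'d topology) pY g H.
        continuous_map Y B pY \<and> continuous_map X Y g \<and> (\<forall>x\<in>topspace X. pY (g x) = pX x) \<and>
        continuous_map (prod_topology A (top_of_set {0..1::real})) Y H \<and>
        (\<forall>a\<in>topspace A. \<forall>t\<in>{0..1}. pY (H (a, t)) = pA a) \<and>
        (\<forall>a\<in>topspace A. H (a, 0) = g (j a))
        \<longrightarrow> (\<exists>G. continuous_map (prod_topology X (top_of_set {0..1::real})) Y G \<and>
               (\<forall>x\<in>topspace X. \<forall>t\<in>{0..1}. pY (G (x, t)) = pX x) \<and>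
               (\<forall>x\<in>topspace X. G (x, 0) = g x) \<and>
               (\<forall>a\<in>topspace A. \<forall>t\<in>{0..1}. G (j a, t) = H (a, t))))"

definition fib_well_pointed :: "'b topology \<Rightarrow> ('a, 'b) fsp \<Rightarrow> 'd itself \<Rightarrow> bool" where
  "fib_well_pointed B X D \<longleftrightarrow>
     closedin (tsp X) (sct X ` topspace B) \<and>
     fib_cofibration B B id (tsp X) (prj X) (sct X) D"

definition fp_closed_cofibration ::
  "'b topology \<Rightarrow> ('a, 'b) fsp \<Rightarrow> ('c, 'b) fsp \<Rightarrow> ('a \<Rightarrow> 'c) \<Rightarrow> 'd itself \<Rightarrow> bool" where
  "fp_closed_cofibration B A X j (_::'d itself) \<longleftrightarrow>
     fp_map B A X j \<and> closedin (tsp X) (j ` topspace (tsp A)) \<and>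
     (\<forall>(Y::('d, 'b) fsp) g H.
        fibrewise_pointed_space B Y \<and> fp_map B X Y g \<and>
        continuous_map (prod_topology (tsp A) (top_of_set {0..1::real})) (tsp Y) H \<and>
        (\<forall>a\<in>topspace (tsp A). \<forall>t\<in>{0..1}. prj Y (H (a, t)) = prj A a) \<and>
        (\<forall>b\<in>topspace B. \<forall>t\<in>{0..1}. H (sct A b, t) = sct Y b) \<and>
        (\<forall>a\<in>topspace (tsp A). H (a, 0) = g (j a))
        \<longrightarrow> (\<exists>G. continuous_map (prod_topology (tsp X) (top_of_set {0..1::real})) (tsp Y) G \<and>
               (\<forall>x\<in>topspace (tsp X). \<forall>t\<in>{0..1}. prj Y (G (x, t)) = prj X x) \<and>
               (\<forall>b\<in>topspace B. \<forall>t\<in>{0..1}. G (sct X b, t) = sct Y b) \<and>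
               (\<forall>x\<in>topspace (tsp X). G (x, 0) = g x) \<and>
               (\<forall>a\<in>topspace (tsp A). \<forall>t\<in>{0..1}. G (j a, t) = H (a, t))))"

definition secat_le :: "'b topology \<Rightarrow> ('e, 'b) fsp \<Rightarrow> ('x, 'b) fsp \<Rightarrow> ('e \<Rightarrow> 'x) \<Rightarrow> nat \<Rightarrow> bool" where
  "secat_le B E X f n \<longleftrightarrow>
     (\<exists>U :: nat \<Rightarrow> 'x set.
        (\<Union>i\<le>n. U i) = topspace (tsp X) \<and>
        (\<forall>i\<le>n. openin (tsp X) (U i) \<and> sct X ` topspace B \<subseteq> U i \<and>
           (\<exists>s. fp_map B (X\<lparr>tsp := subtopology (tsp X) (U i)\<rparr>) E s \<and>
                fp_homotopic B (X\<lparr>tsp := subtopology (tsp X) (U i)\<rparr>) X (f \<circ> s) id)))"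

text \<open>Least n with an (n+1)-element cover as above; \<infinity> if there is none (Inf {} = \<infinity>).\<close>
definition secat :: "'b topology \<Rightarrow> ('e, 'b) fsp \<Rightarrow> ('x, 'b) fsp \<Rightarrow> ('e \<Rightarrow> 'x) \<Rightarrow> enat" where
  "secat B E X f = Inf {enat n | n. secat_le B E X f n}"

text \<open>Points of all spaces built below (E, X, iterated fibrewise products, joins) are encoded
  in one datatype: UE/UX embed E and X, UP forms pairs (fibre products), UL/UR/UJ are the
  three summands Y, E_{h,k} x [0,1], Z of the join before taking the quotient, and UC is an
  extra cylinder coordinate (so the universe also contains mapping cylinders).\<close>
datatype ('b, 'e, 'x) U =
    UE 'e | UX 'x | UP "('b, 'e, 'x) U" "('b, 'e, 'x) U"
  | UL "('b, 'e, 'x) U" | UR "('b, 'e, 'x) U"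
  | UJ "('b, 'e, 'x) U" 'b "real \<Rightarrow> ('b, 'e, 'x) U" "('b, 'e, 'x) U" real
  | UC "('b, 'e, 'x) U" real

type_synonym ('b, 'e, 'x) usp = "(('b, 'e, 'x) U, 'b) fsp"

definition final_top :: "'a topology \<Rightarrow> ('a \<Rightarrow> 'u) \<Rightarrow> 'u topology" where
  "final_top T g = topology (\<lambda>S. S \<subseteq> g ` topspace T \<and> openin T {x \<in> topspace T. g x \<in> S})"

definition final_top3 :: "'p topology \<Rightarrow> ('p \<Rightarrow> 'u) \<Rightarrow> 'q topology \<Rightarrow> ('q \<Rightarrow> 'u)
    \<Rightarrow> 'r topology \<Rightarrow> ('r \<Rightarrow> 'u) \<Rightarrow> 'u topology" where
  "final_top3 T1 g1 T2 g2 T3 g3 = topology (\<lambda>S.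
     S \<subseteq> g1 ` topspace T1 \<union> g2 ` topspace T2 \<union> g3 ` topspace T3 \<and>
     openin T1 {x \<in> topspace T1. g1 x \<in> S} \<and>
     openin T2 {x \<in> topspace T2. g2 x \<in> S} \<and>
     openin T3 {x \<in> topspace T3. g3 x \<in> S})"

definition liftE :: "('e, 'b) fsp \<Rightarrow> ('b, 'e, 'x) usp" where
  "liftE E = \<lparr>tsp = final_top (tsp E) UE,
              prj = (\<lambda>u. case u of UE e \<Rightarrow> prj E e | _ \<Rightarrow> undefined),
              sct = (\<lambda>b. UE (sct E b))\<rparr>"

definition liftX :: "('x, 'b) fsp \<Rightarrow> ('b, 'e, 'x) usp" where
  "liftX X = \<lparr>tsp = final_top (tsp X) UX,
              prj = (\<lambda>u. case u of UX x \<Rightarrow> prj X x | _ \<Rightarrow> undefined),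
              sct = (\<lambda>b. UX (sct X b))\<rparr>"

definition liftf :: "('e \<Rightarrow> 'x) \<Rightarrow> ('b, 'e, 'x) U \<Rightarrow> ('b, 'e, 'x) U" where
  "liftf f = (\<lambda>u. case u of UE e \<Rightarrow> UX (f e) | _ \<Rightarrow> undefined)"

definition fprod :: "('b, 'e, 'x) usp \<Rightarrow> ('b, 'e, 'x) usp \<Rightarrow> ('b, 'e, 'x) usp" where
  "fprod X Y = \<lparr>tsp = final_top (subtopology (prod_topology (tsp X) (tsp Y))
                                    {(x, y). prj X x = prj Y y}) (\<lambda>(x, y). UP x y),
                prj = (\<lambda>u. case u of UP x y \<Rightarrow> prj X x | _ \<Rightarrow> undefined),
                sct = (\<lambda>b. UP (sct X b) (sct Y b))\<rparr>"

text \<open>fpow X n is the (n+1)-fold fibrewise product; diag n is the diagonal \<Delta>_{n+1}.\<close>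
primrec fpow :: "('b, 'e, 'x) usp \<Rightarrow> nat \<Rightarrow> ('b, 'e, 'x) usp" where
  "fpow X 0 = X"
| "fpow X (Suc n) = fprod X (fpow X n)"

primrec diag :: "nat \<Rightarrow> ('b, 'e, 'x) U \<Rightarrow> ('b, 'e, 'x) U" where
  "diag 0 = (\<lambda>x. x)"
| "diag (Suc n) = (\<lambda>x. UP x (diag n x))"

text \<open>Paths [0,1] \<rightarrow> K (normalised to be undefined outside [0,1]) with the compact-open topology.\<close>
definition paths :: "'a topology \<Rightarrow> (real \<Rightarrow> 'a) set" where
  "paths K = {\<theta>. continuous_map (top_of_set {0..1}) K \<theta> \<and> \<theta> \<in> extensional {0..1}}"

definition path_top :: "'a topology \<Rightarrow> (real \<Rightarrow> 'a) topology" where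
  "path_top K = topology_generated_by
     {{\<theta> \<in> paths K. \<theta> ` C \<subseteq> V} | C V. compact C \<and> C \<subseteq> {0..1} \<and> openin K V}"

definition PB :: "'b topology \<Rightarrow> ('a, 'b) fsp \<Rightarrow> ('b \<times> (real \<Rightarrow> 'a)) topology" where
  "PB B K = subtopology (prod_topology B (path_top (tsp K)))
              {(b, \<theta>). \<forall>t\<in>{0..1}. prj K (\<theta> t) = b}"

definition Ehk :: "'b topology \<Rightarrow> ('y, 'b) fsp \<Rightarrow> ('z, 'b) fsp \<Rightarrow> ('a, 'b) fsp
    \<Rightarrow> ('y \<Rightarrow> 'a) \<Rightarrow> ('z \<Rightarrow> 'a) \<Rightarrow> ('y \<times> ('b \<times> (real \<Rightarrow> 'a)) \<times> 'z) topology" where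
  "Ehk B Y Z K h k = subtopology (prod_topology (tsp Y) (prod_topology (PB B K) (tsp Z)))
     {(y, (b, \<theta>), z). h y = \<theta> 0 \<and> k z = \<theta> 1}"

definition const_path :: "'a \<Rightarrow> real \<Rightarrow> 'a" where
  "const_path a = restrict (\<lambda>_. a) {0..1}"

definition join_rel :: "'b topology \<Rightarrow> ('b, 'e, 'x) usp \<Rightarrow> ('b, 'e, 'x) usp \<Rightarrow> ('b, 'e, 'x) usp
    \<Rightarrow> (('b, 'e, 'x) U \<Rightarrow> ('b, 'e, 'x) U) \<Rightarrow> (('b, 'e, 'x) U \<Rightarrow> ('b, 'e, 'x) U)
    \<Rightarrow> ('b, 'e, 'x) U \<Rightarrow> ('b, 'e, 'x) U \<Rightarrow> bool" where
  "join_rel B Y Z K h k u v \<longleftrightarrow>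
     (\<exists>y b \<theta> z. (y, (b, \<theta>), z) \<in> topspace (Ehk B Y Z K h k) \<and>
        ((u = UJ y b \<theta> z 0 \<and> v = UL y) \<or> (u = UJ y b \<theta> z 1 \<and> v = UR z))) \<or>
     (\<exists>b\<in>topspace B. \<exists>t\<in>{0..1}.
        u = UJ (sct Y b) b (const_path (sct K b)) (sct Z b) t \<and> v = UL (sct Y b)) \<or>
     (\<exists>b\<in>topspace B. u = UR (sct Z b) \<and> v = UL (sct Y b))"

definition join_rep :: "'b topology \<Rightarrow> ('b, 'e, 'x) usp \<Rightarrow> ('b, 'e, 'x) usp \<Rightarrow> ('b, 'e, 'x) usp
    \<Rightarrow> (('b, 'e, 'x) U \<Rightarrow> ('b, 'e, 'x) U) \<Rightarrow> (('b, 'e, 'x) U \<Rightarrow> ('b, 'e, 'x) U)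
    \<Rightarrow> ('b, 'e, 'x) U \<Rightarrow> ('b, 'e, 'x) U" where
  "join_rep B Y Z K h k u = (SOME v. equivclp (join_rel B Y Z K h k) u v)"

text \<open>The fibrewise pointed join of h : Y \<rightarrow> K and k : Z \<rightarrow> K, together with the join map to K.
  The join carries the quotient topology of the disjoint union Y \<squnion> (E_{h,k} \<times> [0,1]) \<squnion> Z.\<close>
definition fjoin :: "'b topology \<Rightarrow> ('b, 'e, 'x) usp \<Rightarrow> ('b, 'e, 'x) usp \<Rightarrow> ('b, 'e, 'x) usp
    \<Rightarrow> (('b, 'e, 'x) U \<Rightarrow> ('b, 'e, 'x) U) \<Rightarrow> (('b, 'e, 'x) U \<Rightarrow> ('b, 'e, 'x) U)
    \<Rightarrow> ('b, 'e, 'x) usp \<times> (('b, 'e, 'x) U \<Rightarrow> ('b, 'e, 'x) U)" where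
  "fjoin B Y Z K h k =
     (let r = join_rep B Y Z K h k in
      (\<lparr>tsp = final_top3
                (tsp Y) (\<lambda>y. r (UL y))
                (prod_topology (Ehk B Y Z K h k) (top_of_set {0..1::real}))
                  (\<lambda>((y, (b, \<theta>), z), t). r (UJ y b \<theta> z t))
                (tsp Z) (\<lambda>z. r (UR z)),
        prj = (\<lambda>u. case u of UL y \<Rightarrow> prj Y y | UR z \<Rightarrow> prj Z z | UJ y b \<theta> z t \<Rightarrow> b
                            | _ \<Rightarrow> undefined),
        sct = (\<lambda>b. r (UL (sct Y b)))\<rparr>,
       (\<lambda>u. case u of UL y \<Rightarrow> h y | UR z \<Rightarrow> k z | UJ y b \<theta> z t \<Rightarrow> \<theta> t | _ \<Rightarrow> undefined)))"

fun fatwedge :: "'b topology \<Rightarrow> ('b, 'e, 'x) usp \<Rightarrow> ('b, 'e, 'x) usp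
    \<Rightarrow> (('b, 'e, 'x) U \<Rightarrow> ('b, 'e, 'x) U) \<Rightarrow> nat
    \<Rightarrow> ('b, 'e, 'x) usp \<times> (('b, 'e, 'x) U \<Rightarrow> ('b, 'e, 'x) U)" where
  "fatwedge B E X f 0 = (E, f)"
| "fatwedge B E X f (Suc n) =
     (let (T, j) = fatwedge B E X f n in
      fjoin B (fprod E (fpow X n)) (fprod X T) (fpow X (Suc n))
        (\<lambda>u. case u of UP e w \<Rightarrow> UP (f e) w | _ \<Rightarrow> undefined)
        (\<lambda>u. case u of UP x w \<Rightarrow> UP x (j w) | _ \<Rightarrow> undefined))"

fun ganea :: "'b topology \<Rightarrow> ('b, 'e, 'x) usp \<Rightarrow> ('b, 'e, 'x) usp
    \<Rightarrow> (('b, 'e, 'x) U \<Rightarrow> ('b, 'e, 'x) U) \<Rightarrow> nat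
    \<Rightarrow> ('b, 'e, 'x) usp \<times> (('b, 'e, 'x) U \<Rightarrow> ('b, 'e, 'x) U)" where
  "ganea B E X f 0 = (E, f)"
| "ganea B E X f (Suc n) = (let (G, p) = ganea B E X f n in fjoin B G E X p f)"

end

theory Submission
  imports Defs
begin

text \<open>
  Both constructions are iterated joins, so everything reduces to one join of \<open>h : Y \<rightarrow> K\<close> and
  \<open>k : Z \<rightarrow> K\<close>. A map \<open>W \<rightarrow> K\<close> that lifts up to homotopy through \<open>h\<close> where \<open>\<tau> < 1\<close> and through \<open>k\<close>
  where \<open>\<tau> > 0\<close> lifts through the join, with join parameter a clamped multiple of \<open>\<tau>\<close>: it is locally
  constant near the ends, which makes the map continuous for the quotient topology. Normality of \<open>X\<close>
  turns the open cover that witnesses \<open>secat\<close> into such functions.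

  Conversely, the part \<open>t < 2/3\<close> of the join deforms to \<open>Y\<close>, and by symmetry the part \<open>t > 1/3\<close> deforms
  to \<open>Z\<close>; but \<open>t\<close> is undefined on the section, which every member of the cover has to contain. Since
  \<open>X\<close> is well-pointed there are a homotopy \<open>id \<simeq> c\<close> and an open \<open>V\<close> around the section that \<open>c\<close> retracts
  to the section, and similarly for \<open>E\<close>. After composing with \<open>c\<close>, all lifts and homotopies become equal
  to the section on a neighbourhood of it. They can therefore be glued to the section before passing to
  the quotient, and the glued maps descend to the join. The property is thus inherited by joins, so the
  argument can be iterated.
\<close>

subsection \<open>Topological preliminaries\<close>

abbreviation unit_interval :: "real topology" where
  "unit_interval \<equiv> top_of_set {0..1}"

lemma continuous_map_mem: "continuous_map X Y f \<Longrightarrow> x \<in> topspace X \<Longrightarrow> f x \<in> topspace Y"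
  by (auto dest: continuous_map_funspace)

lemma continuous_map_unit_interval_real:
  "continuous_map (prod_topology X unit_interval) euclideanreal snd"
  "continuous_map (prod_topology unit_interval X) euclideanreal fst"
  by (rule continuous_map_into_fulltopology[OF continuous_map_snd]
      continuous_map_into_fulltopology[OF continuous_map_fst])+

lemma continuous_map_open_cover:
  assumes "topspace X \<subseteq> \<Union>\<U>"
    and "\<And>U. U \<in> \<U> \<Longrightarrow> openin X U" "\<And>U. U \<in> \<U> \<Longrightarrow> continuous_map (subtopology X U) Y f"
  shows "continuous_map X Y f"
  by (rule pasting_lemma[where I = \<U> and T = "\<lambda>U. U" and f = "\<lambda>_. f"]) (use assms in auto)

lemma continuous_map_paste_open:
  assumes "openin X S" "openin X T"
    and "continuous_map (subtopology X S) Y f" "continuous_map (subtopology X T) Y g"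
    and "\<And>x. x \<in> S \<inter> T \<Longrightarrow> f x = g x"
  shows "continuous_map (subtopology X (S \<union> T)) Y (\<lambda>x. if x \<in> T then g x else f x)"
proof (rule pasting_lemma[where I = UNIV and
      T = "\<lambda>b. if b then T else S" and f = "\<lambda>b. if b then g else f"])
  have "(S \<union> T) \<inter> S = S" "(S \<union> T) \<inter> T = T" by auto
  thus "continuous_map (subtopology (subtopology X (S \<union> T)) (if b then T else S)) Y
    (if b then g else f)" for b
    using assms(3,4) by (simp add: subtopology_subtopology)
  show "openin (subtopology X (S \<union> T)) (if b then T else S)" for b
    using assms(1,2) by (auto simp: openin_subtopology)
qed (use assms(5) in \<open>auto split: if_splits\<close>)

lemma openin_forall_compact:
  assumes T: "compact_space T" and F: "continuous_map (prod_topology X T) Y F" and V: "openin Y V"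
  shows "openin X {x \<in> topspace X. \<forall>t\<in>topspace T. F (x, t) \<in> V}"
proof -
  let ?C = "{p \<in> topspace (prod_topology X T). F p \<in> topspace Y - V}"
  have "closedin (prod_topology X T) ?C"
    by (rule closedin_continuous_map_preimage[OF F closedin_diff[OF closedin_topspace V]])
  hence "closedin X (fst ` ?C)"
    using closed_map_fst[OF T] unfolding closed_map_def by blast
  moreover have "topspace X - fst ` ?C = {x \<in> topspace X. \<forall>t\<in>topspace T. F (x, t) \<in> V}"
    using continuous_map_mem[OF F] by (force simp: image_iff)
  ultimately show ?thesis by (metis openin_diff openin_topspace)
qed

lemma openin_preimage_Int:
  assumes "openin T {x \<in> topspace T. g x \<in> S}" "openin T {x \<in> topspace T. g x \<in> S'}"
  shows "openin T {x \<in> topspace T. g x \<in> S \<inter> S'}"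
  using openin_Int[OF assms] by (simp add: Collect_conj_eq Int_ac)

lemma openin_preimage_Union:
  assumes "\<And>K. K \<in> \<K> \<Longrightarrow> openin T {x \<in> topspace T. g x \<in> K}"
  shows "openin T {x \<in> topspace T. g x \<in> \<Union>\<K>}"
proof -
  have "{x \<in> topspace T. g x \<in> \<Union>\<K>} = (\<Union>K\<in>\<K>. {x \<in> topspace T. g x \<in> K})" by auto
  thus ?thesis using assms by auto
qed

lemma openin_final_top:
  "openin (final_top T g) S \<longleftrightarrow> S \<subseteq> g ` topspace T \<and> openin T {x \<in> topspace T. g x \<in> S}"
proof -
  have "istopology (\<lambda>S. S \<subseteq> g ` topspace T \<and> openin T {x \<in> topspace T. g x \<in> S})"
    unfolding istopology_def
    by (intro conjI allI impI openin_preimage_Int openin_preimage_Union) (blast | simp)+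
  thus ?thesis unfolding final_top_def by (simp add: topology_inverse')
qed

lemma topspace_final_top [simp]: "topspace (final_top T g) = g ` topspace T"
proof (rule subset_antisym)
  show "g ` topspace T \<subseteq> topspace (final_top T g)"
    by (rule openin_subset) (simp add: openin_final_top cong: conj_cong)
qed (metis openin_final_top openin_topspace)

lemma quotient_map_final_top: "quotient_map T (final_top T g) g"
  by (auto simp: quotient_map_def openin_final_top)

lemma openin_final_top3:
  "openin (final_top3 T1 g1 T2 g2 T3 g3) S \<longleftrightarrow>
     S \<subseteq> g1 ` topspace T1 \<union> g2 ` topspace T2 \<union> g3 ` topspace T3 \<and>
     openin T1 {x \<in> topspace T1. g1 x \<in> S} \<and>
     openin T2 {x \<in> topspace T2. g2 x \<in> S} \<and>
     openin T3 {x \<in> topspace T3. g3 x \<in> S}"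
proof -
  have "istopology (\<lambda>S. S \<subseteq> g1 ` topspace T1 \<union> g2 ` topspace T2 \<union> g3 ` topspace T3 \<and>
     openin T1 {x \<in> topspace T1. g1 x \<in> S} \<and>
     openin T2 {x \<in> topspace T2. g2 x \<in> S} \<and>
     openin T3 {x \<in> topspace T3. g3 x \<in> S})"
    unfolding istopology_def
    by (intro conjI allI impI openin_preimage_Int openin_preimage_Union) (blast | simp)+
  thus ?thesis unfolding final_top3_def by (simp add: topology_inverse')
qed

lemma topspace_final_top3 [simp]:
  "topspace (final_top3 T1 g1 T2 g2 T3 g3) = g1 ` topspace T1 \<union> g2 ` topspace T2 \<union> g3 ` topspace T3"
    (is "_ = ?R")
proof (rule subset_antisym)
  show "?R \<subseteq> topspace (final_top3 T1 g1 T2 g2 T3 g3)"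
    by (rule openin_subset) (auto simp: openin_final_top3 cong: conj_cong)
qed (metis openin_final_top3 openin_topspace)

subsection \<open>Path spaces\<close>

lemma Union_path_subbasis:
  "\<Union>{{\<theta> \<in> paths K. \<theta> ` C \<subseteq> V} |C V. compact C \<and> C \<subseteq> {0..1::real} \<and> openin K V} = paths K"
  (is "\<Union>?S = _")
proof
  have "{\<theta> \<in> paths K. \<theta> ` {} \<subseteq> {}} \<in> ?S" by blast
  thus "paths K \<subseteq> \<Union>?S" by auto
qed auto

lemma topspace_path_top [simp]: "topspace (path_top K) = paths K"
  unfolding path_top_def topology_generated_by_topspace by (rule Union_path_subbasis)

lemma restrict_mem_paths:
  assumes "continuous_map (prod_topology W unit_interval) K F" "x \<in> topspace W"
  shows "(\<lambda>t\<in>{0..1}. F (x, t)) \<in> paths K"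
proof -
  have "continuous_map unit_interval (prod_topology W unit_interval) (\<lambda>t. (x, t))"
    using assms(2) by (simp add: continuous_map_pairwise o_def)
  from continuous_map_compose[OF this assms(1)]
  have "continuous_map unit_interval K (\<lambda>t\<in>{0..1}. F (x, t))"
    by (rule continuous_map_eq) simp
  thus ?thesis by (simp add: paths_def)
qed

lemma continuous_map_curry_path:
  assumes F: "continuous_map (prod_topology W unit_interval) K F"
  shows "continuous_map W (path_top K) (\<lambda>x. \<lambda>t\<in>{0..1}. F (x, t))"
  unfolding path_top_def
proof (rule continuous_on_generated_topo)
  show "(\<lambda>x. \<lambda>t\<in>{0..1}. F (x, t)) ` topspace W
      \<subseteq> \<Union> {{\<theta> \<in> paths K. \<theta> ` C \<subseteq> V} |C V. compact C \<and> C \<subseteq> {0..1} \<and> openin K V}"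
    unfolding Union_path_subbasis using restrict_mem_paths[OF F] by blast
  fix S assume "S \<in> {{\<theta> \<in> paths K. \<theta> ` C \<subseteq> V} |C V. compact C \<and> C \<subseteq> {0..1} \<and> openin K V}"
  then obtain C V where S: "S = {\<theta> \<in> paths K. \<theta> ` C \<subseteq> V}" and C: "compact C" "C \<subseteq> {0..1}"
    and V: "openin K V" by blast
  have "continuous_map (prod_topology W (top_of_set C)) K F"
    using continuous_map_from_subtopology[OF F, of "topspace W \<times> C"] C(2)
    by (simp add: subtopology_Times subtopology_subtopology Int_absorb1)
  hence "openin W {x \<in> topspace W. \<forall>t\<in>topspace (top_of_set C). F (x, t) \<in> V}"
    using V C(1) by (intro openin_forall_compact) (auto simp: compact_space_subtopology)
  moreover have "(\<lambda>x. \<lambda>t\<in>{0..1}. F (x, t)) -` S \<inter> topspace W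
     = {x \<in> topspace W. \<forall>t\<in>topspace (top_of_set C). F (x, t) \<in> V}"
    using restrict_mem_paths[OF F] C(2) unfolding S by (auto simp: image_subset_iff subset_eq)
  ultimately show "openin W ((\<lambda>x. \<lambda>t\<in>{0..1}. F (x, t)) -` S \<inter> topspace W)" by simp
qed

lemma continuous_map_eval_path:
  "continuous_map (prod_topology (path_top K) unit_interval) K (\<lambda>(\<theta>, t). \<theta> t)"
proof -
  have "openin (prod_topology (path_top K) unit_interval) {p \<in> paths K \<times> {0..1}. (\<lambda>(\<theta>, t). \<theta> t) p \<in> V}"
    (is "openin ?P ?S") if V: "openin K V" for V
  proof (subst openin_subopen, intro ballI)
    fix p assume "p \<in> ?S"
    then obtain \<theta> t where p: "p = (\<theta>, t)" and \<theta>: "\<theta> \<in> paths K" and t: "t \<in> {0..1}" "\<theta> t \<in> V" by auto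
    have "openin unit_interval {s \<in> {0..1}. \<theta> s \<in> V}"
      using \<theta> V by (auto simp: paths_def continuous_map_def)
    then obtain e where e: "e > 0" "\<And>s. s \<in> {0..1} \<Longrightarrow> dist s t < e \<Longrightarrow> \<theta> s \<in> V"
      using t unfolding openin_euclidean_subtopology_iff by blast
    define C where "C = cball t (e/2) \<inter> {0..1}"
    have C: "compact C" "C \<subseteq> {0..1}" by (auto simp: C_def intro: compact_Int_closed)
    have "openin (path_top K) {\<eta> \<in> paths K. \<eta> ` C \<subseteq> V}"
      unfolding path_top_def using C V by (intro topology_generated_by_Basis) blast
    moreover have "openin unit_interval ({0..1} \<inter> ball t (e/2))"
      by (simp add: openin_open_Int)
    ultimately have "openin ?P ({\<eta> \<in> paths K. \<eta> ` C \<subseteq> V} \<times> ({0..1} \<inter> ball t (e/2)))"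
      by (simp add: openin_prod_Times_iff)
    moreover have "p \<in> {\<eta> \<in> paths K. \<eta> ` C \<subseteq> V} \<times> ({0..1} \<inter> ball t (e/2))"
      using p \<theta> t e by (auto simp: C_def dist_commute)
    moreover have "{\<eta> \<in> paths K. \<eta> ` C \<subseteq> V} \<times> ({0..1} \<inter> ball t (e/2)) \<subseteq> ?S"
      unfolding C_def by auto
    ultimately show "\<exists>T. openin ?P T \<and> p \<in> T \<and> T \<subseteq> ?S" by blast
  qed
  moreover have "\<theta> t \<in> topspace K" if "\<theta> \<in> paths K" "t \<in> {0..1}" for \<theta> t
    using that by (auto simp: paths_def continuous_map_def)
  ultimately show ?thesis by (auto simp: continuous_map_def)
qed

lemma continuous_map_path_at:
  assumes "continuous_map W (path_top K) \<Theta>" "continuous_map W unit_interval t"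
  shows "continuous_map W K (\<lambda>w. \<Theta> w (t w))"
  using continuous_map_compose[OF continuous_map_pairedI[OF assms] continuous_map_eval_path]
  by (simp add: o_def)

subsection \<open>Homotopies\<close>

lemma homotopic_withI:
  assumes "continuous_map (prod_topology unit_interval X) Y H"
    and "\<And>x. x \<in> topspace X \<Longrightarrow> H (0, x) = p x" and "\<And>x. x \<in> topspace X \<Longrightarrow> H (1, x) = q x"
    and "\<And>h k. (\<And>x. x \<in> topspace X \<Longrightarrow> h x = k x) \<Longrightarrow> P h = P k"
    and "\<And>t. t \<in> {0..1} \<Longrightarrow> P (\<lambda>x. H (t, x))"
  shows "homotopic_with P X Y p q"
  using assms by (subst homotopic_with) blast+

lemma homotopic_with_compose_left:
  assumes "homotopic_with P X1 X2 f g" "continuous_map X2 X3 h"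
    and "\<And>k. continuous_map X1 X2 k \<Longrightarrow> P k \<Longrightarrow> Q (h \<circ> k)"
  shows "homotopic_with Q X1 X3 (h \<circ> f) (h \<circ> g)"
proof -
  have "homotopic_with (\<lambda>k. continuous_map X1 X2 k \<and> P k) X1 X2 f g"
    by (rule homotopic_with_mono[OF assms(1)]) auto
  thus ?thesis by (rule homotopic_with_compose_continuous_map_left[OF _ assms(2)])
    (use assms(3) in auto)
qed

lemma homotopic_with_paste_open:
  assumes A: "openin X A" and M: "openin X M"
    and hom: "homotopic_with P (subtopology X A) Y p q"
    and s: "continuous_map (subtopology X M) Y s"
    and eq: "\<And>k u. P k \<Longrightarrow> u \<in> A \<inter> M \<Longrightarrow> k u = s u"
    and Q: "\<And>k. P k \<Longrightarrow> Q (\<lambda>u. if u \<in> M then s u else k u)"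
  shows "homotopic_with Q (subtopology X (A \<union> M)) Y
    (\<lambda>u. if u \<in> M then s u else p u) (\<lambda>u. if u \<in> M then s u else q u)"
proof -
  obtain H where H: "continuous_map (prod_topology unit_interval (subtopology X A)) Y H"
    and H01: "\<And>u. H (0, u) = p u" "\<And>u. H (1, u) = q u"
    and HP: "\<And>t. t \<in> {0..1} \<Longrightarrow> P (\<lambda>u. H (t, u))"
    using hom unfolding homotopic_with_def by blast
  have sub: "prod_topology unit_interval (subtopology X S) =
      subtopology (prod_topology unit_interval X) ({0..1} \<times> S)" for S
    using prod_topology_subtopology(2)[of unit_interval X S] by simp
  have "continuous_map (subtopology (prod_topology unit_interval X) ({0..1} \<times> A \<union> {0..1} \<times> M)) Y
      (\<lambda>p. if p \<in> {0..1} \<times> M then (s \<circ> snd) p else H p)"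
  proof (rule continuous_map_paste_open)
    show "continuous_map (subtopology (prod_topology unit_interval X) ({0..1} \<times> M)) Y (s \<circ> snd)"
      unfolding sub[symmetric] by (rule continuous_map_compose[OF continuous_map_snd s])
  qed (use A M H eq[OF HP] in \<open>auto simp: sub openin_prod_Times_iff\<close>)
  hence "continuous_map (prod_topology unit_interval (subtopology X (A \<union> M))) Y
      (\<lambda>(t, u). if u \<in> M then s u else H (t, u))"
    unfolding sub Sigma_Un_distrib2 by (rule continuous_map_eq) (auto simp: mem_Times_iff)
  thus ?thesis
    unfolding homotopic_with_def using H01 HP Q
    by (intro exI[of _ "\<lambda>(t, u). if u \<in> M then s u else H (t, u)"]) auto
qed

subsection \<open>Fibrewise pointed spaces and maps\<close>

abbreviation fsub :: "('a, 'b) fsp \<Rightarrow> 'a set \<Rightarrow> ('a, 'b) fsp" where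
  "fsub X S \<equiv> X\<lparr>tsp := subtopology (tsp X) S\<rparr>"

lemma fsub_fsub: "S' \<subseteq> S \<Longrightarrow> fsub (fsub X S) S' = fsub X S'"
  by (simp add: subtopology_subtopology Int_absorb1)

lemma sct_mem: "fibrewise_pointed_space B X \<Longrightarrow> b \<in> topspace B \<Longrightarrow> sct X b \<in> topspace (tsp X)"
  by (auto simp: fibrewise_pointed_space_def dest: continuous_map_mem)

lemma prj_mem: "fibrewise_pointed_space B X \<Longrightarrow> x \<in> topspace (tsp X) \<Longrightarrow> prj X x \<in> topspace B"
  by (auto simp: fibrewise_pointed_space_def dest: continuous_map_mem)

lemma prj_sct: "fibrewise_pointed_space B X \<Longrightarrow> b \<in> topspace B \<Longrightarrow> prj X (sct X b) = b"
  by (auto simp: fibrewise_pointed_space_def)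

lemma fibrewise_pointed_space_fsub:
  assumes "fibrewise_pointed_space B X" "sct X ` topspace B \<subseteq> S"
  shows "fibrewise_pointed_space B (fsub X S)"
  using assms by (auto simp: fibrewise_pointed_space_def continuous_map_in_subtopology
      intro: continuous_map_from_subtopology)

lemma fp_map_continuous: "fp_map B X Y g \<Longrightarrow> continuous_map (tsp X) (tsp Y) g"
  by (simp add: fp_map_def)

lemma fp_map_mem: "fp_map B X Y g \<Longrightarrow> x \<in> topspace (tsp X) \<Longrightarrow> g x \<in> topspace (tsp Y)"
  by (auto simp: fp_map_def dest: continuous_map_mem)

lemma fp_map_prj: "fp_map B X Y g \<Longrightarrow> x \<in> topspace (tsp X) \<Longrightarrow> prj Y (g x) = prj X x"
  by (simp add: fp_map_def)

lemma fp_map_sct: "fp_map B X Y g \<Longrightarrow> b \<in> topspace B \<Longrightarrow> g (sct X b) = sct Y b"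
  by (simp add: fp_map_def)

lemma fp_map_id: "fp_map B X X id"
  by (simp add: fp_map_def)

lemma fp_map_compose: "fp_map B X Y g \<Longrightarrow> fp_map B Y Z h \<Longrightarrow> fp_map B X Z (h \<circ> g)"
  unfolding fp_map_def by (auto intro: continuous_map_compose dest: continuous_map_mem)

lemma fp_map_restrict: "fp_map B X Y g \<Longrightarrow> fp_map B (fsub X S) Y g"
  by (auto simp: fp_map_def intro: continuous_map_from_subtopology)

lemma fp_map_eq:
  assumes "fibrewise_pointed_space B X" "fp_map B X Y g" "\<And>x. x \<in> topspace (tsp X) \<Longrightarrow> g x = g' x"
  shows "fp_map B X Y g'"
  using assms sct_mem[OF assms(1)] unfolding fp_map_def by (auto intro: continuous_map_eq)

lemma fp_homotopicI:
  assumes X: "fibrewise_pointed_space B X"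
    and "continuous_map (prod_topology unit_interval (tsp X)) (tsp Y) H"
    and "\<And>x. x \<in> topspace (tsp X) \<Longrightarrow> H (0, x) = g0 x" "\<And>x. x \<in> topspace (tsp X) \<Longrightarrow> H (1, x) = g1 x"
    and "\<And>t x. t \<in> {0..1} \<Longrightarrow> x \<in> topspace (tsp X) \<Longrightarrow> prj Y (H (t, x)) = prj X x"
    and "\<And>t b. t \<in> {0..1} \<Longrightarrow> b \<in> topspace B \<Longrightarrow> H (t, sct X b) = sct Y b"
  shows "fp_homotopic B X Y g0 g1"
  unfolding fp_homotopic_def
  by (rule homotopic_withI[OF assms(2)]) (use assms sct_mem[OF X] in auto)

lemma fp_homotopicE:
  assumes "fp_homotopic B X Y g0 g1"
  obtains H where "continuous_map (prod_topology unit_interval (tsp X)) (tsp Y) H"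
    "\<And>x. H (0, x) = g0 x" "\<And>x. H (1, x) = g1 x"
    "\<And>t x. t \<in> {0..1} \<Longrightarrow> x \<in> topspace (tsp X) \<Longrightarrow> prj Y (H (t, x)) = prj X x"
    "\<And>t b. t \<in> {0..1} \<Longrightarrow> b \<in> topspace B \<Longrightarrow> H (t, sct X b) = sct Y b"
  using assms unfolding fp_homotopic_def homotopic_with_def by auto

lemma fp_homotopic_imp_fp_map:
  assumes "fp_homotopic B X Y g0 g1" shows "fp_map B X Y g1"
  using assms homotopic_with_imp_property homotopic_with_imp_continuous_maps
  unfolding fp_homotopic_def fp_map_def by blast

lemma fp_homotopic_refl: "fp_map B X Y g \<Longrightarrow> fp_homotopic B X Y g g"
  unfolding fp_homotopic_def fp_map_def by simp

lemma fp_homotopic_sym: "fp_homotopic B X Y g0 g1 \<Longrightarrow> fp_homotopic B X Y g1 g0"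
  unfolding fp_homotopic_def by (rule homotopic_with_symD)

lemma fp_homotopic_trans:
  "fp_homotopic B X Y g0 g1 \<Longrightarrow> fp_homotopic B X Y g1 g2 \<Longrightarrow> fp_homotopic B X Y g0 g2"
  unfolding fp_homotopic_def by (rule homotopic_with_trans)

lemma fp_homotopic_compose_left:
  assumes "fp_homotopic B X Y g0 g1" "fp_map B Y Z h"
  shows "fp_homotopic B X Z (h \<circ> g0) (h \<circ> g1)"
  using assms unfolding fp_homotopic_def fp_map_def
  by (auto intro!: homotopic_with_compose_left dest: continuous_map_mem)

lemma fp_homotopic_compose_right:
  assumes "fp_homotopic B Y Z g0 g1" "fp_map B X Y h"
  shows "fp_homotopic B X Z (g0 \<circ> h) (g1 \<circ> h)"
  using assms unfolding fp_homotopic_def fp_map_def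
  by (auto intro!: homotopic_with_compose_continuous_map_right dest: continuous_map_mem)

lemma fp_homotopic_restrict:
  assumes "fp_homotopic B X Y g0 g1" shows "fp_homotopic B (fsub X S) Y g0 g1"
  using homotopic_with_mono[OF homotopic_from_subtopology[OF assms[unfolded fp_homotopic_def]]]
  by (simp add: fp_homotopic_def)

lemma fp_homotopic_eq:
  assumes X: "fibrewise_pointed_space B X" and "fp_homotopic B X Y g0 g1"
    and "\<And>x. x \<in> topspace (tsp X) \<Longrightarrow> g0 x = g0' x" "\<And>x. x \<in> topspace (tsp X) \<Longrightarrow> g1 x = g1' x"
  shows "fp_homotopic B X Y g0' g1'"
  using assms(2) unfolding fp_homotopic_def
  by (rule homotopic_with_eq) (use assms(3,4) sct_mem[OF X] in auto)

definition fp_lifts :: "'b topology \<Rightarrow> ('w, 'b) fsp \<Rightarrow> ('y, 'b) fsp \<Rightarrow> ('k, 'b) fsp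
    \<Rightarrow> ('y \<Rightarrow> 'k) \<Rightarrow> ('w \<Rightarrow> 'k) \<Rightarrow> bool" where
  "fp_lifts B W Y K h g \<longleftrightarrow> (\<exists>\<alpha>. fp_map B W Y \<alpha> \<and> fp_homotopic B W K (h \<circ> \<alpha>) g)"

lemma fp_liftsI: "fp_map B W Y \<alpha> \<Longrightarrow> fp_homotopic B W K (h \<circ> \<alpha>) g \<Longrightarrow> fp_lifts B W Y K h g"
  unfolding fp_lifts_def by blast

lemma fp_lifts_restrict: "fp_lifts B W Y K h g \<Longrightarrow> fp_lifts B (fsub W S) Y K h g"
  unfolding fp_lifts_def using fp_map_restrict fp_homotopic_restrict by blast

lemma fp_lifts_fsub_mono:
  assumes "fp_lifts B (fsub W S) Y K h g" "S' \<subseteq> S"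
  shows "fp_lifts B (fsub W S') Y K h g"
  using fp_lifts_restrict[OF assms(1), of S'] unfolding fsub_fsub[OF assms(2)] .

lemma fp_lifts_transport:
  assumes W': "fibrewise_pointed_space B W'" and lift: "fp_lifts B W Y K h g"
    and r: "fp_map B W' W r" and a: "fp_map B Y Y' a" and i: "fp_map B K K' i"
    and h': "\<And>y. y \<in> topspace (tsp Y) \<Longrightarrow> h' (a y) = i (h y)"
    and g': "\<And>w. w \<in> topspace (tsp W') \<Longrightarrow> g' w = i (g (r w))"
  shows "fp_lifts B W' Y' K' h' g'"
proof -
  obtain s where s: "fp_map B W Y s" "fp_homotopic B W K (h \<circ> s) g"
    using lift unfolding fp_lifts_def by blast
  have sr: "fp_map B W' Y (s \<circ> r)" by (rule fp_map_compose[OF r s(1)])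
  have "fp_homotopic B W' K' (i \<circ> (h \<circ> s) \<circ> r) (i \<circ> g \<circ> r)"
    by (intro fp_homotopic_compose_right[OF _ r] fp_homotopic_compose_left[OF _ i] s)
  hence "fp_homotopic B W' K' (h' \<circ> (a \<circ> (s \<circ> r))) g'"
    by (rule fp_homotopic_eq[OF W']) (use h' g' fp_map_mem[OF sr] in auto)
  thus ?thesis by (rule fp_liftsI[OF fp_map_compose[OF sr a]])
qed

lemma secat_le_iff_fp_lifts:
  "secat_le B E X f n \<longleftrightarrow> (\<exists>U. (\<Union>i\<le>n. U i) = topspace (tsp X) \<and>
     (\<forall>i\<le>n. openin (tsp X) (U i) \<and> sct X ` topspace B \<subseteq> U i \<and> fp_lifts B (fsub X (U i)) E X f id))"
  unfolding secat_le_def fp_lifts_def ..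

definition fp_iso :: "'b topology \<Rightarrow> ('a, 'b) fsp \<Rightarrow> ('c, 'b) fsp \<Rightarrow> ('a \<Rightarrow> 'c) \<Rightarrow> ('c \<Rightarrow> 'a) \<Rightarrow> bool" where
  "fp_iso B X X' i r \<longleftrightarrow> fp_map B X X' i \<and> fp_map B X' X r \<and>
     (\<forall>x\<in>topspace (tsp X). r (i x) = x) \<and> (\<forall>u\<in>topspace (tsp X'). i (r u) = u)"

lemma fp_iso_sym: "fp_iso B X X' i r \<Longrightarrow> fp_iso B X' X r i"
  by (auto simp: fp_iso_def)

lemma fp_iso_homeomorphic_maps: "fp_iso B X X' i r \<Longrightarrow> homeomorphic_maps (tsp X) (tsp X') i r"
  by (auto simp: fp_iso_def homeomorphic_maps_def fp_map_def)

lemma fp_iso_final_top: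
  assumes "tsp X' = final_top (tsp X) i" "\<And>x. r (i x) = x"
    and "\<And>x. prj X' (i x) = prj X x" "\<And>b. sct X' b = i (sct X b)"
  shows "fp_iso B X X' i r"
proof -
  have "continuous_map (tsp X') (tsp X) r"
    unfolding assms(1)
    by (rule continuous_compose_quotient_map[OF quotient_map_final_top]) (simp add: o_def assms(2))
  thus ?thesis
    using quotient_imp_continuous_map[OF quotient_map_final_top[of "tsp X" i]] assms
    by (auto simp: fp_iso_def fp_map_def)
qed

lemma fibrewise_pointed_space_iso:
  assumes X: "fibrewise_pointed_space B X" and iso: "fp_iso B X X' i r"
  shows "fibrewise_pointed_space B X'"
  unfolding fibrewise_pointed_space_def
proof (intro conjI ballI)
  have i: "fp_map B X X' i" and r: "fp_map B X' X r" using iso by (simp_all add: fp_iso_def)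
  have pX: "continuous_map (tsp X) B (prj X)" and sX: "continuous_map B (tsp X) (sct X)"
    using X by (simp_all add: fibrewise_pointed_space_def)
  show "continuous_map (tsp X') B (prj X')"
    by (rule continuous_map_eq[OF continuous_map_compose[OF fp_map_continuous[OF r] pX]])
      (simp add: fp_map_prj[OF r])
  show "continuous_map B (tsp X') (sct X')"
    by (rule continuous_map_eq[OF continuous_map_compose[OF sX fp_map_continuous[OF i]]])
      (simp add: fp_map_sct[OF i])
  show "prj X' (sct X' b) = b" if "b \<in> topspace B" for b
    using that fp_map_prj[OF i sct_mem[OF X that]] by (simp add: fp_map_sct[OF i] prj_sct[OF X])
qed

lemma closedin_sct_iso:
  assumes iso: "fp_iso B X X' i r" and closed: "closedin (tsp X) (sct X ` topspace B)"
  shows "closedin (tsp X') (sct X' ` topspace B)"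
proof -
  have "i ` sct X ` topspace B = sct X' ` topspace B"
    using iso by (auto simp: fp_iso_def fp_map_sct image_image)
  thus ?thesis
    using homeomorphic_map_closedness[OF homeomorphic_maps_imp_map[OF fp_iso_homeomorphic_maps[OF iso]]
        closedin_subset[OF closed]] closed by simp
qed

lemma secat_le_iso_imp:
  assumes X: "fp_iso B X X' i r" and X': "fibrewise_pointed_space B X'" and a: "fp_map B E E' a"
    and f: "\<And>e. e \<in> topspace (tsp E) \<Longrightarrow> f' (a e) = i (f e)"
    and "secat_le B E X f n"
  shows "secat_le B E' X' f' n"
proof -
  have i: "fp_map B X X' i" and r: "fp_map B X' X r"
    and ri: "\<And>u. u \<in> topspace (tsp X') \<Longrightarrow> i (r u) = u" using X by (simp_all add: fp_iso_def)
  obtain U where U: "(\<Union>i\<le>n. U i) = topspace (tsp X)"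
    and Ui: "\<And>i. i \<le> n \<Longrightarrow> openin (tsp X) (U i) \<and> sct X ` topspace B \<subseteq> U i \<and>
      fp_lifts B (fsub X (U i)) E X f id"
    using \<open>secat_le B E X f n\<close> unfolding secat_le_iff_fp_lifts by blast
  define U' where "U' k = {u \<in> topspace (tsp X'). r u \<in> U k}" for k
  have U': "openin (tsp X') (U' k)" "sct X' ` topspace B \<subseteq> U' k" if "k \<le> n" for k
    using Ui[OF that] openin_continuous_map_preimage[OF fp_map_continuous[OF r], of "U k"]
      fp_map_sct[OF r] sct_mem[OF X'] by (auto simp: U'_def)
  moreover have "fp_lifts B (fsub X' (U' k)) E' X' f' id" if k: "k \<le> n" for k
  proof (rule fp_lifts_transport[OF fibrewise_pointed_space_fsub[OF X' U'(2)[OF k]] _ _ a i])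
    show "fp_lifts B (fsub X (U k)) E X f id" using Ui[OF k] by simp
    show "fp_map B (fsub X' (U' k)) (fsub X (U k)) r"
      using fp_map_restrict[OF r, of "U' k"]
        by (auto simp: fp_map_def continuous_map_in_subtopology U'_def)
  qed (use f ri in auto)
  moreover have "(\<Union>k\<le>n. U' k) = topspace (tsp X')"
    using U fp_map_mem[OF r] by (auto simp: U'_def)
  ultimately show ?thesis unfolding secat_le_iff_fp_lifts by blast
qed

lemma secat_le_iso:
  assumes "fp_iso B E E' a a'" "fp_iso B X X' i r"
    and "fibrewise_pointed_space B X" "fibrewise_pointed_space B X'"
    and f: "fp_map B E X f" "\<And>e. e \<in> topspace (tsp E) \<Longrightarrow> f' (a e) = i (f e)"
  shows "secat_le B E' X' f' n \<longleftrightarrow> secat_le B E X f n"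
proof
  assume "secat_le B E' X' f' n"
  moreover have "f (a' e) = r (f' e)" if "e \<in> topspace (tsp E')" for e
    using that assms(1,2) f(2)[of "a' e"] fp_map_mem[OF f(1), of "a' e"] fp_map_mem[of B E' E a' e]
    by (auto simp: fp_iso_def)
  ultimately show "secat_le B E X f n"
    using secat_le_iso_imp[OF fp_iso_sym[OF assms(2)] assms(3), of E' E a'] assms(1)
    by (auto simp: fp_iso_def)
next
  assume "secat_le B E X f n"
  thus "secat_le B E' X' f' n"
    using secat_le_iso_imp[OF assms(2,4), of E E' a] assms(1) f(2) by (auto simp: fp_iso_def)
qed

subsection \<open>Halos of the section\<close>

definition section_cylinder :: "'b topology \<Rightarrow> ('a, 'b) fsp \<Rightarrow> ('a \<times> real) topology" where
  "section_cylinder B X = subtopology (prod_topology (tsp X) unit_interval)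
     {(x, t). t = 0 \<or> x \<in> sct X ` topspace B}"

lemma continuous_map_section_cylinder:
  "continuous_map (section_cylinder B X) (tsp X) fst"
  "continuous_map (section_cylinder B X) euclideanreal snd"
  unfolding section_cylinder_def
  by (rule continuous_map_from_subtopology[OF continuous_map_fst]
      continuous_map_from_subtopology[OF continuous_map_unit_interval_real(1)])+

lemma continuous_map_into_section_cylinder:
  assumes "continuous_map W (tsp X) g" "continuous_map W unit_interval t"
    and "\<And>w. w \<in> topspace W \<Longrightarrow> t w = 0 \<or> g w \<in> sct X ` topspace B"
  shows "continuous_map W (section_cylinder B X) (\<lambda>w. (g w, t w))"
  unfolding section_cylinder_def
  by (intro continuous_map_into_subtopology continuous_map_pairedI assms) (use assms(3) in auto)

lemma fib_cofibrationD:
  fixes Y :: "'d topology"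
  assumes "fib_cofibration B A pA X pX j TYPE('d)"
    and "continuous_map Y B pY" "continuous_map X Y g" "\<And>x. x \<in> topspace X \<Longrightarrow> pY (g x) = pX x"
    and "continuous_map (prod_topology A unit_interval) Y H"
    and "\<And>a t. a \<in> topspace A \<Longrightarrow> t \<in> {0..1} \<Longrightarrow> pY (H (a, t)) = pA a"
    and "\<And>a. a \<in> topspace A \<Longrightarrow> H (a, 0) = g (j a)"
  obtains G where "continuous_map (prod_topology X unit_interval) Y G"
    "\<And>x t. x \<in> topspace X \<Longrightarrow> t \<in> {0..1} \<Longrightarrow> pY (G (x, t)) = pX x"
    "\<And>x. x \<in> topspace X \<Longrightarrow> G (x, 0) = g x"
    "\<And>a t. a \<in> topspace A \<Longrightarrow> t \<in> {0..1} \<Longrightarrow> G (j a, t) = H (a, t)"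
proof -
  have "\<exists>G. continuous_map (prod_topology X unit_interval) Y G \<and>
      (\<forall>x\<in>topspace X. \<forall>t\<in>{0..1}. pY (G (x, t)) = pX x) \<and> (\<forall>x\<in>topspace X. G (x, 0) = g x) \<and>
      (\<forall>a\<in>topspace A. \<forall>t\<in>{0..1}. G (j a, t) = H (a, t))"
    using assms(1)[unfolded fib_cofibration_def, THEN conjunct2, THEN conjunct2,
        THEN spec[of _ Y], THEN spec[of _ pY], THEN spec[of _ g], THEN spec[of _ H]] assms(2-7)
    by simp
  thus thesis using that by blast
qed

text \<open>The homotopy extension property is only available for targets whose points lie in \<open>'d\<close>; the
  injection \<open>\<iota>\<close> moves the cylinder there.\<close>

lemma well_pointed_retraction:
  fixes X :: "('a, 'b) fsp" and \<iota> :: "'a \<times> real \<Rightarrow> 'd"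
  assumes inj: "inj \<iota>" and X: "fibrewise_pointed_space B X"
    and wp: "fib_well_pointed B X TYPE('d)"
  obtains \<gamma> where "continuous_map (prod_topology (tsp X) unit_interval) (section_cylinder B X) \<gamma>"
    "\<And>x t. x \<in> topspace (tsp X) \<Longrightarrow> t \<in> {0..1} \<Longrightarrow> prj X (fst (\<gamma> (x, t))) = prj X x"
    "\<And>x. x \<in> topspace (tsp X) \<Longrightarrow> \<gamma> (x, 0) = (x, 0)"
    "\<And>b t. b \<in> topspace B \<Longrightarrow> t \<in> {0..1} \<Longrightarrow> \<gamma> (sct X b, t) = (sct X b, t)"
proof -
  define S where "S = section_cylinder B X"
  define Y where "Y = final_top S \<iota>"
  have quot: "quotient_map S Y \<iota>" unfolding Y_def by (rule quotient_map_final_top)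
  have inv: "inv \<iota> (\<iota> p) = p" for p using inj by simp
  have inv_cont: "continuous_map Y S (inv \<iota>)"
    by (rule continuous_compose_quotient_map[OF quot]) (simp add: o_def inv)
  have pX: "continuous_map (tsp X) B (prj X)" and sX: "continuous_map B (tsp X) (sct X)"
    using X by (auto simp: fibrewise_pointed_space_def)
  have pY: "continuous_map Y B (prj X \<circ> fst \<circ> inv \<iota>)"
    using continuous_map_compose[OF continuous_map_compose[OF inv_cont] pX]
      continuous_map_section_cylinder(1)[of B X] by (simp add: S_def o_assoc)
  have bottom: "continuous_map (tsp X) S (\<lambda>x. (x, 0))"
    unfolding S_def by (rule continuous_map_into_section_cylinder) auto
  have side: "continuous_map (prod_topology B unit_interval) S (\<lambda>p. (sct X (fst p), snd p))"
    unfolding S_def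
    using continuous_map_compose[OF continuous_map_fst sX]
    by (intro continuous_map_into_section_cylinder continuous_map_snd) (auto simp: o_def)
  note \<iota>_cont = quotient_imp_continuous_map[OF quot]
  have cof: "fib_cofibration B B id (tsp X) (prj X) (sct X) TYPE('d)"
    using wp by (simp add: fib_well_pointed_def)
  obtain G where G: "continuous_map (prod_topology (tsp X) unit_interval) Y G"
    "\<And>x t. x \<in> topspace (tsp X) \<Longrightarrow> t \<in> {0..1} \<Longrightarrow> (prj X \<circ> fst \<circ> inv \<iota>) (G (x, t)) = prj X x"
    "\<And>x. x \<in> topspace (tsp X) \<Longrightarrow> G (x, 0) = (\<iota> \<circ> (\<lambda>x. (x, 0))) x"
    "\<And>b t. b \<in> topspace B \<Longrightarrow> t \<in> {0..1} \<Longrightarrow> G (sct X b, t) = (\<iota> \<circ> (\<lambda>p. (sct X (fst p), snd p))) (b, t)"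
    by (rule fib_cofibrationD[OF cof pY continuous_map_compose[OF bottom \<iota>_cont] _
          continuous_map_compose[OF side \<iota>_cont]]) (auto simp: inv prj_sct[OF X])
  show thesis
  proof (rule that[of "inv \<iota> \<circ> G"])
    show "continuous_map (prod_topology (tsp X) unit_interval) (section_cylinder B X) (inv \<iota> \<circ> G)"
      using continuous_map_compose[OF G(1) inv_cont] by (simp add: S_def)
  qed (use G(2-4) in \<open>auto simp: inv\<close>)
qed

definition section_halo :: "'b topology \<Rightarrow> ('a, 'b) fsp \<Rightarrow> 'a set \<Rightarrow> ('a \<Rightarrow> 'a) \<Rightarrow> bool" where
  "section_halo B X V c \<longleftrightarrow> openin (tsp X) V \<and> sct X ` topspace B \<subseteq> V \<and>
     fp_homotopic B X X id c \<and> (\<forall>x\<in>V. c x = sct X (prj X x))"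

lemma well_pointed_imp_halo:
  fixes X :: "('a, 'b) fsp" and \<iota> :: "'a \<times> real \<Rightarrow> 'd"
  assumes inj: "inj \<iota>" and X: "fibrewise_pointed_space B X"
    and wp: "fib_well_pointed B X TYPE('d)"
  shows "\<exists>V c. section_halo B X V c"
proof -
  obtain \<gamma> where \<gamma>: "continuous_map (prod_topology (tsp X) unit_interval) (section_cylinder B X) \<gamma>"
    and \<gamma>_prj: "\<And>x t. x \<in> topspace (tsp X) \<Longrightarrow> t \<in> {0..1} \<Longrightarrow> prj X (fst (\<gamma> (x, t))) = prj X x"
    and \<gamma>_0: "\<And>x. x \<in> topspace (tsp X) \<Longrightarrow> \<gamma> (x, 0) = (x, 0)"
    and \<gamma>_sct: "\<And>b t. b \<in> topspace B \<Longrightarrow> t \<in> {0..1} \<Longrightarrow> \<gamma> (sct X b, t) = (sct X b, t)"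
    by (rule well_pointed_retraction[OF inj X wp]) (rule that)
  define V where "V = {x \<in> topspace (tsp X). snd (\<gamma> (x, 1)) \<in> {0<..}}"
  define c where "c x = fst (\<gamma> (x, 1))" for x
  have "continuous_map (tsp X) (prod_topology (tsp X) unit_interval) (\<lambda>x. (x, 1))"
    by (auto simp: continuous_map_pairwise o_def)
  from continuous_map_compose[OF continuous_map_compose[OF this \<gamma>] continuous_map_section_cylinder(2)]
  have "openin (tsp X) V"
    unfolding V_def by (intro openin_continuous_map_preimage[of _ euclideanreal]) (auto simp: o_def)
  moreover have "fp_homotopic B X X id c"
  proof (rule fp_homotopicI[OF X])
    have "continuous_map (prod_topology unit_interval (tsp X))
      (prod_topology (tsp X) unit_interval) prod.swap"
      by (simp add: continuous_map_pairwise o_def continuous_map_fst continuous_map_snd prod.swap_def)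
    from continuous_map_compose[OF continuous_map_compose[OF this \<gamma>] continuous_map_section_cylinder(1)]
    show "continuous_map (prod_topology unit_interval (tsp X)) (tsp X) (fst \<circ> (\<gamma> \<circ> prod.swap))" .
  qed (auto simp: c_def \<gamma>_0 \<gamma>_prj \<gamma>_sct)
  moreover have "c x = sct X (prj X x)" if "x \<in> V" for x
  proof -
    have x: "x \<in> topspace (tsp X)" "snd (\<gamma> (x, 1)) > 0" using that by (auto simp: V_def)
    then obtain b where b: "b \<in> topspace B" "c x = sct X b"
      using continuous_map_mem[OF \<gamma>, of "(x, 1)"] by (auto simp: section_cylinder_def c_def)
    moreover have "prj X (c x) = prj X x" using \<gamma>_prj[of x 1] x by (simp add: c_def)
    ultimately show ?thesis by (simp add: prj_sct[OF X])
  qed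
  ultimately show ?thesis
    unfolding section_halo_def using sct_mem[OF X]
        by (auto simp: V_def \<gamma>_sct intro!: exI[of _ V] exI[of _ c])
qed

lemma section_halo_iso:
  assumes halo: "section_halo B X V c" and iso: "fp_iso B X X' i r"
    and X': "fibrewise_pointed_space B X'"
  shows "section_halo B X' {u \<in> topspace (tsp X'). r u \<in> V} (i \<circ> c \<circ> r)"
proof -
  have i: "fp_map B X X' i" and r: "fp_map B X' X r" and ir: "\<And>u. u \<in> topspace (tsp X') \<Longrightarrow> i (r u) = u"
    using iso by (simp_all add: fp_iso_def)
  have V: "openin (tsp X) V" "sct X ` topspace B \<subseteq> V" and c: "fp_homotopic B X X id c"
    and cV: "\<And>x. x \<in> V \<Longrightarrow> c x = sct X (prj X x)" using halo by (auto simp: section_halo_def)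
  have "fp_homotopic B X' X' id (i \<circ> c \<circ> r)"
    by (rule fp_homotopic_eq[OF X' fp_homotopic_compose_right[OF fp_homotopic_compose_left[OF c i] r]])
      (auto simp: ir)
  moreover have "(i \<circ> c \<circ> r) u = sct X' (prj X' u)" if "u \<in> topspace (tsp X')" "r u \<in> V" for u
    using that cV fp_map_prj[OF r] fp_map_sct[OF i prj_mem[OF X']] by simp
  ultimately show ?thesis
    unfolding section_halo_def
    using V openin_continuous_map_preimage[OF fp_map_continuous[OF r]] sct_mem[OF X'] fp_map_sct[OF r]
    by (auto simp: image_subset_iff)
qed

subsection \<open>The join as a quotient of a sum\<close>

locale join_data =
  fixes B :: "'b topology" and Y Z K :: "('b, 'e, 'x) usp"
    and h k :: "('b, 'e, 'x) U \<Rightarrow> ('b, 'e, 'x) U"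
  assumes Y: "fibrewise_pointed_space B Y" and Z: "fibrewise_pointed_space B Z"
    and K: "fibrewise_pointed_space B K" and h: "fp_map B Y K h" and k: "fp_map B Z K k"
begin

abbreviation "J \<equiv> fst (fjoin B Y Z K h k)"
abbreviation "jmap \<equiv> snd (fjoin B Y Z K h k)"
abbreviation "rel \<equiv> join_rel B Y Z K h k"
abbreviation "rep \<equiv> join_rep B Y Z K h k"

definition "EI = prod_topology (Ehk B Y Z K h k) unit_interval"

abbreviation "y_of q \<equiv> fst (fst q)"
abbreviation "b_of q \<equiv> fst (fst (snd (fst q)))"
abbreviation "path_of q \<equiv> snd (fst (snd (fst q)))"
abbreviation "z_of q \<equiv> snd (snd (fst q))"
abbreviation "seg q \<equiv> UJ (y_of q) (b_of q) (path_of q) (z_of q) (snd q)"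

definition "prejoin = final_top3 (tsp Y) UL EI (\<lambda>q. seg q) (tsp Z) UR"

lemma tsp_J: "tsp J =
  final_top3 (tsp Y) (\<lambda>y. rep (UL y)) EI (\<lambda>q. rep (seg q)) (tsp Z) (\<lambda>z. rep (UR z))"
  by (simp add: fjoin_def Let_def case_prod_unfold EI_def)

lemma prj_J: "prj J (UL y) = prj Y y" "prj J (UR z) = prj Z z" "prj J (UJ y b \<theta> z t) = b"
  by (simp_all add: fjoin_def Let_def)

lemma sct_J: "sct J b = rep (UL (sct Y b))"
  by (simp add: fjoin_def Let_def)

lemma jmap_simps: "jmap (UL y) = h y" "jmap (UR z) = k z" "jmap (UJ y b \<theta> z t) = \<theta> t"
  by (simp_all add: fjoin_def Let_def)

lemma mem_EI:
  "q \<in> topspace EI \<longleftrightarrow>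
     y_of q \<in> topspace (tsp Y) \<and> b_of q \<in> topspace B \<and> path_of q \<in> paths (tsp K) \<and>
     (\<forall>t\<in>{0..1}. prj K (path_of q t) = b_of q) \<and>
     z_of q \<in> topspace (tsp Z) \<and> h (y_of q) = path_of q 0 \<and> k (z_of q) = path_of q 1 \<and> snd q \<in> {0..1}"
  by (cases q) (auto simp: EI_def Ehk_def PB_def)

lemma prj_y_of: "q \<in> topspace EI \<Longrightarrow> prj Y (y_of q) = b_of q"
  using fp_map_prj[OF h, of "y_of q"] by (auto simp: mem_EI)

lemma prj_z_of: "q \<in> topspace EI \<Longrightarrow> prj Z (z_of q) = b_of q"
  using fp_map_prj[OF k, of "z_of q"] by (auto simp: mem_EI)

lemma continuous_map_components:
  "continuous_map EI (tsp Y) (\<lambda>q. y_of q)"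
  "continuous_map EI B (\<lambda>q. b_of q)"
  "continuous_map EI (path_top (tsp K)) (\<lambda>q. path_of q)"
  "continuous_map EI (tsp Z) (\<lambda>q. z_of q)"
  "continuous_map EI unit_interval snd"
proof -
  have "continuous_map (Ehk B Y Z K h k) (prod_topology (tsp Y) (prod_topology (PB B K) (tsp Z))) id"
    unfolding Ehk_def by (intro continuous_map_from_subtopology) simp
  from continuous_map_compose[OF continuous_map_fst this]
  have E: "continuous_map EI (tsp Y) (\<lambda>q. y_of q)" "continuous_map EI (PB B K) (\<lambda>q. fst (snd (fst q)))"
     "continuous_map EI (tsp Z) (\<lambda>q. z_of q)"
    by (auto simp: EI_def continuous_map_pairwise o_def)
  have "continuous_map (PB B K) (prod_topology B (path_top (tsp K))) id"
    unfolding PB_def by (intro continuous_map_from_subtopology) simp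
  from continuous_map_compose[OF E(2) this]
  show "continuous_map EI B (\<lambda>q. b_of q)" "continuous_map EI (path_top (tsp K)) (\<lambda>q. path_of q)"
    by (auto simp: continuous_map_pairwise o_def)
  show "continuous_map EI (tsp Y) (\<lambda>q. y_of q)" "continuous_map EI (tsp Z) (\<lambda>q. z_of q)"
    using E by simp_all
qed (simp add: EI_def continuous_map_snd)

lemma continuous_map_path_of:
  assumes "continuous_map W EI g" "continuous_map W euclideanreal \<tau>"
    and "\<And>w. w \<in> topspace W \<Longrightarrow> \<tau> w \<in> {0..1}"
  shows "continuous_map W (tsp K) (\<lambda>w. path_of (g w) (\<tau> w))"
proof (rule continuous_map_path_at)
  show "continuous_map W (path_top (tsp K)) (\<lambda>w. path_of (g w))"
    using continuous_map_compose[OF assms(1) continuous_map_components(3)] by (simp add: o_def)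
  show "continuous_map W unit_interval \<tau>"
    by (rule continuous_map_into_subtopology) (use assms(2,3) in auto)
qed

lemma continuous_map_into_EI:
  assumes "continuous_map W (tsp Y) \<alpha>" "continuous_map W B b" "continuous_map W (path_top (tsp K)) \<theta>"
    and "continuous_map W (tsp Z) \<beta>" "continuous_map W unit_interval t"
    and "\<And>w s. w \<in> topspace W \<Longrightarrow> s \<in> {0..1} \<Longrightarrow> prj K (\<theta> w s) = b w"
    and "\<And>w. w \<in> topspace W \<Longrightarrow> h (\<alpha> w) = \<theta> w 0" "\<And>w. w \<in> topspace W \<Longrightarrow> k (\<beta> w) = \<theta> w 1"
  shows "continuous_map W EI (\<lambda>w. ((\<alpha> w, (b w, \<theta> w), \<beta> w), t w))"
proof -
  have "continuous_map W (PB B K) (\<lambda>w. (b w, \<theta> w))"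
    unfolding PB_def
    by (rule continuous_map_into_subtopology) (use assms in \<open>auto simp: continuous_map_pairwise o_def\<close>)
  hence "continuous_map W (Ehk B Y Z K h k) (\<lambda>w. (\<alpha> w, (b w, \<theta> w), \<beta> w))"
    unfolding Ehk_def
    by (intro continuous_map_into_subtopology)
      (use assms in \<open>auto simp: continuous_map_pairwise o_def\<close>)
  thus ?thesis using assms(5) by (simp add: EI_def continuous_map_pairwise o_def)
qed

lemma topspace_prejoin: "topspace prejoin =
  UL ` topspace (tsp Y) \<union> (\<lambda>q. seg q) ` topspace EI \<union> UR ` topspace (tsp Z)"
  by (simp add: prejoin_def)

lemma mem_prejoin [simp]:
  "UL y \<in> topspace prejoin \<longleftrightarrow> y \<in> topspace (tsp Y)"
  "UJ y b \<theta> z t \<in> topspace prejoin \<longleftrightarrow> ((y, (b, \<theta>), z), t) \<in> topspace EI"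
  "UR z \<in> topspace prejoin \<longleftrightarrow> z \<in> topspace (tsp Z)"
  by (force simp: topspace_prejoin)+

lemma prejoin_cases:
  assumes "u \<in> topspace prejoin"
  obtains y where "y \<in> topspace (tsp Y)" "u = UL y"
  | q where "q \<in> topspace EI" "u = seg q"
  | z where "z \<in> topspace (tsp Z)" "u = UR z"
  using assms unfolding topspace_prejoin by blast

lemma openin_prejoin:
  "openin prejoin S \<longleftrightarrow> S \<subseteq> topspace prejoin \<and> openin (tsp Y) {y \<in> topspace (tsp Y). UL y \<in> S} \<and>
     openin EI {q \<in> topspace EI. seg q \<in> S} \<and> openin (tsp Z) {z \<in> topspace (tsp Z). UR z \<in> S}"
  by (simp add: prejoin_def openin_final_top3)

lemma continuous_map_into_prejoin:
  "continuous_map (tsp Y) prejoin UL" "continuous_map EI prejoin (\<lambda>q. seg q)"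
  "continuous_map (tsp Z) prejoin UR"
  by (auto simp: continuous_map_def openin_prejoin)

lemma continuous_map_from_prejoin:
  assumes S: "openin prejoin S"
    and Y: "continuous_map (subtopology (tsp Y) {y \<in> topspace (tsp Y). UL y \<in> S}) T (\<lambda>y. F (UL y))"
    and E: "continuous_map (subtopology EI {q \<in> topspace EI. seg q \<in> S}) T (\<lambda>q. F (seg q))"
    and Z: "continuous_map (subtopology (tsp Z) {z \<in> topspace (tsp Z). UR z \<in> S}) T (\<lambda>z. F (UR z))"
  shows "continuous_map (subtopology prejoin S) T F"
proof -
  have SD: "S \<subseteq> topspace prejoin" using S by (rule openin_subset)
  have "F u \<in> topspace T" if u: "u \<in> S" for u
    using subsetD[OF SD u]
    by (cases rule: prejoin_cases)
      (use u continuous_map_mem[OF Y] continuous_map_mem[OF E] continuous_map_mem[OF Z] in auto)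
  moreover have "openin prejoin {u \<in> S. F u \<in> V}" if V: "openin T V" for V
    using S openin_trans_full[OF openin_continuous_map_preimage[OF Y V]]
      openin_trans_full[OF openin_continuous_map_preimage[OF E V]]
      openin_trans_full[OF openin_continuous_map_preimage[OF Z V]]
    by (auto simp: openin_prejoin conj_assoc)
  moreover have "topspace (subtopology prejoin S) = S" using SD by auto
  ultimately show ?thesis
    unfolding continuous_map_def using S by (auto simp: openin_open_subtopology)
qed

lemma relE:
  assumes "rel u v"
  obtains (left) q where "q \<in> topspace EI" "u = seg q" "snd q = 0" "v = UL (y_of q)"
  | (right) q where "q \<in> topspace EI" "u = seg q" "snd q = 1" "v = UR (z_of q)"
  | (segment) b t where "b \<in> topspace B" "t \<in> {0..1}"
      "u = UJ (sct Y b) b (const_path (sct K b)) (sct Z b) t" "v = UL (sct Y b)"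
  | (ends) b where "b \<in> topspace B" "u = UR (sct Z b)" "v = UL (sct Y b)"
proof -
  consider y b \<theta> z where "(y, (b, \<theta>), z) \<in> topspace (Ehk B Y Z K h k)" "u = UJ y b \<theta> z 0" "v = UL y"
    | y b \<theta> z where "(y, (b, \<theta>), z) \<in> topspace (Ehk B Y Z K h k)" "u = UJ y b \<theta> z 1" "v = UR z"
    | b t where "b \<in> topspace B" "t \<in> {0..1}" "u = UJ (sct Y b) b (const_path (sct K b)) (sct Z b) t"
      "v = UL (sct Y b)"
    | b where "b \<in> topspace B" "u = UR (sct Z b)" "v = UL (sct Y b)"
    using assms unfolding join_rel_def by metis
  thus thesis
  proof cases
    case (1 y b \<theta> z) thus ?thesis using left[of "((y, (b, \<theta>), z), 0)"] by (simp add: EI_def)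
  next
    case (2 y b \<theta> z) thus ?thesis using right[of "((y, (b, \<theta>), z), 1)"] by (simp add: EI_def)
  qed (use segment ends in blast)+
qed

lemma const_path_mem_EI:
  assumes "b \<in> topspace B" "t \<in> {0..1}"
  shows "((sct Y b, (b, const_path (sct K b)), sct Z b), t) \<in> topspace EI"
proof -
  have "const_path (sct K b) \<in> paths (tsp K)"
    using restrict_mem_paths[of "tsp K" "tsp K" fst] sct_mem[OF K assms(1)]
    by (simp add: const_path_def continuous_map_fst)
  thus ?thesis using assms Y Z K
    by (auto simp: mem_EI const_path_def sct_mem prj_sct fp_map_sct[OF h] fp_map_sct[OF k])
qed

lemma rel_mem_prejoin: "rel u v \<Longrightarrow> u \<in> topspace prejoin \<and> v \<in> topspace prejoin"
proof (erule relE)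
  fix b and t :: real
  assume "b \<in> topspace B" "t \<in> {0..1}"
    and "u = UJ (sct Y b) b (const_path (sct K b)) (sct Z b) t" "v = UL (sct Y b)"
  thus ?thesis using const_path_mem_EI[of b t] sct_mem[OF Y] by simp
qed (auto simp: sct_mem[OF Y] sct_mem[OF Z] mem_EI)

lemma rep_eq:
  assumes "rel u v" shows "rep u = rep v"
proof -
  have "equivclp rel u w = equivclp rel v w" for w
    using assms by (meson equivclp_sym equivclp_trans r_into_equivclp)
  thus ?thesis by (simp add: join_rep_def)
qed

lemma rep_seg_0:
  assumes "q \<in> topspace EI" "snd q = 0" shows "rep (seg q) = rep (UL (y_of q))"
  by (rule rep_eq) (use assms in \<open>cases q; auto simp: join_rel_def EI_def\<close>)

lemma rep_seg_1:
  assumes "q \<in> topspace EI" "snd q = 1" shows "rep (seg q) = rep (UR (z_of q))"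
  by (rule rep_eq) (use assms in \<open>cases q; auto simp: join_rel_def EI_def\<close>)

lemma rep_sct_seg:
  assumes "b \<in> topspace B" "t \<in> {0..1}"
  shows "rep (UJ (sct Y b) b (const_path (sct K b)) (sct Z b) t) = sct J b"
  unfolding sct_J by (rule rep_eq) (use assms in \<open>auto simp: join_rel_def\<close>)

lemma rep_UR_sct: "b \<in> topspace B \<Longrightarrow> rep (UR (sct Z b)) = sct J b"
  unfolding sct_J by (rule rep_eq) (auto simp: join_rel_def)

text \<open>The points of the join are representatives chosen by \<open>SOME\<close>, so a function on the sum is at the
  same time a function on the join; it is the induced one exactly when it respects \<open>rel\<close>.\<close>

lemma rep_invariant:
  assumes "\<And>u v. rel u v \<Longrightarrow> F u = F v"
  shows "F (rep u) = F u"
proof -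
  have "equivclp rel u (rep u)"
    unfolding join_rep_def by (rule someI[of _ u]) (simp add: equivclp_def)
  hence "(\<lambda>a b. rel a b \<or> rel b a)\<^sup>*\<^sup>* u (rep u)"
    unfolding equivclp_def symclp_def .
  thus ?thesis by (induction rule: rtranclp_induct) (use assms in \<open>metis+\<close>)
qed

definition saturated :: "('b, 'e, 'x) U set \<Rightarrow> bool" where
  "saturated S \<longleftrightarrow> (\<forall>u v. rel u v \<longrightarrow> (u \<in> S \<longleftrightarrow> v \<in> S))"

definition join_invariant :: "('b, 'e, 'x) U set \<Rightarrow> (('b, 'e, 'x) U \<Rightarrow> 'c) \<Rightarrow> bool" where
  "join_invariant S F \<longleftrightarrow> (\<forall>u v. rel u v \<longrightarrow> u \<in> S \<longrightarrow> v \<in> S \<longrightarrow> F u = F v)"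

lemma join_invariantI: "(\<And>u v. rel u v \<Longrightarrow> F u = F v) \<Longrightarrow> join_invariant S F"
  by (simp add: join_invariant_def)

lemma join_invariant_subset: "join_invariant S F \<Longrightarrow> S' \<subseteq> S \<Longrightarrow> join_invariant S' F"
  by (auto simp: join_invariant_def)

lemma join_invariant_compose: "join_invariant S F \<Longrightarrow> join_invariant S (g \<circ> F)"
  by (auto simp: join_invariant_def)

lemma join_invariant_paste:
  assumes "saturated M" "join_invariant A F" "join_invariant M G"
  shows "join_invariant (A \<union> M) (\<lambda>u. if u \<in> M then G u else F u)"
  using assms unfolding join_invariant_def saturated_def by auto

lemma saturated_prejoin: "saturated (topspace prejoin)"
  using rel_mem_prejoin by (auto simp: saturated_def)

lemma rep_mem_iff: "saturated S \<Longrightarrow> rep u \<in> S \<longleftrightarrow> u \<in> S"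
  by (rule rep_invariant) (auto simp: saturated_def)

lemma join_invariant_rep:
  assumes S: "saturated S" and F: "join_invariant S F" and u: "u \<in> S"
  shows "F (rep u) = F u"
proof -
  have "(if rep u \<in> S then F (rep u) else undefined) = (if u \<in> S then F u else undefined)"
    by (rule rep_invariant) (use S F in \<open>auto simp: saturated_def join_invariant_def\<close>)
  thus ?thesis using u rep_mem_iff[OF S] by simp
qed

lemma topspace_J: "topspace (tsp J) = rep ` topspace prejoin"
  unfolding tsp_J topspace_final_top3 topspace_prejoin by (simp add: image_Un image_image)

lemma quotient_map_rep: "quotient_map prejoin (tsp J) rep"
proof -
  have "openin prejoin {u \<in> topspace prejoin. rep u \<in> S} \<longleftrightarrow> openin (tsp J) S"
    if "S \<subseteq> rep ` topspace prejoin" for S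
  proof -
    have "openin (tsp J) S \<longleftrightarrow> openin (tsp Y) {y \<in> topspace (tsp Y). rep (UL y) \<in> S} \<and>
        openin EI {q \<in> topspace EI. rep (seg q) \<in> S} \<and>
        openin (tsp Z) {z \<in> topspace (tsp Z). rep (UR z) \<in> S}"
      using that unfolding topspace_J[symmetric]
        unfolding tsp_J openin_final_top3 topspace_final_top3 by simp
    thus ?thesis by (simp add: openin_prejoin cong: conj_cong)
  qed
  thus ?thesis by (simp add: quotient_map_def topspace_J)
qed

lemma J_cases:
  assumes "u \<in> topspace (tsp J)"
  obtains y where "y \<in> topspace (tsp Y)" "u = rep (UL y)"
  | q where "q \<in> topspace EI" "u = rep (seg q)"
  | z where "z \<in> topspace (tsp Z)" "u = rep (UR z)"
  using assms unfolding tsp_J topspace_final_top3 by blast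

lemma rep_mem_J: "u \<in> topspace prejoin \<Longrightarrow> rep u \<in> topspace (tsp J)"
  by (rule continuous_map_mem[OF quotient_imp_continuous_map[OF quotient_map_rep]])

lemma J_subset_prejoin: "topspace (tsp J) \<subseteq> topspace prejoin"
  unfolding topspace_J using rep_mem_iff[OF saturated_prejoin] by auto

lemma quotient_map_rep_restrict:
  assumes "saturated S" "openin prejoin S"
  shows "openin (tsp J) (topspace (tsp J) \<inter> S)"
    "quotient_map (subtopology prejoin S) (subtopology (tsp J) S) rep"
proof -
  have pre: "{u \<in> topspace prejoin. rep u \<in> topspace (tsp J) \<inter> S} = S"
    using openin_subset[OF assms(2)] rep_mem_iff[OF assms(1)] rep_mem_J by auto
  show op: "openin (tsp J) (topspace (tsp J) \<inter> S)"
    using quotient_map_rep[unfolded quotient_map_def, THEN conjunct2, rule_format,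
        of "topspace (tsp J) \<inter> S"]
      pre assms(2) by simp
  show "quotient_map (subtopology prejoin S) (subtopology (tsp J) S) rep"
    using quotient_map_restriction[OF quotient_map_rep pre] op by (simp add: subtopology_restrict)
qed

lemma continuous_map_on_join:
  assumes S: "saturated S" "openin prejoin S" and F: "join_invariant S F"
    and cont: "continuous_map (subtopology prejoin S) T F"
  shows "continuous_map (subtopology (tsp J) S) T F"
proof (rule continuous_compose_quotient_map[OF quotient_map_rep_restrict(2)[OF S]])
  show "continuous_map (subtopology prejoin S) T (F \<circ> rep)"
    by (rule continuous_map_eq[OF cont]) (use join_invariant_rep[OF S(1) F] in auto)
qed

lemma homotopic_with_on_join:
  assumes S: "saturated S" "openin prejoin S" and P: "\<And>F. P F \<Longrightarrow> join_invariant S F"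
    and hom: "homotopic_with P (subtopology prejoin S) T p q"
  shows "homotopic_with P (subtopology (tsp J) S) T p q"
proof -
  obtain H where H: "continuous_map (prod_topology unit_interval (subtopology prejoin S)) T H"
    and H01: "\<forall>u. H (0, u) = p u" "\<forall>u. H (1, u) = q u" and HP: "\<forall>t\<in>{0..1}. P (\<lambda>u. H (t, u))"
    using hom unfolding homotopic_with_def by blast
  have H_rep: "H (t, rep u) = H (t, u)" if "t \<in> {0..1}" "u \<in> S" for t u
    using join_invariant_rep[OF S(1) P[OF bspec[OF HP that(1)]] that(2)] .
  have "quotient_map (prod_topology unit_interval (subtopology prejoin S))
      (prod_topology unit_interval (subtopology (tsp J) S)) (\<lambda>(t, u). (t, rep u))"
    by (rule quotient_map_prod_right[OF _ _ quotient_map_rep_restrict(2)[OF S]])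
      (simp_all add: Hausdorff_space_subtopology compact_imp_locally_compact_space
          compact_space_subtopology)
  hence "continuous_map (prod_topology unit_interval (subtopology (tsp J) S)) T H"
  proof (rule continuous_compose_quotient_map)
    show "continuous_map (prod_topology unit_interval (subtopology prejoin S)) T
      (H \<circ> (\<lambda>(t, u). (t, rep u)))"
      by (rule continuous_map_eq[OF H]) (use H_rep in auto)
  qed
  thus ?thesis unfolding homotopic_with_def using H01 HP by blast
qed

lemma continuous_map_from_join:
  assumes "join_invariant (topspace prejoin) F"
    and "continuous_map (tsp Y) T (\<lambda>y. F (UL y))" "continuous_map EI T (\<lambda>q. F (seg q))"
    and "continuous_map (tsp Z) T (\<lambda>z. F (UR z))"
  shows "continuous_map (tsp J) T F"
proof -
  have "continuous_map (subtopology prejoin (topspace prejoin)) T F"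
    by (rule continuous_map_from_prejoin)
      (use assms(2-4) in \<open>auto intro: continuous_map_from_subtopology\<close>)
  from continuous_map_on_join[OF saturated_prejoin openin_topspace assms(1) this]
  show ?thesis using J_subset_prejoin by (simp add: subtopology_superset)
qed

lemma rel_imp_prj_eq: "rel u v \<Longrightarrow> prj J u = prj J v"
  by (erule relE) (use Y Z in \<open>auto simp: prj_J prj_y_of prj_z_of prj_sct\<close>)

lemma rel_imp_jmap_eq: "rel u v \<Longrightarrow> jmap u = jmap v"
  by (erule relE) (auto simp: jmap_simps mem_EI const_path_def fp_map_sct[OF h] fp_map_sct[OF k])

lemma join_invariant_prj: "join_invariant S (prj J)"
  by (rule join_invariantI) (rule rel_imp_prj_eq)

lemma join_invariant_jmap: "join_invariant S jmap"
  by (rule join_invariantI) (rule rel_imp_jmap_eq)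

lemma prj_rep [simp]: "prj J (rep u) = prj J u"
  by (rule rep_invariant) (rule rel_imp_prj_eq)

lemma jmap_rep [simp]: "jmap (rep u) = jmap u"
  by (rule rep_invariant) (rule rel_imp_jmap_eq)

lemma fibrewise_pointed_space_J: "fibrewise_pointed_space B J"
  unfolding fibrewise_pointed_space_def
proof (intro conjI ballI)
  show "continuous_map (tsp J) B (prj J)"
    by (rule continuous_map_from_join[OF join_invariant_prj])
      (use Y Z continuous_map_components(2) in \<open>auto simp: prj_J fibrewise_pointed_space_def\<close>)
  have "continuous_map B (tsp Y) (sct Y)" using Y by (simp add: fibrewise_pointed_space_def)
  from continuous_map_compose[OF continuous_map_compose[OF this continuous_map_into_prejoin(1)]
      quotient_imp_continuous_map[OF quotient_map_rep]]
  show "continuous_map B (tsp J) (sct J)" by (simp add: o_def sct_J[abs_def])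
  show "prj J (sct J b) = b" if "b \<in> topspace B" for b
    using that by (simp add: sct_J prj_J prj_sct[OF Y])
qed

lemma fp_map_jmap: "fp_map B J K jmap"
  unfolding fp_map_def
proof (intro conjI ballI)
  show "continuous_map (tsp J) (tsp K) jmap"
    by (rule continuous_map_from_join[OF join_invariant_jmap])
      (use h k continuous_map_path_at[OF continuous_map_components(3,5)]
        in \<open>auto simp: jmap_simps fp_map_def\<close>)
  show "prj K (jmap u) = prj J u" if "u \<in> topspace (tsp J)" for u
    using that
    by (cases rule: J_cases)
      (auto simp: jmap_simps prj_J fp_map_prj[OF h] fp_map_prj[OF k] mem_EI)
  show "jmap (sct J b) = sct K b" if "b \<in> topspace B" for b
    using that by (simp add: sct_J jmap_simps fp_map_sct[OF h])
qed

lemma continuous_map_prejoin: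
  "continuous_map prejoin B (prj J)" "continuous_map prejoin (tsp K) jmap"
  using continuous_map_compose[OF quotient_imp_continuous_map[OF quotient_map_rep], of B "prj J"]
    continuous_map_compose[OF quotient_imp_continuous_map[OF quotient_map_rep]
      fp_map_continuous[OF fp_map_jmap]]
    fibrewise_pointed_space_J
  by (simp_all add: fibrewise_pointed_space_def o_def)

lemma prj_jmap: "u \<in> topspace prejoin \<Longrightarrow> prj K (jmap u) = prj J u"
  using fp_map_prj[OF fp_map_jmap rep_mem_J] by simp

end

subsection \<open>Exchanging the two sides of a join\<close>

definition swap_sides :: "('b, 'e, 'x) U \<Rightarrow> ('b, 'e, 'x) U" where
  "swap_sides u = (case u of UL y \<Rightarrow> UR y | UR z \<Rightarrow> UL z
     | UJ y b \<theta> z t \<Rightarrow> UJ z b (\<lambda>s\<in>{0..1}. \<theta> (1 - s)) y (1 - t) | _ \<Rightarrow> undefined)"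

lemma swap_sides_simps [simp]:
  "swap_sides (UL y) = UR y" "swap_sides (UR z) = UL z"
  "swap_sides (UJ y b \<theta> z t) = UJ z b (\<lambda>s\<in>{0..1}. \<theta> (1 - s)) y (1 - t)"
  by (simp_all add: swap_sides_def)

lemma (in join_data) join_data_swap: "join_data B Z Y K k h"
  using Y Z K h k by unfold_locales

context join_data
begin

interpretation swap: join_data B Z Y K k h by (rule join_data_swap)

lemma continuous_map_swap_EI:
  "continuous_map EI swap.EI
    (\<lambda>q. ((z_of q, (b_of q, \<lambda>s\<in>{0..1}. path_of q (1 - s)), y_of q), 1 - snd q))"
proof (rule swap.continuous_map_into_EI)
  have "continuous_map (prod_topology EI unit_interval) (tsp K) (\<lambda>p. path_of (fst p) (1 - snd p))"
    by (rule continuous_map_path_of[OF continuous_map_fst])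
      (auto intro!: continuous_map_diff continuous_map_unit_interval_real(1))
  from continuous_map_curry_path[OF this]
  show "continuous_map EI (path_top (tsp K)) (\<lambda>q. \<lambda>s\<in>{0..1}. path_of q (1 - s))" by simp
  have "continuous_map EI euclideanreal snd"
    by (rule continuous_map_into_fulltopology[OF continuous_map_components(5)])
  hence "continuous_map EI euclideanreal (\<lambda>q. 1 - snd q)" by (intro continuous_map_diff) auto
  thus "continuous_map EI unit_interval (\<lambda>q. 1 - snd q)"
    by (rule continuous_map_into_subtopology) (auto simp: mem_EI)
qed (simp_all add: continuous_map_components mem_EI)

definition flip :: "('b, 'e, 'x) U \<Rightarrow> ('b, 'e, 'x) U" where
  "flip u = swap.rep (swap_sides u)"

lemma rel_imp_flip_eq: "rel u v \<Longrightarrow> flip u = flip v"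
proof (erule relE)
  fix q assume q: "q \<in> topspace EI" "u = seg q" "snd q = 0" "v = UL (y_of q)"
  show "flip u = flip v"
    using swap.rep_seg_1[OF continuous_map_mem[OF continuous_map_swap_EI q(1)]] q
      by (simp add: flip_def)
next
  fix q assume q: "q \<in> topspace EI" "u = seg q" "snd q = 1" "v = UR (z_of q)"
  show "flip u = flip v"
    using swap.rep_seg_0[OF continuous_map_mem[OF continuous_map_swap_EI q(1)]] q
      by (simp add: flip_def)
next
  fix b and t :: real
  assume b: "b \<in> topspace B" "t \<in> {0..1}"
    and uv: "u = UJ (sct Y b) b (const_path (sct K b)) (sct Z b) t" "v = UL (sct Y b)"
  have "(\<lambda>s\<in>{0..1}. const_path (sct K b) (1 - s)) = const_path (sct K b)"
    by (auto simp: const_path_def)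
  thus "flip u = flip v"
    using swap.rep_sct_seg[of b "1 - t"] swap.rep_UR_sct b by (simp add: uv flip_def)
next
  fix b assume "b \<in> topspace B" "u = UR (sct Z b)" "v = UL (sct Y b)"
  thus "flip u = flip v" using swap.rep_UR_sct by (simp add: flip_def swap.sct_J)
qed

lemma flip_rep [simp]: "flip (rep u) = flip u"
  by (rule rep_invariant) (rule rel_imp_flip_eq)

lemma fp_map_flip: "fp_map B J swap.J flip"
  unfolding fp_map_def
proof (intro conjI ballI)
  note rep' = quotient_imp_continuous_map[OF swap.quotient_map_rep]
  show "continuous_map (tsp J) (tsp swap.J) flip"
  proof (rule continuous_map_from_join)
    show "continuous_map EI (tsp swap.J) (\<lambda>q. flip (seg q))"
      using continuous_map_compose[OF continuous_map_compose[OF continuous_map_swap_EI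
            swap.continuous_map_into_prejoin(2)] rep'] by (simp add: flip_def o_def)
    show "continuous_map (tsp Y) (tsp swap.J) (\<lambda>y. flip (UL y))"
      using continuous_map_compose[OF swap.continuous_map_into_prejoin(3) rep']
        by (simp add: flip_def o_def)
    show "continuous_map (tsp Z) (tsp swap.J) (\<lambda>z. flip (UR z))"
      using continuous_map_compose[OF swap.continuous_map_into_prejoin(1) rep']
        by (simp add: flip_def o_def)
  qed (rule join_invariantI, rule rel_imp_flip_eq)
  show "prj swap.J (flip u) = prj J u" if "u \<in> topspace (tsp J)" for u
    using that by (cases rule: J_cases)
      (auto simp: flip_def[of "UL _"] flip_def[of "UR _"] flip_def[of "UJ _ _ _ _ _"]
        prj_J swap.prj_J)
  show "flip (sct J b) = sct swap.J b" if "b \<in> topspace B" for b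
    using that by (simp add: sct_J) (simp add: flip_def swap.rep_UR_sct)
qed

lemma jmap_flip:
  assumes "u \<in> topspace (tsp J)" shows "swap.jmap (flip u) = jmap u"
  using assms by (cases rule: J_cases) (auto simp: flip_def[of "UL _"] flip_def[of "UR _"]
      flip_def[of "UJ _ _ _ _ _"] jmap_simps swap.jmap_simps mem_EI)

end

subsection \<open>Deforming part of the join into one side\<close>

context join_data
begin

definition left_region :: "('b, 'e, 'x) U set" where
  "left_region = {u \<in> topspace prejoin. case u of UL y \<Rightarrow> True | UJ y b \<theta> z t \<Rightarrow> t < 2/3 | _ \<Rightarrow> False}"

definition left_end :: "('b, 'e, 'x) U \<Rightarrow> ('b, 'e, 'x) U" where
  "left_end u = (case u of UL y \<Rightarrow> y | UJ y b \<theta> z t \<Rightarrow> y | _ \<Rightarrow> undefined)"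

definition left_track :: "('b, 'e, 'x) U \<Rightarrow> real \<Rightarrow> ('b, 'e, 'x) U" where
  "left_track u = (case u of UL y \<Rightarrow> (\<lambda>s\<in>{0..1}. h y)
     | UJ y b \<theta> z t \<Rightarrow> (\<lambda>s\<in>{0..1}. \<theta> (t * (1 - s))) | _ \<Rightarrow> undefined)"

lemma mem_left_region [simp]:
  "UL y \<in> left_region \<longleftrightarrow> y \<in> topspace (tsp Y)"
  "UJ y b \<theta> z t \<in> left_region \<longleftrightarrow> ((y, (b, \<theta>), z), t) \<in> topspace EI \<and> t < 2/3"
  "UR z \<notin> left_region"
  by (simp_all add: left_region_def)

lemma left_simps [simp]:
  "left_end (UL y) = y" "left_end (UJ y b \<theta> z t) = y"
  "left_track (UL y) = (\<lambda>s\<in>{0..1}. h y)"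
  "left_track (UJ y b \<theta> z t) = (\<lambda>s\<in>{0..1}. \<theta> (t * (1 - s)))"
  by (simp_all add: left_end_def left_track_def)

lemma left_region_cases:
  assumes "u \<in> left_region"
  obtains y where "y \<in> topspace (tsp Y)" "u = UL y"
  | q where "q \<in> topspace EI" "snd q < 2/3" "u = seg q"
proof -
  have "u \<in> topspace prejoin" using assms by (simp add: left_region_def)
  thus thesis by (cases rule: prejoin_cases) (use assms that in auto)
qed

lemma continuous_map_EI_snd: "continuous_map EI euclideanreal snd"
  by (rule continuous_map_into_fulltopology[OF continuous_map_components(5)])

lemma openin_EI_snd: "openin EI {q \<in> topspace EI. snd q < a}" "openin EI {q \<in> topspace EI. a < snd q}"
  using openin_continuous_map_preimage[OF continuous_map_EI_snd, of "{..<a}"]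
    openin_continuous_map_preimage[OF continuous_map_EI_snd, of "{a<..}"] by simp_all

lemma openin_left_region: "openin prejoin left_region"
  using openin_EI_snd(1)[of "2/3"] by (auto simp: openin_prejoin left_region_def cong: conj_cong)

lemma mult_diff_mem_unit: "t \<in> {0..1} \<Longrightarrow> s \<in> {0..1} \<Longrightarrow> t * (1 - s) \<in> {0..1::real}"
  by (auto intro: mult_le_one)

lemma continuous_map_track:
  "continuous_map (prod_topology EI unit_interval) (tsp K)
    (\<lambda>p. path_of (fst p) (snd (fst p) * (1 - snd p)))"
proof (rule continuous_map_path_of[OF continuous_map_fst])
  have "continuous_map (prod_topology EI unit_interval) euclideanreal (\<lambda>p. snd (fst p))"
    using continuous_map_compose[OF continuous_map_fst continuous_map_EI_snd] by (simp add: o_def)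
  thus "continuous_map (prod_topology EI unit_interval) euclideanreal (\<lambda>p. snd (fst p) * (1 - snd p))"
    by (intro continuous_map_real_mult continuous_map_diff continuous_map_unit_interval_real(1)) auto
qed (auto simp: mem_EI simp del: atLeastAtMost_iff intro!: mult_diff_mem_unit)

lemma continuous_map_left_end: "continuous_map (subtopology prejoin left_region) (tsp Y) left_end"
  by (rule continuous_map_from_prejoin[OF openin_left_region])
    (simp_all add: continuous_map_components continuous_map_from_subtopology)

lemma continuous_map_left_track:
  "continuous_map (subtopology prejoin left_region) (path_top (tsp K)) left_track"
proof (rule continuous_map_from_prejoin[OF openin_left_region])
  show "continuous_map (subtopology EI {q \<in> topspace EI. seg q \<in> left_region}) (path_top (tsp K))
      (\<lambda>q. left_track (seg q))"
    using continuous_map_curry_path[OF continuous_map_track]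
    by (intro continuous_map_from_subtopology) simp
  have "continuous_map (prod_topology (tsp Y) unit_interval) (tsp K) (h \<circ> fst)"
    by (rule continuous_map_compose[OF continuous_map_fst fp_map_continuous[OF h]])
  from continuous_map_curry_path[OF this]
  show "continuous_map (subtopology (tsp Y) {y \<in> topspace (tsp Y). UL y \<in> left_region})
    (path_top (tsp K))
      (\<lambda>y. left_track (UL y))"
    by (intro continuous_map_from_subtopology) simp
qed simp

lemma join_invariant_left_end: "join_invariant left_region left_end"
  by (auto simp: join_invariant_def elim!: relE)

lemma join_invariant_left_track: "join_invariant left_region left_track"
  unfolding join_invariant_def
proof (intro allI impI)
  fix u v assume "rel u v" and uv: "u \<in> left_region" "v \<in> left_region"
  thus "left_track u = left_track v"
  proof (cases rule: relE)
    case (segment b t)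
    have "const_path (sct K b) (t * (1 - s)) = sct K b" if "s \<in> {0..1}" for s
      using mult_diff_mem_unit[OF segment(2) that] by (simp add: const_path_def)
    thus ?thesis using segment fp_map_sct[OF h] by (auto intro: restrict_ext)
  qed (use uv in \<open>auto simp: mem_EI\<close>)
qed

lemma left_track_ends:
  assumes "u \<in> left_region"
  shows "left_track u 0 = jmap u" "left_track u 1 = h (left_end u)"
  using assms by (cases rule: left_region_cases; simp add: jmap_simps mem_EI)+

lemma prj_left_end: "u \<in> left_region \<Longrightarrow> prj Y (left_end u) = prj J u"
  by (erule left_region_cases) (simp_all add: prj_J prj_y_of)

lemma prj_left_track:
  assumes "u \<in> left_region" "s \<in> {0..1}" shows "prj K (left_track u s) = prj J u"
  using assms(1)
proof (cases rule: left_region_cases)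
  case (1 y) thus ?thesis using assms(2) fp_map_prj[OF h] by (simp add: prj_J)
next
  case (2 q)
  hence "prj K (path_of q (snd q * (1 - s))) = b_of q"
    using mult_diff_mem_unit[of "snd q" s] assms(2) by (simp add: mem_EI)
  thus ?thesis using 2 assms(2) by (simp add: prj_J)
qed

lemma left_deformation:
  assumes "A \<subseteq> left_region"
  shows "homotopic_with (\<lambda>g. join_invariant A g \<and> (\<forall>u\<in>A. \<exists>s\<in>{0..1}. g u = left_track u s))
    (subtopology prejoin A) (tsp K) jmap (h \<circ> left_end)"
proof (rule homotopic_withI)
  let ?W = "prod_topology unit_interval (subtopology prejoin A)"
  have "continuous_map (subtopology prejoin A) (path_top (tsp K)) left_track"
    using continuous_map_from_subtopology_mono[OF continuous_map_left_track assms] .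
  from continuous_map_path_at[OF continuous_map_compose[OF continuous_map_snd this] continuous_map_fst]
  show "continuous_map ?W (tsp K) (\<lambda>p. left_track (snd p) (fst p))" by (simp add: o_def)
  have A: "u \<in> A" if "u \<in> topspace (subtopology prejoin A)" for u using that by simp
  show "left_track (snd (0, u)) (fst (0::real, u)) = jmap u"
    "left_track (snd (1, u)) (fst (1::real, u)) = (h \<circ> left_end) u"
    if "u \<in> topspace (subtopology prejoin A)" for u
    using left_track_ends[OF subsetD[OF assms A[OF that]]] by simp_all
next
  have "join_invariant A left_track"
    by (rule join_invariant_subset[OF join_invariant_left_track assms])
  thus "join_invariant A (\<lambda>u. left_track (snd (s, u)) (fst (s, u))) \<and>
      (\<forall>u\<in>A. \<exists>s'\<in>{0..1}. left_track (snd (s, u)) (fst (s, u)) = left_track u s')"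
    if "s \<in> {0..1}" for s :: real
    using that by (auto simp: join_invariant_def)
next
  fix g g' :: "('b, 'e, 'x) U \<Rightarrow> ('b, 'e, 'x) U"
  assume "\<And>u. u \<in> topspace (subtopology prejoin A) \<Longrightarrow> g u = g' u"
  hence eq: "g u = g' u" if "u \<in> A" for u using that assms by (auto simp: left_region_def)
  hence "join_invariant A g = join_invariant A g'" by (auto simp: join_invariant_def)
  thus "(join_invariant A g \<and> (\<forall>u\<in>A. \<exists>s\<in>{0..1}. g u = left_track u s)) =
      (join_invariant A g' \<and> (\<forall>u\<in>A. \<exists>s\<in>{0..1}. g' u = left_track u s))"
    using eq by auto
qed

text \<open>Nothing is asked for \<open>t > 2/3\<close>, because a condition on \<open>y\<close> would not be saturated at \<open>t = 1\<close>.\<close>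

definition left_halo :: "('b, 'e, 'x) U set \<Rightarrow> ('b, 'e, 'x) U set \<Rightarrow> ('b, 'e, 'x) U set" where
  "left_halo M V = {u \<in> topspace prejoin. jmap u \<in> V \<and> (case u of UL y \<Rightarrow> y \<in> M
     | UJ y b \<theta> z t \<Rightarrow> 2/3 < t \<or> y \<in> M \<and> (\<forall>s\<in>{0..1}. \<theta> (t * (1 - s)) \<in> V) | _ \<Rightarrow> True)}"

lemma mem_left_halo:
  "UL y \<in> left_halo M V \<longleftrightarrow> y \<in> topspace (tsp Y) \<and> h y \<in> V \<and> y \<in> M"
  "UR z \<in> left_halo M V \<longleftrightarrow> z \<in> topspace (tsp Z) \<and> k z \<in> V"
  "UJ y b \<theta> z t \<in> left_halo M V \<longleftrightarrow> ((y, (b, \<theta>), z), t) \<in> topspace EI \<and> \<theta> t \<in> V \<and>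
     (2/3 < t \<or> y \<in> M \<and> (\<forall>s\<in>{0..1}. \<theta> (t * (1 - s)) \<in> V))"
  by (auto simp: left_halo_def jmap_simps)

lemma left_halo_in_region:
  assumes "u \<in> left_halo M V" "u \<in> left_region"
  shows "left_end u \<in> M" and "s \<in> {0..1} \<Longrightarrow> left_track u s \<in> V"
  using assms(2,1) by (cases rule: left_region_cases; auto simp: mem_left_halo)+

context
  fixes M V
  assumes M: "openin (tsp Y) M" "sct Y ` topspace B \<subseteq> M"
    and V: "openin (tsp K) V" "sct K ` topspace B \<subseteq> V"
begin

lemma openin_left_halo: "openin prejoin (left_halo M V)"
proof -
  have "openin (tsp Y) ({y \<in> topspace (tsp Y). h y \<in> V} \<inter> M)"
    by (intro openin_Int openin_continuous_map_preimage[OF fp_map_continuous[OF h] V(1)] M)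
  moreover have "\<dots> = {y \<in> topspace (tsp Y). UL y \<in> left_halo M V}"
    by (auto simp: mem_left_halo)
  moreover have "openin EI ({q \<in> topspace EI. path_of q (snd q) \<in> V} \<inter>
    ({q \<in> topspace EI. 2/3 < snd q} \<union>
      ({q \<in> topspace EI. y_of q \<in> M} \<inter> {q \<in> topspace EI. \<forall>s\<in>{0..1}. path_of q (snd q * (1 - s)) \<in> V})))"
    using openin_forall_compact[OF _ continuous_map_track V(1)]
    by (intro openin_Int openin_Un openin_EI_snd openin_continuous_map_preimage[OF _ V(1)]
        openin_continuous_map_preimage[OF continuous_map_components(1) M(1)]
        continuous_map_path_at[OF continuous_map_components(3,5)])
            (simp add: compact_space_subtopology)
  moreover have "\<dots> = {q \<in> topspace EI. seg q \<in> left_halo M V}"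
    by (auto simp: mem_left_halo)
  moreover have "openin (tsp Z) {z \<in> topspace (tsp Z). UR z \<in> left_halo M V}"
    using openin_continuous_map_preimage[OF fp_map_continuous[OF k] V(1)]
    by (simp add: mem_left_halo cong: conj_cong)
  ultimately show ?thesis by (simp add: openin_prejoin left_halo_def[of M V] subset_eq)
qed

lemma section_subset_left_halo: "b \<in> topspace B \<Longrightarrow> UL (sct Y b) \<in> left_halo M V"
  using M(2) V(2) by (auto simp: mem_left_halo sct_mem[OF Y] fp_map_sct[OF h])

lemma saturated_left_halo: "saturated (left_halo M V)"
proof -
  have "u \<in> left_halo M V \<longleftrightarrow> v \<in> left_halo M V" if "rel u v" for u v
    using that
  proof (cases rule: relE)
    case (segment b t)
    have "const_path (sct K b) s \<in> V" if "s \<in> {0..1}" for s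
      using that V(2) segment(1) by (auto simp: const_path_def)
    hence "u \<in> left_halo M V"
      using segment M(2) mult_diff_mem_unit[OF segment(2)] const_path_mem_EI[OF segment(1,2)]
      by (auto simp: mem_left_halo simp del: atLeastAtMost_iff)
    thus ?thesis using section_subset_left_halo[OF segment(1)] segment(4) by simp
  next
    case (ends b)
    thus ?thesis using section_subset_left_halo V(2)
      by (auto simp: mem_left_halo sct_mem[OF Z] fp_map_sct[OF k])
  qed (auto simp: mem_left_halo mem_EI)
  thus ?thesis by (simp add: saturated_def)
qed

lemma saturated_left_Un_halo: "saturated ({u \<in> left_region. left_end u \<in> W} \<union> left_halo M V)"
  (is "saturated (?A \<union> ?Q)")
proof -
  have "u \<in> ?A \<union> ?Q \<longleftrightarrow> v \<in> ?A \<union> ?Q" if r: "rel u v" for u v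
  proof -
    have Q: "u \<in> ?Q \<longleftrightarrow> v \<in> ?Q" using r saturated_left_halo by (simp add: saturated_def)
    from r show ?thesis
    proof (cases rule: relE)
      case (left q) thus ?thesis using Q by (auto simp: mem_EI)
    next
      case (right q) thus ?thesis using Q by auto
    qed (use Q section_subset_left_halo in auto)
  qed
  thus ?thesis by (simp add: saturated_def)
qed

end

definition left_part :: "('b, 'e, 'x) U set \<Rightarrow> ('b, 'e, 'x) U set" where
  "left_part W = rep ` {u \<in> left_region. left_end u \<in> W}"

lemma left_part_UN:
  assumes "S \<subseteq> (\<Union>i\<in>I. W i)" shows "left_part S \<subseteq> (\<Union>i\<in>I. left_part (W i))"
  using assms by (fastforce simp: left_part_def)

end

context join_data
begin

interpretation swap: join_data B Z Y K k h by (rule join_data_swap)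

definition right_part :: "('b, 'e, 'x) U set \<Rightarrow> ('b, 'e, 'x) U set" where
  "right_part W = {u \<in> topspace (tsp J). flip u \<in> swap.left_part W}"

lemma right_part_UN:
  assumes "S \<subseteq> (\<Union>i\<in>I. W i)" shows "right_part S \<subseteq> (\<Union>i\<in>I. right_part (W i))"
  using swap.left_part_UN[OF assms] by (auto simp: right_part_def)

lemma parts_cover_join:
  assumes u: "u \<in> topspace (tsp J)"
  shows "u \<in> left_part (topspace (tsp Y)) \<or> u \<in> right_part (topspace (tsp Z))"
  using u
proof (cases rule: J_cases)
  case (1 y) thus ?thesis by (auto simp: left_part_def intro!: image_eqI[of _ _ "UL y"])
next
  case (2 q)
  consider "snd q < 2/3" | "1/3 < snd q" by linarith
  thus ?thesis
  proof cases
    case 1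
    thus ?thesis using 2 by (auto simp: left_part_def mem_EI intro!: image_eqI[of _ _ "seg q"])
  next
    case right: 2
    have "swap_sides (seg q) \<in> swap.left_region"
      "swap.left_end (swap_sides (seg q)) \<in> topspace (tsp Z)"
      using 2(1) right continuous_map_mem[OF continuous_map_swap_EI 2(1)] by (simp_all add: mem_EI)
    thus ?thesis using u 2
      by (auto simp: right_part_def swap.left_part_def flip_def[of "UJ _ _ _ _ _"])
  qed
next
  case (3 z)
  hence "flip u \<in> swap.left_part (topspace (tsp Z))"
    by (auto simp: swap.left_part_def flip_def[of "UR z"] intro!: image_eqI[of _ _ "UL z"])
  thus ?thesis using u by (simp add: right_part_def)
qed

end

subsection \<open>Local lifts relative to the section\<close>

definition fibrewise_rel :: "('y, 'b) fsp \<Rightarrow> ('x, 'b) fsp \<Rightarrow> 'y set \<Rightarrow> 'y set \<Rightarrow> ('y \<Rightarrow> 'x) \<Rightarrow> bool" where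
  "fibrewise_rel Y X W M k \<longleftrightarrow> (\<forall>u\<in>W. prj X (k u) = prj Y u \<and> (u \<in> M \<longrightarrow> k u = sct X (prj Y u)))"

lemma fibrewise_rel_compose_right:
  assumes "fibrewise_rel Y X W M k"
    and "\<And>u. u \<in> W' \<Longrightarrow> v u \<in> W \<and> prj Y (v u) = prj Y' u" "\<And>u. u \<in> W' \<Longrightarrow> u \<in> M' \<Longrightarrow> v u \<in> M"
  shows "fibrewise_rel Y' X W' M' (k \<circ> v)"
  using assms by (simp add: fibrewise_rel_def)

lemma fibrewise_rel_compose_left:
  assumes "fibrewise_rel Y X W M k" "fp_map B X X' j"
    and "\<And>u. u \<in> W \<Longrightarrow> k u \<in> topspace (tsp X)" "\<And>u. u \<in> W \<Longrightarrow> prj Y u \<in> topspace B"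
  shows "fibrewise_rel Y X' W M (j \<circ> k)"
  using assms by (simp add: fibrewise_rel_def fp_map_prj[OF assms(2)] fp_map_sct[OF assms(2)])

lemma fibrewise_rel_paste:
  assumes "fibrewise_rel Y X A M k" "\<And>u. u \<in> M \<Longrightarrow> prj X (sct X (prj Y u)) = prj Y u"
  shows "fibrewise_rel Y X (A \<union> M) M (\<lambda>u. if u \<in> M then sct X (prj Y u) else k u)"
  using assms by (auto simp: fibrewise_rel_def)

locale lift_data =
  fixes B :: "'b topology" and E :: "('e, 'b) fsp" and X :: "('x, 'b) fsp" and f :: "'e \<Rightarrow> 'x"
    and V :: "'x set" and c :: "'x \<Rightarrow> 'x"
  assumes E: "fibrewise_pointed_space B E" and X: "fibrewise_pointed_space B X"
    and f: "fp_map B E X f" and halo: "section_halo B X V c"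
begin

lemma openin_V: "openin (tsp X) V"
  and sct_subset_V: "sct X ` topspace B \<subseteq> V"
  and homotopic_id_c: "fp_homotopic B X X id c"
  and c_eq: "x \<in> V \<Longrightarrow> c x = sct X (prj X x)"
  using halo by (auto simp: section_halo_def)

lemma fp_map_c: "fp_map B X X c"
  by (rule fp_homotopic_imp_fp_map[OF homotopic_id_c])

lemma fibrewise_rel_c:
  assumes "\<And>u. u \<in> W \<Longrightarrow> g u \<in> topspace (tsp X) \<and> prj X (g u) = prj Y u"
    and "\<And>u. u \<in> W \<Longrightarrow> u \<in> M \<Longrightarrow> g u \<in> V"
  shows "fibrewise_rel Y X W M (c \<circ> g)"
  using assms by (simp add: fibrewise_rel_def fp_map_prj[OF fp_map_c] c_eq)

text \<open>Composing with \<open>c\<close> allows the homotopy to be relative to a whole neighbourhood \<open>M\<close> of the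
  section; over \<open>M\<close> it can then be glued to the section.\<close>

definition local_lift :: "('y, 'b) fsp \<Rightarrow> ('y \<Rightarrow> 'x) \<Rightarrow> 'y set \<Rightarrow> bool" where
  "local_lift Y g W \<longleftrightarrow> openin (tsp Y) W \<and> (\<exists>M a. openin (tsp Y) M \<and> sct Y ` topspace B \<subseteq> M \<and> M \<subseteq> W \<and>
     continuous_map (subtopology (tsp Y) W) (tsp E) a \<and> fibrewise_rel Y E W M a \<and>
     homotopic_with (fibrewise_rel Y X W M) (subtopology (tsp Y) W) (tsp X) (c \<circ> g) (f \<circ> a))"

lemma local_liftI:
  assumes "openin (tsp Y) W" "openin (tsp Y) M" "sct Y ` topspace B \<subseteq> M" "M \<subseteq> W"
    and "continuous_map (subtopology (tsp Y) W) (tsp E) a" "fibrewise_rel Y E W M a"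
    and "homotopic_with (fibrewise_rel Y X W M) (subtopology (tsp Y) W) (tsp X) (c \<circ> g) (f \<circ> a)"
  shows "local_lift Y g W"
  using assms unfolding local_lift_def by blast

lemma local_liftE:
  assumes "local_lift Y g W"
  obtains M a where "openin (tsp Y) W" "openin (tsp Y) M" "sct Y ` topspace B \<subseteq> M" "M \<subseteq> W"
    "continuous_map (subtopology (tsp Y) W) (tsp E) a" "fibrewise_rel Y E W M a"
    "homotopic_with (fibrewise_rel Y X W M) (subtopology (tsp Y) W) (tsp X) (c \<circ> g) (f \<circ> a)"
  using assms unfolding local_lift_def by blast

lemma local_lift_pullback:
  assumes l: "local_lift Y g W" and Y': "fibrewise_pointed_space B Y'" and v: "fp_map B Y' Y v"
    and g': "\<And>u. u \<in> topspace (tsp Y') \<Longrightarrow> g' u = g (v u)"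
  shows "local_lift Y' g' {u \<in> topspace (tsp Y'). v u \<in> W}" (is "local_lift Y' g' ?W")
proof -
  from l obtain M a where W: "openin (tsp Y) W"
    and M: "openin (tsp Y) M" "sct Y ` topspace B \<subseteq> M" "M \<subseteq> W"
    and a: "continuous_map (subtopology (tsp Y) W) (tsp E) a" "fibrewise_rel Y E W M a"
    and hom: "homotopic_with (fibrewise_rel Y X W M) (subtopology (tsp Y) W) (tsp X) (c \<circ> g) (f \<circ> a)"
    by (rule local_liftE)
  let ?M = "{u \<in> topspace (tsp Y'). v u \<in> M}"
  note v_cont = fp_map_continuous[OF v]
  have vW: "continuous_map (subtopology (tsp Y') ?W) (subtopology (tsp Y) W) v"
    using v_cont by (auto simp: continuous_map_in_subtopology continuous_map_from_subtopology)
  show ?thesis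
  proof (rule local_liftI)
    show "openin (tsp Y') ?W" "openin (tsp Y') ?M"
      using openin_continuous_map_preimage[OF v_cont] W M(1) by auto
    show "continuous_map (subtopology (tsp Y') ?W) (tsp E) (a \<circ> v)"
      by (rule continuous_map_compose[OF vW a(1)])
    show "fibrewise_rel Y' E ?W ?M (a \<circ> v)"
      by (rule fibrewise_rel_compose_right[OF a(2)]) (auto simp: fp_map_prj[OF v])
    have "homotopic_with (fibrewise_rel Y' X ?W ?M) (subtopology (tsp Y') ?W) (tsp X) (c \<circ> g \<circ> v)
      (f \<circ> a \<circ> v)"
      by (rule homotopic_with_compose_continuous_map_right[OF hom vW], rule fibrewise_rel_compose_right)
        (auto simp: fp_map_prj[OF v])
    thus "homotopic_with (fibrewise_rel Y' X ?W ?M) (subtopology (tsp Y') ?W) (tsp X) (c \<circ> g')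
      (f \<circ> (a \<circ> v))"
      by (rule homotopic_with_eq) (auto simp: g' fibrewise_rel_def)
  qed (use M sct_mem[OF Y'] fp_map_sct[OF v] in auto)
qed

lemma homotopic_rel_c:
  assumes H: "continuous_map (prod_topology unit_interval (tsp Y)) (tsp X) H"
    and prj: "\<And>t u. t \<in> {0..1} \<Longrightarrow> u \<in> topspace (tsp Y) \<Longrightarrow> prj X (H (t, u)) = prj Y u"
    and M: "\<And>t u. t \<in> {0..1} \<Longrightarrow> u \<in> M \<Longrightarrow> H (t, u) \<in> V"
  shows "homotopic_with (fibrewise_rel Y X (topspace (tsp Y)) M) (tsp Y) (tsp X)
    (c \<circ> (\<lambda>u. H (0, u))) (c \<circ> (\<lambda>u. H (1, u)))"
proof (rule homotopic_withI)
  show "continuous_map (prod_topology unit_interval (tsp Y)) (tsp X) (c \<circ> H)"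
    by (rule continuous_map_compose[OF H fp_map_continuous[OF fp_map_c]])
  fix t :: real assume t: "t \<in> {0..1}"
  have "H (t, u) \<in> topspace (tsp X)" if "u \<in> topspace (tsp Y)" for u
    using continuous_map_mem[OF H, of "(t, u)"] t that by simp
  hence "fibrewise_rel Y X (topspace (tsp Y)) M (c \<circ> (\<lambda>u. H (t, u)))"
    by (intro fibrewise_rel_c conjI prj M t)
  thus "fibrewise_rel Y X (topspace (tsp Y)) M (\<lambda>u. (c \<circ> H) (t, u))" by (simp add: o_def)
qed (auto simp: fibrewise_rel_def)

lemma homotopic_rel_compose_c:
  assumes g: "continuous_map (tsp Y) (tsp X) g" and rel: "fibrewise_rel Y X (topspace (tsp Y)) M g"
    and Y: "fibrewise_pointed_space B Y"
  shows "homotopic_with (fibrewise_rel Y X (topspace (tsp Y)) M) (tsp Y) (tsp X) g (c \<circ> g)"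
proof -
  have "homotopic_with (fibrewise_rel Y X (topspace (tsp Y)) M) (tsp Y) (tsp X) (id \<circ> g) (c \<circ> g)"
    by (rule homotopic_with_compose_continuous_map_right[OF homotopic_id_c[unfolded fp_homotopic_def] g])
      (use rel continuous_map_mem[OF g] prj_mem[OF Y] in \<open>simp add: fibrewise_rel_def\<close>)
  thus ?thesis by simp
qed

lemma local_lift_domain:
  assumes "section_halo B E V' c'"
  shows "local_lift E f (topspace (tsp E))"
proof -
  have V': "openin (tsp E) V'" "sct E ` topspace B \<subseteq> V'" and c': "fp_homotopic B E E id c'"
    and c'V': "\<And>x. x \<in> V' \<Longrightarrow> c' x = sct E (prj E x)" using assms by (auto simp: section_halo_def)
  have c'_map: "fp_map B E E c'" by (rule fp_homotopic_imp_fp_map[OF c'])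
  obtain H where H: "continuous_map (prod_topology unit_interval (tsp E)) (tsp X) H"
    and H01: "\<And>u. H (0, u) = (f \<circ> id) u" "\<And>u. H (1, u) = (f \<circ> c') u"
    and H_prj: "\<And>t u. t \<in> {0..1} \<Longrightarrow> u \<in> topspace (tsp E) \<Longrightarrow> prj X (H (t, u)) = prj E u"
    and H_sct: "\<And>t b. t \<in> {0..1} \<Longrightarrow> b \<in> topspace B \<Longrightarrow> H (t, sct E b) = sct X b"
    by (rule fp_homotopicE[OF fp_homotopic_compose_left[OF c' f]]) (rule that)
  define M where "M =
      V' \<inter> {u \<in> topspace (tsp E). \<forall>t\<in>topspace unit_interval. (H \<circ> prod.swap) (u, t) \<in> V}"
  have "continuous_map (prod_topology (tsp E) unit_interval)
    (prod_topology unit_interval (tsp E)) prod.swap"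
    by (simp add: prod.swap_def continuous_map_pairwise o_def continuous_map_fst continuous_map_snd)
  hence M: "openin (tsp E) M"
    unfolding M_def
    by (intro openin_Int V' openin_forall_compact[OF _ _ openin_V] continuous_map_compose[OF _ H])
      (simp add: compact_space_subtopology)
  have sM: "sct E ` topspace B \<subseteq> M"
    using V'(2) sct_subset_V sct_mem[OF E] by (auto simp: M_def H_sct)
  have c'_rel: "fibrewise_rel E E (topspace (tsp E)) M c'"
    using c'V' by (auto simp: fibrewise_rel_def M_def fp_map_prj[OF c'_map])
  have fc'_rel: "fibrewise_rel E X (topspace (tsp E)) M (f \<circ> c')"
    by (rule fibrewise_rel_compose_left[OF c'_rel f]) (use fp_map_mem[OF c'_map] prj_mem[OF E] in auto)
  have "homotopic_with (fibrewise_rel E X (topspace (tsp E)) M) (tsp E) (tsp X) (c \<circ> f) (c \<circ> (f \<circ> c'))"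
    using homotopic_rel_c[OF H H_prj, of M] by (simp add: M_def H01 o_def)
  hence "homotopic_with (fibrewise_rel E X (topspace (tsp E)) M) (tsp E) (tsp X) (c \<circ> f) (f \<circ> c')"
    using homotopic_rel_compose_c[OF fp_map_continuous[OF fp_map_compose[OF c'_map f]] fc'_rel E]
    by (rule homotopic_with_trans[OF _ homotopic_with_symD])
  thus ?thesis
    using M sM openin_subset[OF M] c'_rel fp_map_continuous[OF c'_map] by (intro local_liftI) auto
qed

definition lift_cover :: "('y, 'b) fsp \<Rightarrow> (nat \<Rightarrow> 'y \<Rightarrow> 'x) \<Rightarrow> nat set \<Rightarrow> bool" where
  "lift_cover Y g I \<longleftrightarrow> (\<exists>W. topspace (tsp Y) \<subseteq> (\<Union>i\<in>I. W i) \<and> (\<forall>i\<in>I. local_lift Y (g i) (W i)))"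

lemma lift_cover_pullback:
  assumes "lift_cover Y g I" and Y': "fibrewise_pointed_space B Y'" and v: "fp_map B Y' Y v"
    and g': "\<And>i u. i \<in> I \<Longrightarrow> u \<in> topspace (tsp Y') \<Longrightarrow> g' i u = g i (v u)"
  shows "lift_cover Y' g' I"
proof -
  obtain W where W: "topspace (tsp Y) \<subseteq> (\<Union>i\<in>I. W i)" and l: "\<And>i. i \<in> I \<Longrightarrow> local_lift Y (g i) (W i)"
    using assms(1) unfolding lift_cover_def by blast
  have "topspace (tsp Y') \<subseteq> (\<Union>i\<in>I. {u \<in> topspace (tsp Y'). v u \<in> W i})"
    using W fp_map_mem[OF v] by fastforce
  moreover have "local_lift Y' (g' i) {u \<in> topspace (tsp Y'). v u \<in> W i}" if "i \<in> I" for i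
    by (rule local_lift_pullback[OF l[OF that] Y' v g'[OF that]])
  ultimately show ?thesis
    unfolding lift_cover_def by (intro exI[of _ "\<lambda>i. {u \<in> topspace (tsp Y'). v u \<in> W i}"]) auto
qed

lemma local_lift_imp_fp_lifts:
  assumes l: "local_lift X g W" and g: "fp_homotopic B X X g id"
  shows "sct X ` topspace B \<subseteq> W" "fp_lifts B (fsub X W) E X f id"
proof -
  from l obtain M a where W: "openin (tsp X) W" and M: "sct X ` topspace B \<subseteq> M" "M \<subseteq> W"
    and a: "continuous_map (subtopology (tsp X) W) (tsp E) a" "fibrewise_rel X E W M a"
    and hom: "homotopic_with (fibrewise_rel X X W M) (subtopology (tsp X) W) (tsp X) (c \<circ> g) (f \<circ> a)"
    by (rule local_liftE)
  show sW: "sct X ` topspace B \<subseteq> W" using M by blast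
  have a_map: "fp_map B (fsub X W) E a"
    using a M sW by (auto simp: fp_map_def fibrewise_rel_def prj_sct[OF X] image_subset_iff)
  have "homotopic_with (\<lambda>k. (\<forall>x\<in>topspace (subtopology (tsp X) W). prj X (k x) = prj X x) \<and>
      (\<forall>b\<in>topspace B. k (sct X b) = sct X b)) (subtopology (tsp X) W) (tsp X) (c \<circ> g) (f \<circ> a)"
    by (rule homotopic_with_mono[OF hom])
      (use M sW in \<open>auto simp: fibrewise_rel_def prj_sct[OF X] image_subset_iff\<close>)
  hence ca: "fp_homotopic B (fsub X W) X (c \<circ> g) (f \<circ> a)" by (simp add: fp_homotopic_def)
  have "fp_homotopic B X X (c \<circ> g) id"
    using fp_homotopic_trans[OF fp_homotopic_compose_left[OF g fp_map_c]]
      fp_homotopic_sym[OF homotopic_id_c] by simp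
  from fp_homotopic_trans[OF fp_homotopic_sym[OF ca] fp_homotopic_restrict[OF this]]
  show "fp_lifts B (fsub X W) E X f id" by (rule fp_liftsI[OF a_map])
qed

lemma secat_le_if_lift_cover:
  assumes cover: "lift_cover Y g {..n}" and \<phi>: "fp_map B X Y \<phi>"
    and g: "\<And>i. i \<le> n \<Longrightarrow> fp_homotopic B X X (g i \<circ> \<phi>) id"
  shows "secat_le B E X f n"
proof -
  have "lift_cover X (\<lambda>i. g i \<circ> \<phi>) {..n}" by (rule lift_cover_pullback[OF cover X \<phi>]) simp
  then obtain W where W: "topspace (tsp X) \<subseteq> (\<Union>i\<le>n. W i)"
    and l: "\<And>i. i \<le> n \<Longrightarrow> local_lift X (g i \<circ> \<phi>) (W i)"
    unfolding lift_cover_def by auto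
  have "openin (tsp X) (W i)" if "i \<le> n" for i using l[OF that] by (simp add: local_lift_def)
  moreover from this have "(\<Union>i\<le>n. W i) = topspace (tsp X)" using W openin_subset by fastforce
  ultimately show ?thesis
    unfolding secat_le_iff_fp_lifts using local_lift_imp_fp_lifts[OF l g] by (intro exI[of _ W]) simp
qed

end

subsection \<open>Local lifts on a join\<close>

locale join_lift = join_data B Y Z K h k + lift_data B E X f V c
  for B :: "'b topology" and Y Z K :: "('b, 'e, 'x) usp"
    and h k :: "('b, 'e, 'x) U \<Rightarrow> ('b, 'e, 'x) U"
    and E :: "('f, 'b) fsp" and X :: "('w, 'b) fsp" and f V c +
  fixes \<pi> :: "('b, 'e, 'x) U \<Rightarrow> 'w"
  assumes \<pi>: "fp_map B K X \<pi>"
begin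

lemma prj_J_mem: "u \<in> topspace prejoin \<Longrightarrow> prj J u \<in> topspace B"
  by (rule continuous_map_mem[OF continuous_map_prejoin(1)])

context
  fixes W M a
  assumes W: "openin (tsp Y) W" and M: "openin (tsp Y) M" "sct Y ` topspace B \<subseteq> M" "M \<subseteq> W"
    and a: "continuous_map (subtopology (tsp Y) W) (tsp E) a" "fibrewise_rel Y E W M a"
    and hom: "homotopic_with (fibrewise_rel Y X W M) (subtopology (tsp Y) W) (tsp X) (c \<circ> (\<pi> \<circ> h))
        (f \<circ> a)"
begin

definition "left_domain = {u \<in> left_region. left_end u \<in> W}"
definition "lift_halo = left_halo M {w \<in> topspace (tsp K). \<pi> w \<in> V}"
definition "glued_lift u = (if u \<in> lift_halo then sct E (prj J u) else (a \<circ> left_end) u)"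

abbreviation "glued_domain \<equiv> left_domain \<union> lift_halo"

lemma preimage_V:
  "openin (tsp K) {w \<in> topspace (tsp K). \<pi> w \<in> V}"
  "sct K ` topspace B \<subseteq> {w \<in> topspace (tsp K). \<pi> w \<in> V}"
  using openin_continuous_map_preimage[OF fp_map_continuous[OF \<pi>] openin_V] sct_subset_V
  by (auto simp: sct_mem[OF K] fp_map_sct[OF \<pi>])

lemmas openin_lift_halo = openin_left_halo[OF M(1,2) preimage_V, folded lift_halo_def]
lemmas saturated_lift_halo = saturated_left_halo[OF M(1,2) preimage_V, folded lift_halo_def]
lemmas saturated_glued_domain =
  saturated_left_Un_halo[OF M(1,2) preimage_V, of W, folded lift_halo_def left_domain_def]

lemma left_domainD: "u \<in> left_domain \<Longrightarrow> u \<in> left_region \<and> u \<in> topspace prejoin \<and> left_end u \<in> W"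
  by (auto simp: left_domain_def left_region_def)

lemma lift_haloD: "u \<in> lift_halo \<Longrightarrow> u \<in> topspace prejoin"
  by (simp add: lift_halo_def left_halo_def)

lemma openin_left_domain: "openin prejoin left_domain"
proof -
  have "openin (subtopology prejoin left_region)
    {u \<in> topspace (subtopology prejoin left_region). left_end u \<in> W}"
    by (rule openin_continuous_map_preimage[OF continuous_map_left_end W])
  moreover have "{u \<in> topspace (subtopology prejoin left_region). left_end u \<in> W} = left_domain"
    using openin_subset[OF openin_left_region] by (auto simp: left_domain_def)
  ultimately show ?thesis using openin_trans_full[OF _ openin_left_region] by simp
qed

lemma continuous_map_left_end_domain: "continuous_map (subtopology prejoin left_domain)
  (subtopology (tsp Y) W) left_end"
  using continuous_map_from_subtopology_mono[OF continuous_map_left_end, of left_domain] left_domainD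
  by (auto simp: continuous_map_in_subtopology)

lemma fibrewise_rel_left_end:
  assumes "fibrewise_rel Y X' W M g" shows "fibrewise_rel J X' left_domain lift_halo (g \<circ> left_end)"
  by (rule fibrewise_rel_compose_right[OF assms])
    (use left_domainD prj_left_end left_halo_in_region(1) in \<open>auto simp: lift_halo_def\<close>)

lemma fibrewise_rel_left_track:
  assumes g: "continuous_map (subtopology prejoin left_domain) (tsp K) g"
    and track: "\<forall>u\<in>left_domain. \<exists>s\<in>{0..1}. g u = left_track u s"
  shows "fibrewise_rel J X left_domain lift_halo (c \<circ> (\<pi> \<circ> g))"
proof (rule fibrewise_rel_c, intro conjI)
  fix u assume u: "u \<in> left_domain"
  then obtain s where s: "s \<in> {0..1}" "g u = left_track u s" using track by blast
  have gu: "g u \<in> topspace (tsp K)" using continuous_map_mem[OF g] u left_domainD by simp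
  show "(\<pi> \<circ> g) u \<in> topspace (tsp X)" using fp_map_mem[OF \<pi> gu] by simp
  show "prj X ((\<pi> \<circ> g) u) = prj J u"
    using fp_map_prj[OF \<pi> gu] prj_left_track[OF _ s(1)] left_domainD[OF u] s(2) by simp
  show "(\<pi> \<circ> g) u \<in> V" if "u \<in> lift_halo"
    using left_halo_in_region(2)[OF that[unfolded lift_halo_def] _ s(1)] left_domainD[OF u] s(2)
      by simp
qed

lemma homotopic_on_left_domain:
  "homotopic_with (\<lambda>g. join_invariant left_domain g \<and> fibrewise_rel J X left_domain lift_halo g)
     (subtopology prejoin left_domain) (tsp X) (c \<circ> \<pi> \<circ> jmap) (f \<circ> a \<circ> left_end)"
proof (rule homotopic_with_trans)
  have domain_left: "left_domain \<subseteq> left_region" using left_domainD by blast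
  show "homotopic_with (\<lambda>g. join_invariant left_domain g \<and> fibrewise_rel J X left_domain lift_halo g)
     (subtopology prejoin left_domain) (tsp X) (c \<circ> \<pi> \<circ> jmap) (c \<circ> \<pi> \<circ> (h \<circ> left_end))"
    by (rule homotopic_with_compose_left[OF left_deformation[OF domain_left]
          fp_map_continuous[OF fp_map_compose[OF \<pi> fp_map_c]]])
      (use fibrewise_rel_left_track in \<open>auto simp: o_assoc intro!: join_invariant_compose\<close>)
  have "join_invariant left_domain (g \<circ> left_end)" for g :: "('b, 'e, 'x) U \<Rightarrow> 'w"
    by (rule join_invariant_compose[OF join_invariant_subset[OF join_invariant_left_end domain_left]])
  hence "homotopic_with (\<lambda>g. join_invariant left_domain g \<and> fibrewise_rel J X left_domain lift_halo g)
     (subtopology prejoin left_domain) (tsp X) (c \<circ> (\<pi> \<circ> h) \<circ> left_end) (f \<circ> a \<circ> left_end)"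
    by (intro homotopic_with_compose_continuous_map_right[OF hom continuous_map_left_end_domain]
        conjI fibrewise_rel_left_end)
  thus "homotopic_with (\<lambda>g. join_invariant left_domain g \<and> fibrewise_rel J X left_domain lift_halo g)
     (subtopology prejoin left_domain) (tsp X) (c \<circ> \<pi> \<circ> (h \<circ> left_end)) (f \<circ> a \<circ> left_end)"
    by (simp add: o_assoc)
qed

lemma continuous_map_sct_prj_J:
  assumes "fibrewise_pointed_space B X'"
  shows "continuous_map (subtopology prejoin S) (tsp X') (\<lambda>u. sct X' (prj J u))"
  using continuous_map_from_subtopology[OF continuous_map_compose[OF continuous_map_prejoin(1)],
      of "tsp X'" "sct X'"]
    assms by (simp add: fibrewise_pointed_space_def o_def)

lemma join_invariant_sct_prj: "join_invariant S (\<lambda>u. sct X' (prj J u))"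
  using join_invariant_compose[OF join_invariant_prj, of S "sct X'"] by (simp add: o_def)

lemma prj_sct_prj_J: "fibrewise_pointed_space B X' \<Longrightarrow> u \<in> lift_halo \<Longrightarrow>
  prj X' (sct X' (prj J u)) = prj J u"
  using prj_J_mem[OF lift_haloD] by (simp add: prj_sct)

lemma homotopic_glued_lift:
  "homotopic_with (\<lambda>g. join_invariant glued_domain g \<and> fibrewise_rel J X glued_domain lift_halo g)
     (subtopology prejoin glued_domain) (tsp X) (c \<circ> (\<pi> \<circ> jmap)) (f \<circ> glued_lift)"
proof -
  have "(c \<circ> \<pi> \<circ> jmap) u = sct X (prj J u)" if u: "u \<in> lift_halo" for u
  proof -
    have "jmap u \<in> topspace (tsp K)" "\<pi> (jmap u) \<in> V" using u
      by (auto simp: lift_halo_def left_halo_def)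
    thus ?thesis using c_eq fp_map_prj[OF \<pi>] prj_jmap[OF lift_haloD[OF u]] by simp
  qed
  hence p: "(\<lambda>u. if u \<in> lift_halo then sct X (prj J u) else (c \<circ> \<pi> \<circ> jmap) u) = c \<circ> (\<pi> \<circ> jmap)" by auto
  have q: "(\<lambda>u. if u \<in> lift_halo then sct X (prj J u) else (f \<circ> a \<circ> left_end) u) = f \<circ> glued_lift"
    using fp_map_sct[OF f prj_J_mem[OF lift_haloD]] by (auto simp: glued_lift_def)
  show ?thesis
    unfolding p[symmetric] q[symmetric]
  proof (rule homotopic_with_paste_open[OF openin_left_domain openin_lift_halo
        homotopic_on_left_domain continuous_map_sct_prj_J[OF X]])
    fix g assume g: "join_invariant left_domain g \<and> fibrewise_rel J X left_domain lift_halo g"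
    show "g u = sct X (prj J u)" if "u \<in> left_domain \<inter> lift_halo" for u using g that
      by (simp add: fibrewise_rel_def)
    show "join_invariant glued_domain (\<lambda>u. if u \<in> lift_halo then sct X (prj J u) else g u) \<and>
        fibrewise_rel J X glued_domain lift_halo (\<lambda>u. if u \<in> lift_halo then sct X (prj J u) else g u)"
      using g prj_sct_prj_J[OF X]
      by (intro conjI join_invariant_paste[OF saturated_lift_halo _ join_invariant_sct_prj]
          fibrewise_rel_paste) auto
  qed
qed

lemma glued_lift_on_domain:
  "continuous_map (subtopology prejoin glued_domain) (tsp E) glued_lift"
  "join_invariant glued_domain glued_lift" "fibrewise_rel J E glued_domain lift_halo glued_lift"
proof -
  have rel: "fibrewise_rel J E left_domain lift_halo (a \<circ> left_end)"
    by (rule fibrewise_rel_left_end[OF a(2)])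
  show "continuous_map (subtopology prejoin glued_domain) (tsp E) glued_lift"
    unfolding glued_lift_def
    by (rule continuous_map_paste_open[OF openin_left_domain openin_lift_halo
          continuous_map_compose[OF continuous_map_left_end_domain a(1)]
          continuous_map_sct_prj_J[OF E]])
      (use rel in \<open>simp add: fibrewise_rel_def\<close>)
  have "left_domain \<subseteq> left_region" using left_domainD by blast
  thus "join_invariant glued_domain glued_lift"
    unfolding glued_lift_def
    by (intro join_invariant_paste[OF saturated_lift_halo _ join_invariant_sct_prj]
        join_invariant_compose
        join_invariant_subset[OF join_invariant_left_end])
  show "fibrewise_rel J E glued_domain lift_halo glued_lift"
    unfolding glued_lift_def by (rule fibrewise_rel_paste[OF rel prj_sct_prj_J[OF E]])
qed

lemma local_lift_on_join: "local_lift J (\<pi> \<circ> jmap) (topspace (tsp J) \<inter> glued_domain)"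
proof (rule local_liftI)
  note S = saturated_glued_domain openin_Un[OF openin_left_domain openin_lift_halo]
  let ?W = "topspace (tsp J) \<inter> glued_domain" and ?M = "topspace (tsp J) \<inter> lift_halo"
  show "openin (tsp J) ?W" "openin (tsp J) ?M"
    by (rule quotient_map_rep_restrict(1)[OF S]
        quotient_map_rep_restrict(1)[OF saturated_lift_halo openin_lift_halo])+
  show "sct J ` topspace B \<subseteq> ?M"
    using sct_mem[OF fibrewise_pointed_space_J] section_subset_left_halo[OF M(1,2) preimage_V]
      rep_mem_iff[OF saturated_lift_halo] by (auto simp: sct_J lift_halo_def)
  show "continuous_map (subtopology (tsp J) ?W) (tsp E) glued_lift"
    unfolding subtopology_restrict by (rule continuous_map_on_join[OF S glued_lift_on_domain(2,1)])
  show "fibrewise_rel J E ?W ?M glued_lift" using glued_lift_on_domain(3)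
    by (auto simp: fibrewise_rel_def)
  show "homotopic_with (fibrewise_rel J X ?W ?M) (subtopology (tsp J) ?W) (tsp X) (c \<circ> (\<pi> \<circ> jmap))
    (f \<circ> glued_lift)"
    unfolding subtopology_restrict
    by (rule homotopic_with_mono[OF homotopic_with_on_join[OF S _ homotopic_glued_lift]])
      (auto simp: fibrewise_rel_def)
qed blast

end

lemma local_lift_left:
  assumes "local_lift Y (\<pi> \<circ> h) W"
  shows "\<exists>W'. local_lift J (\<pi> \<circ> jmap) W' \<and> left_part W \<subseteq> W'"
proof -
  from assms obtain M a where W: "openin (tsp Y) W"
    and M: "openin (tsp Y) M" "sct Y ` topspace B \<subseteq> M" "M \<subseteq> W"
    and a: "continuous_map (subtopology (tsp Y) W) (tsp E) a" "fibrewise_rel Y E W M a"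
    and hom: "homotopic_with (fibrewise_rel Y X W M) (subtopology (tsp Y) W) (tsp X) (c \<circ> (\<pi> \<circ> h))
        (f \<circ> a)"
    by (rule local_liftE)
  note data = W M a hom
  have "rep u \<in> topspace (tsp J) \<inter> (left_domain W \<union> lift_halo M)" if "u \<in> left_domain W" for u
    using that rep_mem_iff[OF saturated_glued_domain[OF data]] rep_mem_J left_domainD[OF data] by auto
  hence "left_part W \<subseteq> topspace (tsp J) \<inter> (left_domain W \<union> lift_halo M)"
    unfolding left_part_def left_domain_def[OF data, symmetric] by blast
  thus ?thesis using local_lift_on_join[OF data] by blast
qed

lemma local_lift_right:
  assumes "local_lift Z (\<pi> \<circ> k) W"
  shows "\<exists>W'. local_lift J (\<pi> \<circ> jmap) W' \<and> right_part W \<subseteq> W'"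
proof -
  interpret swap: join_lift B Z Y K k h E X f V c \<pi>
    using Y Z K h k E X f halo \<pi> by unfold_locales
  obtain W' where W': "local_lift swap.J (\<pi> \<circ> swap.jmap) W'" "swap.left_part W \<subseteq> W'"
    using swap.local_lift_left[OF assms] by blast
  have "local_lift J (\<pi> \<circ> jmap) {u \<in> topspace (tsp J). flip u \<in> W'}"
    by (rule local_lift_pullback[OF W'(1) fibrewise_pointed_space_J fp_map_flip]) (simp add: jmap_flip)
  moreover have "right_part W \<subseteq> {u \<in> topspace (tsp J). flip u \<in> W'}"
    using W'(2) by (auto simp: right_part_def)
  ultimately show ?thesis by blast
qed

end

lemma (in lift_data) lift_cover_join:
  assumes join: "join_data B Y Z K h k"
    and cover_Y: "lift_cover Y (\<lambda>i. \<pi> i \<circ> h) I1" and cover_Z: "lift_cover Z (\<lambda>i. \<pi> i \<circ> k) I2"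
    and I: "I1 \<inter> I2 = {}" and \<pi>: "\<And>i. i \<in> I1 \<union> I2 \<Longrightarrow> fp_map B K X (\<pi> i)"
  shows "lift_cover (fst (fjoin B Y Z K h k)) (\<lambda>i. \<pi> i \<circ> snd (fjoin B Y Z K h k)) (I1 \<union> I2)"
proof -
  interpret join_data B Y Z K h k by (rule join)
  have jl: "join_lift B Y Z K h k E X f V c (\<pi> i)" if "i \<in> I1 \<union> I2" for i
    by (rule join_lift.intro[OF join lift_data_axioms join_lift_axioms.intro[OF \<pi>[OF that]]])
  from cover_Y obtain W1 where W1: "topspace (tsp Y) \<subseteq> (\<Union>i\<in>I1. W1 i)"
    "\<forall>i\<in>I1. local_lift Y (\<pi> i \<circ> h) (W1 i)" unfolding lift_cover_def by (elim exE conjE)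
  from cover_Z obtain W2 where W2: "topspace (tsp Z) \<subseteq> (\<Union>i\<in>I2. W2 i)"
    "\<forall>i\<in>I2. local_lift Z (\<pi> i \<circ> k) (W2 i)" unfolding lift_cover_def by (elim exE conjE)
  have "\<forall>i\<in>I1. \<exists>W. local_lift J (\<pi> i \<circ> jmap) W \<and> left_part (W1 i) \<subseteq> W"
    by (intro ballI join_lift.local_lift_left[OF jl[OF UnI1] bspec[OF W1(2)]])
  from bchoice[OF this] obtain L
    where L: "\<forall>i\<in>I1. local_lift J (\<pi> i \<circ> jmap) (L i) \<and> left_part (W1 i) \<subseteq> L i" ..
  have "\<forall>i\<in>I2. \<exists>W. local_lift J (\<pi> i \<circ> jmap) W \<and> right_part (W2 i) \<subseteq> W"
    by (intro ballI join_lift.local_lift_right[OF jl[OF UnI2] bspec[OF W2(2)]])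
  from bchoice[OF this] obtain R
    where R: "\<forall>i\<in>I2. local_lift J (\<pi> i \<circ> jmap) (R i) \<and> right_part (W2 i) \<subseteq> R i" ..
  define W where "W i = (if i \<in> I1 then L i else R i)" for i
  have "local_lift J (\<pi> i \<circ> jmap) (W i)" if "i \<in> I1 \<union> I2" for i
    using that L R by (cases "i \<in> I1") (simp_all add: W_def)
  moreover have "u \<in> (\<Union>i\<in>I1 \<union> I2. W i)" if u: "u \<in> topspace (tsp J)" for u
  proof -
    have "u \<in> (\<Union>i\<in>I1. left_part (W1 i)) \<union> (\<Union>i\<in>I2. right_part (W2 i))"
      using parts_cover_join[OF u] left_part_UN[OF W1(1)] right_part_UN[OF W2(1)] by blast
    hence "u \<in> (\<Union>i\<in>I1. L i) \<union> (\<Union>i\<in>I2. R i)" using L R by blast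
    moreover have "(\<Union>i\<in>I1 \<union> I2. W i) = (\<Union>i\<in>I1. L i) \<union> (\<Union>i\<in>I2. R i)"
      using I by (auto simp: W_def split: if_splits)
    ultimately show ?thesis by simp
  qed
  ultimately show ?thesis unfolding lift_cover_def by blast
qed

subsection \<open>Maps into the join\<close>

abbreviation pos_set :: "('w, 'b) fsp \<Rightarrow> ('w \<Rightarrow> real) \<Rightarrow> 'w set" where
  "pos_set W v \<equiv> {x \<in> topspace (tsp W). 0 < v x}"

lemma continuous_map_homotopy_at:
  assumes "continuous_map (prod_topology unit_interval (subtopology T A)) K H"
    and "continuous_map X euclideanreal s" "\<And>x. x \<in> topspace X \<Longrightarrow> s x \<in> {0..1}"
    and "continuous_map X T y" "\<And>x. x \<in> topspace X \<Longrightarrow> y x \<in> A"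
  shows "continuous_map X K (\<lambda>x. H (s x, y x))"
proof -
  have "continuous_map X (prod_topology unit_interval (subtopology T A)) (\<lambda>x. (s x, y x))"
    by (intro continuous_map_pairedI continuous_map_into_subtopology) (use assms(2-5) in auto)
  from continuous_map_compose[OF this assms(1)] show ?thesis by (simp add: o_def)
qed

locale join_section = join_data B Y Z K h k
  for B :: "'b topology" and Y Z K :: "('b, 'e, 'x) usp"
    and h k :: "('b, 'e, 'x) U \<Rightarrow> ('b, 'e, 'x) U" +
  fixes W :: "('w, 'b) fsp" and g :: "'w \<Rightarrow> ('b, 'e, 'x) U" and \<tau> :: "'w \<Rightarrow> real"
    and \<alpha> \<beta> :: "'w \<Rightarrow> ('b, 'e, 'x) U" and F G :: "real \<times> 'w \<Rightarrow> ('b, 'e, 'x) U"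
    and S0 S1 :: "'w set"
  defines "S0 \<equiv> pos_set W (\<lambda>x. 1 - \<tau> x)" and "S1 \<equiv> pos_set W \<tau>"
  assumes W: "fibrewise_pointed_space B W" and \<tau>: "continuous_map (tsp W) euclideanreal \<tau>"
    and \<tau>_sct: "\<And>b. b \<in> topspace B \<Longrightarrow> 0 < \<tau> (sct W b) \<and> \<tau> (sct W b) < 1"
    and \<alpha>: "fp_map B (fsub W S0) Y \<alpha>" and \<beta>: "fp_map B (fsub W S1) Z \<beta>"
    and F: "continuous_map (prod_topology unit_interval (subtopology (tsp W) S0)) (tsp K) F"
    and F_ends: "\<And>x. F (0, x) = h (\<alpha> x)" "\<And>x. F (1, x) = g x"
    and F_prj: "\<And>r x. r \<in> {0..1} \<Longrightarrow> x \<in> S0 \<Longrightarrow> prj K (F (r, x)) = prj W x"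
    and F_sct: "\<And>r b. r \<in> {0..1} \<Longrightarrow> b \<in> topspace B \<Longrightarrow> F (r, sct W b) = sct K b"
    and G: "continuous_map (prod_topology unit_interval (subtopology (tsp W) S1)) (tsp K) G"
    and G_ends: "\<And>x. G (0, x) = k (\<beta> x)" "\<And>x. G (1, x) = g x"
    and G_prj: "\<And>r x. r \<in> {0..1} \<Longrightarrow> x \<in> S1 \<Longrightarrow> prj K (G (r, x)) = prj W x"
    and G_sct: "\<And>r b. r \<in> {0..1} \<Longrightarrow> b \<in> topspace B \<Longrightarrow> G (r, sct W b) = sct K b"
begin

definition concat_path :: "'w \<times> real \<Rightarrow> ('b, 'e, 'x) U" where
  "concat_path p = (if snd p \<le> 1/2 then F (2 * snd p, fst p) else G (2 - 2 * snd p, fst p))"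

definition "join_param x = max 0 (min 1 (3 * \<tau> x - 1))"

definition "join_pt x = ((\<alpha> x, (prj W x, \<lambda>r\<in>{0..1}. concat_path (x, r)), \<beta> x), join_param x)"

definition into_join :: "'w \<Rightarrow> ('b, 'e, 'x) U" where
  "into_join x =
    (if \<tau> x < 1/3 then rep (UL (\<alpha> x))
     else if 2/3 < \<tau> x then rep (UR (\<beta> x))
     else rep (seg (join_pt x)))"

lemma openin_\<tau>: "openin (tsp W) {x \<in> topspace (tsp W). \<tau> x < a}"
  "openin (tsp W) {x \<in> topspace (tsp W). a < \<tau> x}"
  using openin_continuous_map_preimage[OF \<tau>, of "{..<a}"]
    openin_continuous_map_preimage[OF \<tau>, of "{a<..}"]
  by simp_all

lemma mem_S: "x \<in> S0 \<longleftrightarrow> x \<in> topspace (tsp W) \<and> \<tau> x < 1" "x \<in> S1 \<longleftrightarrow> x \<in> topspace (tsp W) \<and> 0 < \<tau> x"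
  by (auto simp: S0_def S1_def)

lemma openin_S: "openin (tsp W) S0" "openin (tsp W) S1"
  using openin_\<tau> by (simp_all add: S0_def S1_def)

lemma sct_mem_S: "b \<in> topspace B \<Longrightarrow> sct W b \<in> S0 \<inter> S1"
  using \<tau>_sct sct_mem[OF W] by (simp add: mem_S)

lemma \<alpha>_on_S0: "continuous_map (subtopology (tsp W) S0) (tsp Y) \<alpha>" "x \<in> S0 \<Longrightarrow> prj Y (\<alpha> x) = prj W x"
    "b \<in> topspace B \<Longrightarrow> \<alpha> (sct W b) = sct Y b"
  using \<alpha> by (auto simp: fp_map_def mem_S)

lemma \<beta>_on_S1: "continuous_map (subtopology (tsp W) S1) (tsp Z) \<beta>" "x \<in> S1 \<Longrightarrow> prj Z (\<beta> x) = prj W x"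
    "b \<in> topspace B \<Longrightarrow> \<beta> (sct W b) = sct Z b"
  using \<beta> by (auto simp: fp_map_def mem_S)

lemma continuous_map_concat_path:
  "continuous_map (prod_topology (subtopology (tsp W) (S0 \<inter> S1)) unit_interval) (tsp K) concat_path"
  unfolding concat_path_def
proof (rule continuous_map_cases_le)
  let ?P = "prod_topology (subtopology (tsp W) (S0 \<inter> S1)) unit_interval"
  show r: "continuous_map ?P euclideanreal snd" by (rule continuous_map_unit_interval_real(1))
  have x: "continuous_map ?P (tsp W) fst"
    by (rule continuous_map_into_fulltopology[OF continuous_map_fst])
  show "continuous_map (subtopology ?P {p \<in> topspace ?P. snd p \<le> 1/2}) (tsp K)
    (\<lambda>p. F (2 * snd p, fst p))"
    by (rule continuous_map_homotopy_at[OF F])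
      (auto intro!: continuous_map_real_mult continuous_map_from_subtopology r x)
  show "continuous_map (subtopology ?P {p \<in> topspace ?P. 1/2 \<le> snd p}) (tsp K)
    (\<lambda>p. G (2 - 2 * snd p, fst p))"
    by (rule continuous_map_homotopy_at[OF G])
      (auto intro!: continuous_map_diff continuous_map_real_mult continuous_map_from_subtopology r x)
  show "F (2 * snd p, fst p) = G (2 - 2 * snd p, fst p)" if "snd p = 1/2" for p :: "'w \<times> real"
  proof -
    have "2 * snd p = 1" "2 - 2 * snd p = 1" using that by simp_all
    thus ?thesis by (simp only: F_ends G_ends)
  qed
qed simp

lemma concat_path_ends: "concat_path (x, 0) = h (\<alpha> x)" "concat_path (x, 1) = k (\<beta> x)"
  by (simp_all add: concat_path_def F_ends G_ends)

lemma prj_concat_path: "x \<in> S0 \<inter> S1 \<Longrightarrow> r \<in> {0..1} \<Longrightarrow> prj K (concat_path (x, r)) = prj W x"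
  using F_prj[of "2 * r" x] G_prj[of "2 - 2 * r" x] by (auto simp: concat_path_def)

lemma concat_path_sct: "b \<in> topspace B \<Longrightarrow> r \<in> {0..1} \<Longrightarrow> concat_path (sct W b, r) = sct K b"
  using F_sct[of "2 * r" b] G_sct[of "2 - 2 * r" b] by (auto simp: concat_path_def)

lemma continuous_map_join_param: "continuous_map (tsp W) euclideanreal join_param"
  unfolding join_param_def by (intro continuous_intros \<tau>)

lemma join_param_unit: "join_param x \<in> {0..1}"
  by (simp add: join_param_def)

lemma continuous_map_join_pt: "continuous_map (subtopology (tsp W) (S0 \<inter> S1)) EI join_pt"
  unfolding join_pt_def
proof (rule continuous_map_into_EI)
  let ?W = "subtopology (tsp W) (S0 \<inter> S1)"
  show "continuous_map ?W (tsp Y) \<alpha>" "continuous_map ?W (tsp Z) \<beta>"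
    using continuous_map_from_subtopology_mono[OF \<alpha>_on_S0(1)]
      continuous_map_from_subtopology_mono[OF \<beta>_on_S1(1)]
    by auto
  show "continuous_map ?W B (prj W)"
    using W by (intro continuous_map_from_subtopology) (simp add: fibrewise_pointed_space_def)
  show "continuous_map ?W unit_interval join_param"
    using join_param_unit
    by (intro continuous_map_into_subtopology continuous_map_from_subtopology
        continuous_map_join_param) auto
qed (use continuous_map_curry_path[OF continuous_map_concat_path] prj_concat_path
    in \<open>auto simp: concat_path_ends\<close>)

lemma into_join_on_both:
  assumes "x \<in> S0 \<inter> S1" shows "into_join x = rep (seg (join_pt x))"
proof -
  have q: "join_pt x \<in> topspace EI"
    using continuous_map_mem[OF continuous_map_join_pt] assms by (simp add: mem_S)
  show ?thesis
    using rep_seg_0[OF q] rep_seg_1[OF q] by (auto simp: into_join_def join_pt_def join_param_def)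
qed

lemma into_join_cases:
  assumes "x \<in> topspace (tsp W)"
  obtains (left) "x \<in> S0" "\<tau> x < 1/3" "into_join x = rep (UL (\<alpha> x))"
  | (both) "x \<in> S0 \<inter> S1" "into_join x = rep (seg (join_pt x))"
  | (right) "x \<in> S1" "2/3 < \<tau> x" "into_join x = rep (UR (\<beta> x))"
proof -
  consider "\<tau> x < 1/3" | "2/3 < \<tau> x" | "1/3 \<le> \<tau> x" "\<tau> x \<le> 2/3" by linarith
  thus thesis
    by cases (use assms that into_join_on_both in \<open>auto simp: into_join_def mem_S\<close>)
qed

lemma continuous_map_into_join: "continuous_map (tsp W) (tsp J) into_join"
proof (rule continuous_map_open_cover[where \<U> = "{{x \<in> topspace (tsp W). \<tau> x < 1/3}, S0 \<inter> S1,
      {x \<in> topspace (tsp W). 2/3 < \<tau> x}}"])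
  let ?L = "{x \<in> topspace (tsp W). \<tau> x < 1/3}" and ?R = "{x \<in> topspace (tsp W). 2/3 < \<tau> x}"
  note rep_cont = quotient_imp_continuous_map[OF quotient_map_rep]
  have "continuous_map (subtopology (tsp W) ?L) (tsp Y) \<alpha>"
    by (rule continuous_map_from_subtopology_mono[OF \<alpha>_on_S0(1)]) (auto simp: mem_S)
  from continuous_map_compose[OF continuous_map_compose[OF this continuous_map_into_prejoin(1)]
      rep_cont]
  have L: "continuous_map (subtopology (tsp W) ?L) (tsp J) into_join"
    by (rule continuous_map_eq) (simp add: into_join_def)
  have "continuous_map (subtopology (tsp W) ?R) (tsp Z) \<beta>"
    by (rule continuous_map_from_subtopology_mono[OF \<beta>_on_S1(1)]) (auto simp: mem_S)
  from continuous_map_compose[OF continuous_map_compose[OF this continuous_map_into_prejoin(3)]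
      rep_cont]
  have R: "continuous_map (subtopology (tsp W) ?R) (tsp J) into_join"
    by (rule continuous_map_eq) (simp add: into_join_def)
  from continuous_map_compose[OF
      continuous_map_compose[OF continuous_map_join_pt continuous_map_into_prejoin(2)] rep_cont]
  have C: "continuous_map (subtopology (tsp W) (S0 \<inter> S1)) (tsp J) into_join"
    by (rule continuous_map_eq) (simp add: into_join_on_both)
  show "continuous_map (subtopology (tsp W) U) (tsp J) into_join" if "U \<in> {?L, S0 \<inter> S1, ?R}" for U
    using that L R C by blast
  show "openin (tsp W) U" if "U \<in> {?L, S0 \<inter> S1, ?R}" for U
    using that openin_\<tau> openin_S by blast
  show "topspace (tsp W) \<subseteq> \<Union>{?L, S0 \<inter> S1, ?R}"
  proof
    fix x assume "x \<in> topspace (tsp W)"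
    thus "x \<in> \<Union>{?L, S0 \<inter> S1, ?R}" by (cases rule: into_join_cases) (auto simp: mem_S)
  qed
qed

lemma fp_map_into_join: "fp_map B W J into_join"
  unfolding fp_map_def
proof (intro conjI ballI continuous_map_into_join)
  show "prj J (into_join x) = prj W x" if "x \<in> topspace (tsp W)" for x
    using that by (cases rule: into_join_cases) (auto simp: prj_J join_pt_def \<alpha>_on_S0(2) \<beta>_on_S1(2))
  show "into_join (sct W b) = sct J b" if b: "b \<in> topspace B" for b
  proof -
    have "(\<lambda>r\<in>{0..1}. concat_path (sct W b, r)) = const_path (sct K b)"
      unfolding const_path_def by (rule restrict_ext) (rule concat_path_sct[OF b])
    thus ?thesis
      using into_join_on_both[OF sct_mem_S[OF b]] rep_sct_seg[OF b join_param_unit]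
      by (simp add: join_pt_def \<alpha>_on_S0(3)[OF b] \<beta>_on_S1(3)[OF b] prj_sct[OF W b])
  qed
qed

text \<open>The join parameter moves linearly to \<open>1/2\<close>, the point where the path passes through \<open>g\<close>. Its
  double \<open>slide\<close> stays on one side of \<open>1\<close> for each \<open>x\<close>, so only one of \<open>F\<close> and \<open>G\<close> is needed at \<open>x\<close>.\<close>

definition "slide p = 2 * join_param (snd p) * (1 - fst p) + fst p"

definition deform :: "real \<times> 'w \<Rightarrow> ('b, 'e, 'x) U" where
  "deform p = (if \<tau> (snd p) \<le> 1/2 then F (slide p, snd p) else G (2 - slide p, snd p))"

lemma slide_bounds:
  assumes "r \<in> {0..1}"
  shows "\<tau> x \<le> 1/2 \<Longrightarrow> slide (r, x) \<in> {0..1}" and "1/2 \<le> \<tau> x \<Longrightarrow> 2 - slide (r, x) \<in> {0..1}"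
proof -
  have r: "0 \<le> 1 - r" using assms by simp
  show "slide (r, x) \<in> {0..1}" if "\<tau> x \<le> 1/2"
  proof -
    have "2 * join_param x \<in> {0..1}" using that by (auto simp: join_param_def min_def max_def)
    thus ?thesis
      using assms mult_right_mono[OF _ r, of "2 * join_param x" 1]
        mult_nonneg_nonneg[OF _ r, of "2 * join_param x"]
      by (auto simp: slide_def)
  qed
  show "2 - slide (r, x) \<in> {0..1}" if "1/2 \<le> \<tau> x"
  proof -
    have "2 * join_param x \<in> {1..2}" using that by (auto simp: join_param_def min_def max_def)
    thus ?thesis
      using assms mult_right_mono[OF _ r, of "2 * join_param x" 2]
        mult_right_mono[OF _ r, of 1 "2 * join_param x"]
      by (auto simp: slide_def)
  qed
qed

lemma continuous_map_deform: "continuous_map (prod_topology unit_interval (tsp W)) (tsp K) deform"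
  unfolding deform_def
proof (rule continuous_map_cases_le)
  let ?P = "prod_topology unit_interval (tsp W)"
  have x: "continuous_map ?P (tsp W) snd" by (rule continuous_map_snd)
  show "continuous_map ?P euclideanreal (\<lambda>p. \<tau> (snd p))"
    using continuous_map_compose[OF x \<tau>] by (simp add: o_def)
  have slide: "continuous_map ?P euclideanreal slide"
    unfolding slide_def using continuous_map_compose[OF x continuous_map_join_param]
    by (intro continuous_intros continuous_map_unit_interval_real(2)) (simp_all add: o_def)
  show "continuous_map (subtopology ?P {p \<in> topspace ?P. \<tau> (snd p) \<le> 1/2}) (tsp K)
    (\<lambda>p. F (slide p, snd p))"
    by (rule continuous_map_homotopy_at[OF F])
      (use slide_bounds(1) in \<open>auto simp del: atLeastAtMost_iff simp: mem_S
        intro!: continuous_map_from_subtopology slide x\<close>)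
  show "continuous_map (subtopology ?P {p \<in> topspace ?P. 1/2 \<le> \<tau> (snd p)}) (tsp K)
    (\<lambda>p. G (2 - slide p, snd p))"
    by (rule continuous_map_homotopy_at[OF G])
      (use slide_bounds(2) in \<open>auto simp del: atLeastAtMost_iff simp: mem_S
        intro!: continuous_map_diff continuous_map_from_subtopology slide x\<close>)
  show "F (slide p, snd p) = G (2 - slide p, snd p)" if "\<tau> (snd p) = 1/2" for p
  proof -
    have mid: "2 * join_param (snd p) = 1" using that by (simp add: join_param_def)
    have "slide p = 1" unfolding slide_def mid by simp
    thus ?thesis by (simp add: F_ends G_ends)
  qed
qed simp

lemma deform_0:
  assumes "x \<in> topspace (tsp W)" shows "deform (0, x) = jmap (into_join x)"
  using assms
proof (cases rule: into_join_cases)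
  case both
  have "join_param x \<le> 1/2 \<longleftrightarrow> \<tau> x \<le> 1/2" by (auto simp: join_param_def min_def max_def)
  thus ?thesis
    using both(2) join_param_unit[of x]
      by (simp add: jmap_simps join_pt_def concat_path_def deform_def slide_def)
qed (simp_all add: jmap_simps deform_def slide_def join_param_def F_ends G_ends)

lemma deform_1: "deform (1, x) = g x"
  by (simp add: deform_def slide_def F_ends G_ends)

lemma fp_homotopic_jmap_into_join: "fp_homotopic B W K (jmap \<circ> into_join) g"
proof (rule fp_homotopicI[OF W continuous_map_deform])
  fix r :: real assume r: "r \<in> {0..1}"
  show "prj K (deform (r, x)) = prj W x" if "x \<in> topspace (tsp W)" for x
    using that F_prj[OF slide_bounds(1)[OF r]] G_prj[OF slide_bounds(2)[OF r]]
    by (simp add: deform_def mem_S)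
  show "deform (r, sct W b) = sct K b" if "b \<in> topspace B" for b
    using F_sct[OF slide_bounds(1)[OF r] that] G_sct[OF slide_bounds(2)[OF r] that]
      by (simp add: deform_def)
qed (simp_all add: deform_0 deform_1)

end

context join_data
begin

lemma fp_lifts_join_unit:
  fixes W :: "('w, 'b) fsp"
  assumes W: "fibrewise_pointed_space B W" and \<tau>: "continuous_map (tsp W) euclideanreal \<tau>"
    and \<tau>_sct: "\<And>b. b \<in> topspace B \<Longrightarrow> 0 < \<tau> (sct W b) \<and> \<tau> (sct W b) < 1"
    and left: "fp_lifts B (fsub W (pos_set W (\<lambda>x. 1 - \<tau> x))) Y K h g"
    and right: "fp_lifts B (fsub W (pos_set W \<tau>)) Z K k g"
  shows "fp_lifts B W J K jmap g"
proof -
  let ?W0 = "fsub W (pos_set W (\<lambda>x. 1 - \<tau> x))" and ?W1 = "fsub W (pos_set W \<tau>)"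
  obtain \<alpha> where \<alpha>: "fp_map B ?W0 Y \<alpha>" "fp_homotopic B ?W0 K (h \<circ> \<alpha>) g"
    using left unfolding fp_lifts_def by blast
  obtain \<beta> where \<beta>: "fp_map B ?W1 Z \<beta>" "fp_homotopic B ?W1 K (k \<circ> \<beta>) g"
    using right unfolding fp_lifts_def by blast
  obtain F where F: "continuous_map (prod_topology unit_interval (tsp ?W0)) (tsp K) F"
    "\<And>x. F (0, x) = (h \<circ> \<alpha>) x" "\<And>x. F (1, x) = g x"
    "\<And>t x. t \<in> {0..1} \<Longrightarrow> x \<in> topspace (tsp ?W0) \<Longrightarrow> prj K (F (t, x)) = prj ?W0 x"
    "\<And>t b. t \<in> {0..1} \<Longrightarrow> b \<in> topspace B \<Longrightarrow> F (t, sct ?W0 b) = sct K b"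
    by (rule fp_homotopicE[OF \<alpha>(2)]) (rule that)
  obtain G where G: "continuous_map (prod_topology unit_interval (tsp ?W1)) (tsp K) G"
    "\<And>x. G (0, x) = (k \<circ> \<beta>) x" "\<And>x. G (1, x) = g x"
    "\<And>t x. t \<in> {0..1} \<Longrightarrow> x \<in> topspace (tsp ?W1) \<Longrightarrow> prj K (G (t, x)) = prj ?W1 x"
    "\<And>t b. t \<in> {0..1} \<Longrightarrow> b \<in> topspace B \<Longrightarrow> G (t, sct ?W1 b) = sct K b"
    by (rule fp_homotopicE[OF \<beta>(2)]) (rule that)
  interpret js: join_section B Y Z K h k W g \<tau> \<alpha> \<beta> F G "pos_set W (\<lambda>x. 1 - \<tau> x)" "pos_set W \<tau>"
    by unfold_locales (use W \<tau> \<tau>_sct \<alpha>(1) \<beta>(1) F G in simp_all)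
  show ?thesis by (rule fp_liftsI[OF js.fp_map_into_join js.fp_homotopic_jmap_into_join])
qed

lemma fp_lifts_join:
  fixes W :: "('w, 'b) fsp"
  assumes W: "fibrewise_pointed_space B W"
    and v: "continuous_map (tsp W) euclideanreal v" "continuous_map (tsp W) euclideanreal w"
      "\<And>x. x \<in> topspace (tsp W) \<Longrightarrow> 0 \<le> v x \<and> 0 \<le> w x"
    and pos: "\<And>b. b \<in> topspace B \<Longrightarrow> 0 < v (sct W b) \<and> 0 < w (sct W b)"
    and left: "fp_lifts B (fsub W (pos_set W v)) Y K h g"
    and right: "fp_lifts B (fsub W (pos_set W w)) Z K k g"
  shows "fp_lifts B (fsub W (pos_set W (\<lambda>x. v x + w x))) J K jmap g"
proof -
  define S where "S = pos_set W (\<lambda>x. v x + w x)"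
  define \<tau> where "\<tau> x = w x / (v x + w x)" for x
  have "sct W ` topspace B \<subseteq> S"
    using pos sct_mem[OF W] by (force simp: S_def intro: add_pos_pos)
  hence W': "fibrewise_pointed_space B (fsub W S)" by (rule fibrewise_pointed_space_fsub[OF W])
  have "continuous_map (subtopology (tsp W) S) euclideanreal \<tau>"
    unfolding \<tau>_def
    by (intro continuous_map_real_divide continuous_map_add continuous_map_from_subtopology v)
      (auto simp: S_def)
  hence \<tau>: "continuous_map (tsp (fsub W S)) euclideanreal \<tau>" by simp
  have "1 - \<tau> x = v x / (v x + w x)" if "x \<in> S" for x
    using that by (simp add: S_def \<tau>_def field_simps)
  hence subsets: "pos_set (fsub W S) (\<lambda>x. 1 - \<tau> x) \<subseteq> pos_set W v" "pos_set (fsub W S) \<tau> \<subseteq> pos_set W w"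
    using v(3) by (auto simp: S_def \<tau>_def zero_less_divide_iff)
  have S: "pos_set (fsub W S) u \<subseteq> S" for u by auto
  have "fp_lifts B (fsub (fsub W S) (pos_set (fsub W S) (\<lambda>x. 1 - \<tau> x))) Y K h g"
    "fp_lifts B (fsub (fsub W S) (pos_set (fsub W S) \<tau>)) Z K k g"
    unfolding fsub_fsub[OF S] using subsets fp_lifts_fsub_mono[OF left] fp_lifts_fsub_mono[OF right]
        by blast+
  moreover have "0 < \<tau> (sct (fsub W S) b) \<and> \<tau> (sct (fsub W S) b) < 1" if "b \<in> topspace B" for b
    using pos[OF that] by (simp add: \<tau>_def)
  ultimately show ?thesis
    unfolding S_def[symmetric] by (intro fp_lifts_join_unit[OF W' \<tau>])
qed

end

subsection \<open>Fibre products\<close>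

definition up_fst :: "('b, 'e, 'x) U \<Rightarrow> ('b, 'e, 'x) U" where
  "up_fst u = (case u of UP x y \<Rightarrow> x | _ \<Rightarrow> undefined)"

definition up_snd :: "('b, 'e, 'x) U \<Rightarrow> ('b, 'e, 'x) U" where
  "up_snd u = (case u of UP x y \<Rightarrow> y | _ \<Rightarrow> undefined)"

lemma up_simps [simp]: "up_fst (UP x y) = x" "up_snd (UP x y) = y"
  by (simp_all add: up_fst_def up_snd_def)

lemma mem_fprod:
  "u \<in> topspace (tsp (fprod X Y)) \<longleftrightarrow>
    (\<exists>x y. u = UP x y \<and> x \<in> topspace (tsp X) \<and> y \<in> topspace (tsp Y) \<and> prj X x = prj Y y)"
  by (auto simp: fprod_def)

lemma prj_fprod [simp]: "prj (fprod X Y) (UP x y) = prj X x"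
  by (simp add: fprod_def)

lemma sct_fprod [simp]: "sct (fprod X Y) b = UP (sct X b) (sct Y b)"
  by (simp add: fprod_def)

lemma continuous_map_fprod_proj:
  "continuous_map (tsp (fprod X Y)) (tsp X) up_fst" "continuous_map (tsp (fprod X Y)) (tsp Y) up_snd"
  unfolding fprod_def fsp.simps
  by (rule continuous_compose_quotient_map[OF quotient_map_final_top],
      rule continuous_map_eq[OF continuous_map_from_subtopology[OF continuous_map_fst]]
        continuous_map_eq[OF continuous_map_from_subtopology[OF continuous_map_snd]], auto)+

lemma continuous_map_into_fprod:
  assumes "continuous_map W (tsp X) g" "continuous_map W (tsp Y) g'"
    and "\<And>w. w \<in> topspace W \<Longrightarrow> prj X (g w) = prj Y (g' w)"
  shows "continuous_map W (tsp (fprod X Y)) (\<lambda>w. UP (g w) (g' w))"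
proof -
  let ?S = "subtopology (prod_topology (tsp X) (tsp Y)) {(x, y). prj X x = prj Y y}"
  have "continuous_map W ?S (\<lambda>w. (g w, g' w))"
    by (rule continuous_map_into_subtopology) (use assms in \<open>auto simp: continuous_map_pairwise o_def\<close>)
  from continuous_map_compose[OF this
      quotient_imp_continuous_map[OF quotient_map_final_top[of ?S "\<lambda>(x, y). UP x y"]]]
  show ?thesis by (simp add: fprod_def o_def)
qed

lemma fibrewise_pointed_space_fprod:
  assumes X: "fibrewise_pointed_space B X" and Y: "fibrewise_pointed_space B Y"
  shows "fibrewise_pointed_space B (fprod X Y)"
  unfolding fibrewise_pointed_space_def
proof (intro conjI ballI)
  have "continuous_map (tsp X) B (prj X)" using X by (simp add: fibrewise_pointed_space_def)
  from continuous_map_compose[OF continuous_map_fprod_proj(1) this]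
  show "continuous_map (tsp (fprod X Y)) B (prj (fprod X Y))"
    by (rule continuous_map_eq) (auto simp: mem_fprod)
  have "continuous_map B (tsp (fprod X Y)) (\<lambda>b. UP (sct X b) (sct Y b))"
    by (rule continuous_map_into_fprod) (use X Y in \<open>auto simp: fibrewise_pointed_space_def\<close>)
  thus "continuous_map B (tsp (fprod X Y)) (sct (fprod X Y))" by (rule continuous_map_eq) simp
qed (use prj_sct[OF X] in simp)

lemma fp_map_fprod_proj: "fp_map B (fprod X Y) X up_fst" "fp_map B (fprod X Y) Y up_snd"
  unfolding fp_map_def using continuous_map_fprod_proj[of X Y] by (auto simp: mem_fprod)

lemma fp_map_pair:
  assumes "fp_map B W X g" "fp_map B W Y g'"
  shows "fp_map B W (fprod X Y) (\<lambda>w. UP (g w) (g' w))"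
  unfolding fp_map_def using assms
  by (auto simp: fp_map_def intro!: continuous_map_into_fprod)

lemma fp_homotopic_pair:
  assumes W: "fibrewise_pointed_space B W"
    and X: "fp_homotopic B W X g0 g1" and Y: "fp_homotopic B W Y g0' g1'"
  shows "fp_homotopic B W (fprod X Y) (\<lambda>w. UP (g0 w) (g0' w)) (\<lambda>w. UP (g1 w) (g1' w))"
proof -
  obtain H where H: "continuous_map (prod_topology unit_interval (tsp W)) (tsp X) H"
    "\<And>x. H (0, x) = g0 x" "\<And>x. H (1, x) = g1 x"
    "\<And>t x. t \<in> {0..1} \<Longrightarrow> x \<in> topspace (tsp W) \<Longrightarrow> prj X (H (t, x)) = prj W x"
    "\<And>t b. t \<in> {0..1} \<Longrightarrow> b \<in> topspace B \<Longrightarrow> H (t, sct W b) = sct X b"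
    by (rule fp_homotopicE[OF X]) (rule that)
  obtain G where G: "continuous_map (prod_topology unit_interval (tsp W)) (tsp Y) G"
    "\<And>x. G (0, x) = g0' x" "\<And>x. G (1, x) = g1' x"
    "\<And>t x. t \<in> {0..1} \<Longrightarrow> x \<in> topspace (tsp W) \<Longrightarrow> prj Y (G (t, x)) = prj W x"
    "\<And>t b. t \<in> {0..1} \<Longrightarrow> b \<in> topspace B \<Longrightarrow> G (t, sct W b) = sct Y b"
    by (rule fp_homotopicE[OF Y]) (rule that)
  show ?thesis
  proof (rule fp_homotopicI[OF W])
    show "continuous_map (prod_topology unit_interval (tsp W)) (tsp (fprod X Y)) (\<lambda>p. UP (H p) (G p))"
      by (rule continuous_map_into_fprod[OF H(1) G(1)]) (use H(4) G(4) in auto)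
  qed (use H(2-5) G(2-5) in auto)
qed

definition fprod_map :: "(('b, 'e, 'x) U \<Rightarrow> ('b, 'e, 'x) U) \<Rightarrow> (('b, 'e, 'x) U \<Rightarrow> ('b, 'e, 'x) U)
    \<Rightarrow> ('b, 'e, 'x) U \<Rightarrow> ('b, 'e, 'x) U" where
  "fprod_map g g' u = (case u of UP x y \<Rightarrow> UP (g x) (g' y) | _ \<Rightarrow> undefined)"

lemma fprod_map_simps [simp]: "fprod_map g g' (UP x y) = UP (g x) (g' y)"
  by (simp add: fprod_map_def)

lemma fp_map_fprod_map:
  assumes "fibrewise_pointed_space B X" "fibrewise_pointed_space B Y"
    and "fp_map B X X' g" "fp_map B Y Y' g'"
  shows "fp_map B (fprod X Y) (fprod X' Y') (fprod_map g g')"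
  by (rule fp_map_eq[OF fibrewise_pointed_space_fprod[OF assms(1,2)] fp_map_pair[OF
        fp_map_compose[OF fp_map_fprod_proj(1) assms(3)]
        fp_map_compose[OF fp_map_fprod_proj(2) assms(4)]]])
    (auto simp: mem_fprod)

lemma fp_lifts_fprod:
  assumes W: "fibrewise_pointed_space B W"
    and "fp_lifts B W Y K h g" "fp_lifts B W Y' K' h' g'"
  shows "fp_lifts B W (fprod Y Y') (fprod K K') (fprod_map h h') (\<lambda>w. UP (g w) (g' w))"
proof -
  obtain \<alpha> \<alpha>' where \<alpha>: "fp_map B W Y \<alpha>" "fp_homotopic B W K (h \<circ> \<alpha>) g"
    and \<alpha>': "fp_map B W Y' \<alpha>'" "fp_homotopic B W K' (h' \<circ> \<alpha>') g'"
    using assms(2,3) unfolding fp_lifts_def by blast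
  show ?thesis
    by (rule fp_liftsI[OF fp_map_pair[OF \<alpha>(1) \<alpha>'(1)]])
      (use fp_homotopic_pair[OF W \<alpha>(2) \<alpha>'(2)] in \<open>simp add: o_def\<close>)
qed

lemma fp_lifts_self:
  assumes "fp_map B W K g" shows "fp_lifts B W K K id g"
  by (rule fp_liftsI[OF assms]) (simp add: fp_homotopic_refl[OF assms])

lemma fibrewise_pointed_space_fpow: "fibrewise_pointed_space B X \<Longrightarrow>
  fibrewise_pointed_space B (fpow X n)"
  by (induction n) (simp_all add: fibrewise_pointed_space_fprod)

lemma diag_0: "diag 0 = id"
  by (simp add: fun_eq_iff)

lemma fp_map_diag: "fp_map B X (fpow X n) (diag n)"
proof (induction n)
  case 0 show ?case unfolding diag_0 by (simp add: fp_map_id del: id_apply)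
next
  case (Suc n) thus ?case using fp_map_pair[OF fp_map_id Suc] by simp
qed

text \<open>The coordinates of \<open>fpow X n\<close> are numbered from the right: index \<open>n\<close> is the leftmost one,
  which matches the order in which the joins are formed.\<close>

primrec coord :: "nat \<Rightarrow> nat \<Rightarrow> ('b, 'e, 'x) U \<Rightarrow> ('b, 'e, 'x) U" where
  "coord 0 i = id"
| "coord (Suc n) i = (if i = Suc n then up_fst else coord n i \<circ> up_snd)"

lemma fp_map_coord: "i \<le> n \<Longrightarrow> fp_map B (fpow X n) X (coord n i)"
proof (induction n)
  case 0 show ?case by (simp add: fp_map_id del: id_apply)
next
  case (Suc n)
  show ?case
  proof (cases "i = Suc n")
    case True thus ?thesis by (simp add: fp_map_fprod_proj(1))
  next
    case False
    thus ?thesis using fp_map_compose[OF fp_map_fprod_proj(2) Suc.IH] Suc.prems by (simp add: o_def)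
  qed
qed

lemma coord_diag: "i \<le> n \<Longrightarrow> coord n i (diag n x) = x"
  by (induction n) auto

subsection \<open>Fat wedges and Ganea spaces\<close>

lemma fatwedge_Suc:
  "fatwedge B E X f (Suc n) = fjoin B (fprod E (fpow X n)) (fprod X (fst (fatwedge B E X f n)))
     (fpow X (Suc n)) (fprod_map f id) (fprod_map id (snd (fatwedge B E X f n)))"
  by (simp add: Let_def case_prod_beta fprod_map_def[abs_def] del: fpow.simps)

lemma ganea_Suc:
  "ganea B E X f (Suc n) = fjoin B (fst (ganea B E X f n)) E X (snd (ganea B E X f n)) f"
  by (simp add: case_prod_beta)

declare fatwedge.simps(2) [simp del] ganea.simps(2) [simp del]

locale fib_map =
  fixes B :: "'b topology" and E X :: "('b, 'e, 'x) usp" and f :: "('b, 'e, 'x) U \<Rightarrow> ('b, 'e, 'x) U"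
  assumes E: "fibrewise_pointed_space B E" and X: "fibrewise_pointed_space B X" and f: "fp_map B E X f"
begin

abbreviation "T n \<equiv> fst (fatwedge B E X f n)"
abbreviation "j n \<equiv> snd (fatwedge B E X f n)"
abbreviation "G n \<equiv> fst (ganea B E X f n)"
abbreviation "p n \<equiv> snd (ganea B E X f n)"

lemma join_data_fatwedge_step:
  assumes "fibrewise_pointed_space B (T n)" "fp_map B (T n) (fpow X n) (j n)"
  shows "join_data B (fprod E (fpow X n)) (fprod X (T n)) (fpow X (Suc n)) (fprod_map f id)
    (fprod_map id (j n))"
  using assms fibrewise_pointed_space_fpow[OF X] E X f
  by (auto intro!: join_data.intro fibrewise_pointed_space_fprod fp_map_fprod_map fp_map_id)

lemma fatwedge_space_map: "fibrewise_pointed_space B (T n) \<and> fp_map B (T n) (fpow X n) (j n)"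
proof (induction n)
  case 0 show ?case using E f by simp
next
  case (Suc n)
  then interpret join_data B "fprod E (fpow X n)" "fprod X (T n)" "fpow X (Suc n)" "fprod_map f id"
      "fprod_map id (j n)"
    by (intro join_data_fatwedge_step) auto
  show ?case unfolding fatwedge_Suc using fibrewise_pointed_space_J fp_map_jmap ..
qed

lemma join_data_fatwedge:
  "join_data B (fprod E (fpow X n)) (fprod X (T n)) (fpow X (Suc n)) (fprod_map f id)
    (fprod_map id (j n))"
  using join_data_fatwedge_step fatwedge_space_map by blast

lemma ganea_space_map: "fibrewise_pointed_space B (G n) \<and> fp_map B (G n) X (p n)"
proof (induction n)
  case 0 show ?case using E f by simp
next
  case (Suc n)
  interpret join_data B "G n" E X "p n" f
    by unfold_locales (use Suc E X f in auto)
  show ?case unfolding ganea_Suc using fibrewise_pointed_space_J fp_map_jmap ..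
qed

lemma join_data_ganea: "join_data B (G n) E X (p n) f"
  by unfold_locales (use ganea_space_map E X f in auto)

context
  fixes u :: "nat \<Rightarrow> ('b, 'e, 'x) U \<Rightarrow> real" and n :: nat
  assumes u: "\<And>i. i \<le> n \<Longrightarrow> continuous_map (tsp X) euclideanreal (u i)"
      "\<And>i x. i \<le> n \<Longrightarrow> x \<in> topspace (tsp X) \<Longrightarrow> 0 \<le> u i x"
      "\<And>i b. i \<le> n \<Longrightarrow> b \<in> topspace B \<Longrightarrow> 0 < u i (sct X b)"
    and lift: "\<And>i. i \<le> n \<Longrightarrow> fp_lifts B (fsub X (pos_set X (u i))) E X f id"
begin

lemma partial_sum:
  assumes "m \<le> n"
  shows "continuous_map (tsp X) euclideanreal (\<lambda>x. \<Sum>i\<le>m. u i x)"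
    "\<And>x. x \<in> topspace (tsp X) \<Longrightarrow> 0 \<le> (\<Sum>i\<le>m. u i x)"
    "\<And>b. b \<in> topspace B \<Longrightarrow> 0 < (\<Sum>i\<le>m. u i (sct X b))"
proof -
  show "continuous_map (tsp X) euclideanreal (\<lambda>x. \<Sum>i\<le>m. u i x)"
    by (intro continuous_map_sum u) (use assms in auto)
  show "0 \<le> (\<Sum>i\<le>m. u i x)" if "x \<in> topspace (tsp X)" for x
    by (rule sum_nonneg) (use that u(2) assms in auto)
  show "0 < (\<Sum>i\<le>m. u i (sct X b))" if "b \<in> topspace B" for b
    by (rule sum_pos) (use that u(3) assms in auto)
qed

lemma pos_set_sum_0: "pos_set X (\<lambda>x. \<Sum>i\<le>0. u i x) = pos_set X (u 0)"
  by simp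

lemma fp_lifts_ganea:
  "m \<le> n \<Longrightarrow> fp_lifts B (fsub X (pos_set X (\<lambda>x. \<Sum>i\<le>m. u i x))) (G m) X (p m) id"
proof (induction m)
  case 0 show ?case unfolding pos_set_sum_0 ganea.simps(1) fst_conv snd_conv by (rule lift[OF le0])
next
  case (Suc m)
  interpret join_data B "G m" E X "p m" f by (rule join_data_ganea)
  have m: "m \<le> n" using Suc.prems by simp
  have "fp_lifts B (fsub X (pos_set X (\<lambda>x. (\<Sum>i\<le>m. u i x) + u (Suc m) x))) J X jmap id"
    by (rule fp_lifts_join[OF X _ _ _ _ Suc.IH[OF m] lift[OF Suc.prems]])
      (use Suc.prems partial_sum[OF m] u in auto)
  thus ?case unfolding ganea_Suc sum.atMost_Suc .
qed

lemma fp_lifts_fatwedge: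
  "m \<le> n \<Longrightarrow> fp_lifts B (fsub X (pos_set X (\<lambda>x. \<Sum>i\<le>m. u i x))) (T m) (fpow X m) (j m) (diag m)"
proof (induction m)
  case 0 show ?case
    unfolding pos_set_sum_0 diag_0 fpow.simps(1) fatwedge.simps(1) fst_conv snd_conv
        by (rule lift[OF le0])
next
  case (Suc m)
  interpret join_data B "fprod E (fpow X m)" "fprod X (T m)" "fpow X (Suc m)" "fprod_map f id"
      "fprod_map id (j m)"
    by (rule join_data_fatwedge)
  have m: "m \<le> n" using Suc.prems by simp
  have space: "fibrewise_pointed_space B (fsub X (pos_set X v))"
    if "\<And>b. b \<in> topspace B \<Longrightarrow> 0 < v (sct X b)" for v
    by (rule fibrewise_pointed_space_fsub[OF X]) (use that sct_mem[OF X] in auto)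
  have diag: "diag (Suc m) = (\<lambda>x. UP (id x) (diag m x))" by simp
  have left: "fp_lifts B (fsub X (pos_set X (u (Suc m)))) (fprod E (fpow X m)) (fpow X (Suc m))
      (fprod_map f id) (diag (Suc m))"
    unfolding diag fpow.simps
    by (intro fp_lifts_fprod space lift u fp_lifts_self fp_map_restrict fp_map_diag Suc.prems)
  have right: "fp_lifts B (fsub X (pos_set X (\<lambda>x. \<Sum>i\<le>m. u i x))) (fprod X (T m)) (fpow X (Suc m))
      (fprod_map id (j m)) (diag (Suc m))"
    unfolding diag fpow.simps
    by (intro fp_lifts_fprod space partial_sum(3) fp_lifts_self fp_map_restrict fp_map_id Suc.IH m)
  have "fp_lifts B (fsub X (pos_set X (\<lambda>x. u (Suc m) x + (\<Sum>i\<le>m. u i x)))) J (fpow X (Suc m)) jmap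
    (diag (Suc m))"
    by (rule fp_lifts_join[OF X _ _ _ _ left right]) (use Suc.prems partial_sum[OF m] u in auto)
  thus ?case by (simp add: fatwedge_Suc add.commute del: fpow.simps diag.simps)
qed

end

context
  fixes V c V' c'
  assumes X_halo: "section_halo B X V c" and E_halo: "section_halo B E V' c'"
begin

interpretation lift_data B E X f V c
  using E X f X_halo by unfold_locales

lemma lift_cover_domain: "lift_cover E (\<lambda>_. f) {i}"
  unfolding lift_cover_def using local_lift_domain[OF E_halo] by auto

lemma lift_cover_ganea: "lift_cover (G n) (\<lambda>_. p n) {..n}"
proof (induction n)
  case 0 show ?case using lift_cover_domain[of 0] by simp
next
  case (Suc n)
  have "lift_cover (G (Suc n)) (\<lambda>_. id \<circ> p (Suc n)) ({..n} \<union> {Suc n})"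
    unfolding ganea_Suc
    by (rule lift_cover_join[OF join_data_ganea, where \<pi> = "\<lambda>_. id"])
      (use Suc lift_cover_domain in \<open>simp_all add: fp_map_id\<close>)
  thus ?case by (simp add: atMost_Suc)
qed

lemma lift_cover_fatwedge: "lift_cover (T n) (\<lambda>i. coord n i \<circ> j n) {..n}"
proof (induction n)
  case 0 show ?case using lift_cover_domain[of 0] by simp
next
  case (Suc n)
  note join = join_data_fatwedge[of n]
  have left: "lift_cover (fprod E (fpow X n)) (\<lambda>i. coord (Suc n) i \<circ> fprod_map f id) {Suc n}"
    by (rule lift_cover_pullback[OF lift_cover_domain join_data.Y[OF join] fp_map_fprod_proj(1)])
      (auto simp: mem_fprod)
  have right: "lift_cover (fprod X (T n)) (\<lambda>i. coord (Suc n) i \<circ> fprod_map id (j n)) {..n}"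
    by (rule lift_cover_pullback[OF Suc join_data.Z[OF join] fp_map_fprod_proj(2)])
      (auto simp: mem_fprod)
  have "lift_cover (T (Suc n)) (\<lambda>i. coord (Suc n) i \<circ> j (Suc n)) ({Suc n} \<union> {..n})"
    unfolding fatwedge_Suc
    by (rule lift_cover_join[OF join left right])
      (auto intro!: fp_map_coord simp del: fpow.simps coord.simps)
  thus ?case by (simp add: atMost_Suc o_def)
qed

lemma secat_le_if_fp_lifts_ganea:
  assumes "fp_lifts B X (G n) X (p n) id" shows "secat_le B E X f n"
proof -
  obtain \<sigma> where "fp_map B X (G n) \<sigma>" "fp_homotopic B X X (p n \<circ> \<sigma>) id"
    using assms unfolding fp_lifts_def by blast
  thus ?thesis by (rule secat_le_if_lift_cover[OF lift_cover_ganea])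
qed

lemma secat_le_if_fp_lifts_fatwedge:
  assumes "fp_lifts B X (T n) (fpow X n) (j n) (diag n)" shows "secat_le B E X f n"
proof -
  obtain \<phi> where \<phi>: "fp_map B X (T n) \<phi>" "fp_homotopic B X (fpow X n) (j n \<circ> \<phi>) (diag n)"
    using assms unfolding fp_lifts_def by blast
  show ?thesis
  proof (rule secat_le_if_lift_cover[OF lift_cover_fatwedge \<phi>(1)])
    fix i assume i: "i \<le> n"
    show "fp_homotopic B X X (coord n i \<circ> j n \<circ> \<phi>) id"
      by (rule fp_homotopic_eq[OF X fp_homotopic_compose_left[OF \<phi>(2) fp_map_coord[OF i]]])
        (simp_all add: coord_diag[OF i])
  qed
qed

end

end

subsection \<open>Normality\<close>

definition bump_function :: "'a topology \<Rightarrow> 'a set \<Rightarrow> 'a set \<Rightarrow> ('a \<Rightarrow> real) \<Rightarrow> bool" where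
  "bump_function T U D w \<longleftrightarrow> continuous_map T euclideanreal w \<and>
     (\<forall>x\<in>topspace T. 0 \<le> w x \<and> (0 < w x \<longrightarrow> x \<in> U)) \<and> (\<forall>x\<in>D. w x = 1)"

lemma normal_space_bump_function:
  assumes T: "normal_space T" and "openin T U" "closedin T D" "D \<subseteq> U"
  shows "\<exists>w. bump_function T U D w"
proof -
  have "closedin T (topspace T - U)" "disjnt (topspace T - U) D"
    using assms by (auto simp: disjnt_def)
  then obtain w where w: "continuous_map T (top_of_set {0..1::real}) w" "w ` (topspace T - U) \<subseteq> {0}"
      "w ` D \<subseteq> {1}"
    using Urysohn_lemma[OF T, of "topspace T - U" D 0 1] assms(3) by auto
  have "x \<in> U" if "x \<in> topspace T" "0 < w x" for x
    using w(2) that by (cases "x \<in> U") auto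
  hence "bump_function T U D w"
    using w(1,3) by (auto simp: bump_function_def continuous_map_in_subtopology)
  thus ?thesis by blast
qed

lemma normal_space_subordinate_bump_functions:
  fixes T :: "'a topology"
  assumes T: "normal_space T" and S: "closedin T S" and "finite I"
    and "\<And>i. i \<in> I \<Longrightarrow> openin T (U i) \<and> S \<subseteq> U i" and "closedin T C" "C \<subseteq> (\<Union>i\<in>I. U i)"
  shows "\<exists>u. (\<forall>i\<in>I. bump_function T (U i) S (u i)) \<and> (\<forall>x\<in>C. \<exists>i\<in>I. 0 < u i x)"
  using assms(3-)
proof (induction I arbitrary: C rule: finite_induct)
  case empty thus ?case by simp
next
  case (insert i I)
  define D where "D = C - (\<Union>j\<in>I. U j)"
  have "closedin T (D \<union> S)" "D \<union> S \<subseteq> U i"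
    using insert.prems S by (auto simp: D_def intro!: closedin_diff closedin_Un openin_Union)
  then obtain w where w: "bump_function T (U i) (D \<union> S) w"
    using normal_space_bump_function[OF T] insert.prems(1)[of i] by blast
  define C' where "C' = C \<inter> {x \<in> topspace T. w x \<in> {..1/2}}"
  have "closedin T C'"
    unfolding C'_def using w insert.prems(2)
    by (intro closedin_Int closedin_continuous_map_preimage[of T euclideanreal])
      (auto simp: bump_function_def)
  moreover have "C' \<subseteq> (\<Union>j\<in>I. U j)" using w by (force simp: C'_def D_def bump_function_def)
  ultimately obtain u where u: "\<forall>j\<in>I. bump_function T (U j) S (u j)" "\<forall>x\<in>C'. \<exists>j\<in>I. 0 < u j x"
    using insert.IH[of C'] insert.prems(1) by auto
  have "\<exists>j\<in>insert i I. 0 < (u(i := w)) j x" if x: "x \<in> C" for x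
  proof (cases "x \<in> C'")
    case True
    then obtain j where "j \<in> I" "0 < u j x" using u(2) by blast
    thus ?thesis using insert.hyps(2) by (intro bexI[of _ j]) auto
  next
    case False
    hence "w x > 1/2" using x closedin_subset[OF insert.prems(2)] by (auto simp: C'_def)
    thus ?thesis by simp
  qed
  moreover have "bump_function T (U i) S w" using w by (simp add: bump_function_def)
  ultimately show ?case using u(1) by (intro exI[of _ "u(i := w)"]) auto
qed

subsection \<open>Fibrewise sectional category\<close>

lemma secat_le_mono:
  assumes "secat_le B E X f m" "m \<le> n" shows "secat_le B E X f n"
proof -
  obtain U where U: "(\<Union>i\<le>m. U i) = topspace (tsp X)"
    "\<And>i. i \<le> m \<Longrightarrow> openin (tsp X) (U i) \<and> sct X ` topspace B \<subseteq> U i \<and> fp_lifts B (fsub X (U i)) E X f id"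
    using assms(1) unfolding secat_le_iff_fp_lifts by blast
  have "i \<in> (\<lambda>i. min i m) ` {..n}" if "i \<le> m" for i
    using that assms(2) by (intro image_eqI[of _ _ i]) auto
  hence "(\<lambda>i. min i m) ` {..n} = {..m}" by auto
  hence "(\<Union>i\<le>n. U (min i m)) = (\<Union>i\<le>m. U i)" by (metis image_image)
  thus ?thesis unfolding secat_le_iff_fp_lifts using U by (intro exI[of _ "\<lambda>i. U (min i m)"]) simp
qed

lemma secat_le_enat_iff: "secat B E X f \<le> enat n \<longleftrightarrow> secat_le B E X f n"
proof
  assume le: "secat B E X f \<le> enat n"
  let ?A = "{enat n |n. secat_le B E X f n}"
  have "?A \<noteq> {}" using le unfolding secat_def by (auto simp: Inf_enat_def split: if_splits)
  hence "Inf ?A \<in> ?A" unfolding Inf_enat_def by (metis (mono_tags, lifting) LeastI_ex ex_in_conv)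
  then obtain m where "Inf ?A = enat m" "secat_le B E X f m" by blast
  thus "secat_le B E X f n" using le secat_le_mono by (simp add: secat_def)
qed (auto simp: secat_def intro: Inf_lower)

context fib_map
begin

lemma fp_lifts_if_secat_le:
  assumes normal: "normal_space (tsp X)" and closed: "closedin (tsp X) (sct X ` topspace B)"
    and sec: "secat_le B E X f n"
  shows "fp_lifts B X (T n) (fpow X n) (j n) (diag n)" "fp_lifts B X (G n) X (p n) id"
proof -
  obtain U where U: "(\<Union>i\<le>n. U i) = topspace (tsp X)"
    and U_i: "\<forall>i\<le>n. openin (tsp X) (U i) \<and> sct X ` topspace B \<subseteq> U i \<and>
        fp_lifts B (fsub X (U i)) E X f id"
    using sec unfolding secat_le_iff_fp_lifts by blast
  have "\<exists>u. (\<forall>i\<in>{..n}. bump_function (tsp X) (U i) (sct X ` topspace B) (u i)) \<and>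
      (\<forall>x\<in>topspace (tsp X). \<exists>i\<in>{..n}. 0 < u i x)"
    by (rule normal_space_subordinate_bump_functions[OF normal closed]) (use U U_i in auto)
  then obtain u where bump: "\<forall>i\<in>{..n}. bump_function (tsp X) (U i) (sct X ` topspace B) (u i)"
    and cover: "\<forall>x\<in>topspace (tsp X). \<exists>i\<in>{..n}. 0 < u i x" by blast
  have u: "continuous_map (tsp X) euclideanreal (u i)" "x \<in> topspace (tsp X) \<Longrightarrow> 0 \<le> u i x"
    "b \<in> topspace B \<Longrightarrow> 0 < u i (sct X b)" "pos_set X (u i) \<subseteq> U i" if "i \<le> n" for i x b
    using bump that by (auto simp: bump_function_def)
  have lift: "fp_lifts B (fsub X (pos_set X (u i))) E X f id" if "i \<le> n" for i
    using fp_lifts_fsub_mono[OF _ u(4)[OF that]] U_i that by blast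
  have "0 < (\<Sum>i\<le>n. u i x)" if x: "x \<in> topspace (tsp X)" for x
  proof -
    obtain i where "i \<le> n" "0 < u i x" using cover x by auto
    thus ?thesis using u(2) x by (intro sum_pos2[of _ i]) auto
  qed
  hence "fsub X (pos_set X (\<lambda>x. \<Sum>i\<le>n. u i x)) = X" by (simp cong: conj_cong)
  thus "fp_lifts B X (T n) (fpow X n) (j n) (diag n)" "fp_lifts B X (G n) X (p n) id"
    using fp_lifts_fatwedge[of n u, OF u(1-3) lift order_refl]
      fp_lifts_ganea[of n u, OF u(1-3) lift order_refl]
    by simp_all
qed

theorem secat_le_iff_fatwedge_ganea:
  assumes "normal_space (tsp X)" "closedin (tsp X) (sct X ` topspace B)"
    and "section_halo B X V c" "section_halo B E V' c'"
  shows "secat_le B E X f n \<longleftrightarrow> fp_lifts B X (T n) (fpow X n) (j n) (diag n)"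
    and "secat_le B E X f n \<longleftrightarrow> fp_lifts B X (G n) X (p n) id"
  using fp_lifts_if_secat_le[OF assms(1,2)] secat_le_if_fp_lifts_fatwedge[OF assms(3,4)]
    secat_le_if_fp_lifts_ganea[OF assms(3,4)] by blast+

end

subsection \<open>Passing to the universe of points\<close>

lemma fp_iso_liftE: "fp_iso B E (liftE E) UE (\<lambda>u. case u of UE e \<Rightarrow> e | _ \<Rightarrow> undefined)"
  by (rule fp_iso_final_top) (simp_all add: liftE_def)

lemma fp_iso_liftX: "fp_iso B X (liftX X) UX (\<lambda>u. case u of UX x \<Rightarrow> x | _ \<Rightarrow> undefined)"
  by (rule fp_iso_final_top) (simp_all add: liftX_def)

lemma liftf_UE: "liftf f (UE e) = UX (f e)"
  by (simp add: liftf_def)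

lemma fib_map_lift:
  assumes E: "fibrewise_pointed_space B E" and X: "fibrewise_pointed_space B X" and f: "fp_map B E X f"
  shows "fib_map B (liftE E :: ('b, 'e, 'x) usp) (liftX X) (liftf f)"
proof
  show E': "fibrewise_pointed_space B (liftE E :: ('b, 'e, 'x) usp)"
    and "fibrewise_pointed_space B (liftX X :: ('b, 'e, 'x) usp)"
    by (rule fibrewise_pointed_space_iso[OF E fp_iso_liftE]
        fibrewise_pointed_space_iso[OF X fp_iso_liftX])+
  have "fp_map B (liftE E) (liftX X) (UX \<circ> (f \<circ> (\<lambda>u. case u of UE e \<Rightarrow> e | _ \<Rightarrow> undefined)))"
    using fp_iso_liftE[of B E] fp_iso_liftX[of B X] f by (auto simp: fp_iso_def intro!: fp_map_compose)
  thus "fp_map B (liftE E :: ('b, 'e, 'x) usp) (liftX X) (liftf f)"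
    by (rule fp_map_eq[OF E']) (auto simp: liftE_def liftf_UE)
qed

lemma well_pointed_imp_halo_universe:
  fixes X' :: "('b, 'e, 'x) usp"
  assumes X: "fibrewise_pointed_space B X" and wp: "fib_well_pointed B X TYPE(('b, 'e, 'x) U)"
    and iso: "fp_iso B X X' i r" and i: "inj i"
  shows "\<exists>V c. section_halo B X' V c"
proof -
  have "inj (\<lambda>(x, t). UC (i x) t)" using i by (auto simp: inj_on_def)
  from well_pointed_imp_halo[OF this X wp] show ?thesis
    using section_halo_iso[OF _ iso fibrewise_pointed_space_iso[OF X iso]] by blast
qed

theorem theorem3p7:
  fixes B :: "'b topology"
    and E :: "('e, 'b) fsp" and X :: "('x, 'b) fsp" and f :: "'e \<Rightarrow> 'x"
    and n :: nat
  defines "E' \<equiv> (liftE E :: ('b, 'e, 'x) usp)"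
      and "X' \<equiv> (liftX X :: ('b, 'e, 'x) usp)"
      and "f' \<equiv> (liftf f :: ('b, 'e, 'x) U \<Rightarrow> ('b, 'e, 'x) U)"
  assumes "fibrewise_pointed_space B E" and "fibrewise_pointed_space B X"
    and "fp_map B E X f"
    and "fib_well_pointed B E TYPE(('b, 'e, 'x) U)"
    and "fib_well_pointed B X TYPE(('b, 'e, 'x) U)"
    and "(normal_space (tsp E) \<and> normal_space (tsp X)) \<or>
         (fp_closed_cofibration B E X f TYPE(('b, 'e, 'x) U) \<and> normal_space (tsp X))"
  shows "(secat B E X f \<le> enat n \<longleftrightarrow>
            (\<exists>\<phi>. fp_map B X' (fst (fatwedge B E' X' f' n)) \<phi> \<and>
                 fp_homotopic B X' (fpow X' n) (snd (fatwedge B E' X' f' n) \<circ> \<phi>) (diag n)))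
       \<and> (secat B E X f \<le> enat n \<longleftrightarrow>
            (\<exists>\<sigma>. fp_map B X' (fst (ganea B E' X' f' n)) \<sigma> \<and>
                 fp_homotopic B X' X' (snd (ganea B E' X' f' n) \<circ> \<sigma>) id))"
proof -
  interpret fib_map B E' X' f'
    unfolding E'_def X'_def f'_def by (rule fib_map_lift[OF assms(4-6)])
  have isoE: "fp_iso B E E' UE (\<lambda>u. case u of UE e \<Rightarrow> e | _ \<Rightarrow> undefined)"
    and isoX: "fp_iso B X X' UX (\<lambda>u. case u of UX x \<Rightarrow> x | _ \<Rightarrow> undefined)"
    unfolding E'_def X'_def by (rule fp_iso_liftE fp_iso_liftX)+
  have normal: "normal_space (tsp X')"
    using assms(9) homeomorphic_normal_space[of "tsp X" "tsp X'"] fp_iso_homeomorphic_maps[OF isoX]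
    unfolding homeomorphic_space_def by blast
  have closed: "closedin (tsp X') (sct X' ` topspace B)"
    using closedin_sct_iso[OF isoX] assms(8) by (simp add: fib_well_pointed_def)
  obtain V c V' c' where halos: "section_halo B X' V c" "section_halo B E' V' c'"
    using well_pointed_imp_halo_universe[OF assms(5,8) isoX]
      well_pointed_imp_halo_universe[OF assms(4,7) isoE]
    by (auto simp: inj_def)
  have "secat_le B E' X' f' n \<longleftrightarrow> secat_le B E X f n"
    unfolding f'_def by (rule secat_le_iso[OF isoE isoX assms(5) X assms(6) liftf_UE])
  thus ?thesis
    using secat_le_iff_fatwedge_ganea[OF normal closed halos, of n]
    unfolding secat_le_enat_iff fp_lifts_def by simp
qed

end
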